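(* The weighted resolution set (WeRe set) is a topological invariant of pseudo DP tangles: if $d_\infty$ and $d'_\infty$ are pseudo DP diagrams of pseudo DP equivalent pseudo DP tangles, then the WeRe sets of $d_\infty$ and $d'_\infty$ coincide, where the first entries of the ordered pairs (classical DP tangles) are considered up to DP isotopy.
   Context: **Pseudo diagrams.** $I=[0,1]$, $T^2$ is the torus, $\mathbb{E}^2$ the Euclidean plane. A pseudo link diagram in $T^2$ is a regular link diagram (finitely many transverse double points) in which each double point is either a classical crossing (with over/under information) or a precrossing (over/under information missing, i.e. unknown). Pseudo Reidemeister equivalence is generated by surface isotopy, the classical Reidemeister moves R1, R2, R3, and all versions of the pseudo Reidemeister moves: PR1 (creation or removal of a kink whose only double point is a precrossing); PR2 (in a two-strand twist consisting of one classical crossing and one precrossing, the order of the two is interchanged, keeping the type of the classical crossing); PR3, PR3$'$ (an arc passing entirely over, respectively entirely under, the two arcs of a precrossing is slid across the precrossing). **Pseudo DP diagrams.** Let $(u,v)$ be a basis of $\mathbb{E}^2$ and $\rho:\mathbb{E}^2\to T^2$ the universal covering map assigning a longitude $l$ to $u$ and a meridian $m$ to $v$. For a pseudo link diagram $d$ in $T^2$, the lifting $d_\infty$ of $d$ under $\rho$ is a pseudo DP diagram and $d$ is a pseudo motif of $d_\infty$ (a flat pseudo motif when viewed in the parallelogram obtained by cutting $T^2$ along $(l,m)$). The set $\Lambda=\{xu+yv:x,y\in\mathbb{Z}\}$ is a supporting lattice and $d=d_\infty/\Lambda$. **Homologous precrossings.** Two precrossings of $d_\infty$ (or of a finite cover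 of $d$) are homologous if they lie in the preimage of the same precrossing of $d$; they bear the same missing information. The set of precrossings of $d_\infty$ is thus partitioned into classes of homologous precrossings, and this marking is part of the data of $d_\infty$ and of finite covers of $d$. **Classical DP tangles.** A classical DP tangle is the lift to $\mathbb{E}^2\times I$, under the universal covering map $\mathbb{E}^2\times I\to T^2\times I$, of a link in $T^2\times I$. Two DP tangles are DP isotopic if they are related via an ambient isotopy of $\mathbb{E}^2\times I$ that preserves double periodicity; this includes orientation-preserving invertible affine transformations of the plane carrying the tangles along. **Pseudo DP tangles and their equivalence.** A toroidal pseudo link diagram lifts to a spatial pseudo link in $T^2\times I$: classical crossings are placed in small 3-balls with the over arc in the upper boundary and the under arc in the lower boundary, precrossings are supported by small rigid embedded discs, and the remaining arcs are embedded. A pseudo DP tangle is the lifting of such a spatial pseudo link under $\tilde\rho:\mathbb{E}^2\times I\to T^2\times I$ (the trivial extension of $\rho$); equivalently it is the spatial lift of a pseudo DP diagram, with the same missing information on homologous precrossings. Two pseudo DP tangles are pseudo DP equivalent (pseudo DP isotopic) if they are related via an ambient isotopy of the thickened plane, respecting arc and disc isotopies, that preserves double periodicity. As a convention recalled from the theory of toroidal pseudo links, isotopy of spatial pseudo links in $T^2\times I$ corresponds to pseudo Reidemeister equivalence of their diagrams in $T^2$ (so it includes PR1). On the level of motifs, pseudo DP equivalence is generated by: pseudo Reidemeister equivalence in $T^2$ (surface isotopies and classical and pseudo Reidemeister moves); shifts of the longitude-meridian pair; re-scalings of the torus (inflations and deflations); Dehn twists; and pseudo cover equivalence, i.e. replacing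 $d_\infty/\Lambda_1$ by $d_\infty/\Lambda_2$ for lattices $\Lambda_1,\Lambda_2$ of $d_\infty$ both contained in a lattice $\Lambda_0$ of $d_\infty$, the lattices being compatible with the marking of homologous precrossings. **Resolutions and WeRe set.** A resolution of a pseudo DP diagram $d_\infty$ is a classical DP tangle obtained by assigning to every precrossing belonging to the same class of homologous precrossings the same type of crossing (positive or negative). The weighted resolution set (WeRe set) of $d_\infty$ is the collection of ordered pairs $(d^i_\infty,p_i)$, where $d^i_\infty$ is a resolution of $d_\infty$ and $p_i$ is the probability of obtaining from $d_\infty$ the equivalence class (under DP isotopy) of $d^i_\infty$ through a random assignment of crossing types to the classes of homologous precrossings (one type per class), with equal likelihood for positive and negative crossings. *)

theory Defs
  imports "HOL-Probability.Probability"
begin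

text \<open>
  The torus \<open>T\<^sup>2\<close> is always presented as the quotient of the plane by a lattice \<open>\<Lambda>\<close>, and objects on
  \<open>T\<^sup>2\<close> or \<open>T\<^sup>2 \<times> I\<close> as \<open>\<Lambda>\<close>-periodic objects in the plane or in the thickened plane. The basis \<open>(u, v)\<close>
  itself is not stored: two bases of the same lattice give the same quotient.
\<close>

type_synonym plane = "real \<times> real"
type_synonym space = "plane \<times> real"

definition lattice_of :: "plane \<Rightarrow> plane \<Rightarrow> plane set" where
  "lattice_of u v = {of_int x *\<^sub>R u + of_int y *\<^sub>R v | x y :: int. True}"

definition is_lattice :: "plane set \<Rightarrow> bool" where
  "is_lattice \<Lambda> \<longleftrightarrow> (\<exists>u v. u \<noteq> v \<and> independent {u, v} \<and> \<Lambda> = lattice_of u v)"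

definition shift :: "plane \<Rightarrow> space \<Rightarrow> space" where
  "shift w k = (fst k + w, snd k)"

definition orientation_preserving_affine :: "(plane \<Rightarrow> plane) \<Rightarrow> plane \<Rightarrow> bool" where
  \<comment> \<open>the affine map \<open>\<lambda>x. L x + w\<close>\<close>
  "orientation_preserving_affine L w \<longleftrightarrow>
     (\<exists>a b c d. a * d - b * c > 0 \<and> L = (\<lambda>p. (a * fst p + b * snd p, c * fst p + d * snd p)))"


section \<open>Classical DP tangles and DP isotopy\<close>

text \<open>
  Links lie in the interior of \<open>T\<^sup>2 \<times> I\<close>. The lift of a link is a closed periodic 1-dimensional
  submanifold. Tameness is not part of the definition: it is preserved by ambient isotopy and is
  automatic for the spatial lift of a diagram.
\<close>

definition DP_tangle_over :: "plane set \<Rightarrow> space set \<Rightarrow> bool" where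
  "DP_tangle_over \<Lambda> T \<longleftrightarrow>
     is_lattice \<Lambda> \<and> T \<subseteq> UNIV \<times> {0<..<1} \<and> closed T \<and>
     (\<forall>w\<in>\<Lambda>. shift w ` T = T) \<and>
     (\<forall>p\<in>T. \<exists>U. openin (top_of_set T) U \<and> p \<in> U \<and> U homeomorphic (UNIV :: real set))"

definition DP_tangle :: "space set \<Rightarrow> bool" where
  "DP_tangle T \<longleftrightarrow> (\<exists>\<Lambda>. DP_tangle_over \<Lambda> T)"

abbreviation thickened_plane :: "space set" where
  "thickened_plane \<equiv> UNIV \<times> {0..1}"

text \<open>
  An ambient isotopy preserves double periodicity if at each time it carries the translations by some
  lattice of the tangle to the translations by a lattice, which may vary with time.
\<close>

definition DP_preserving_isotopy :: "plane set \<Rightarrow> (real \<Rightarrow> space \<Rightarrow> space) \<Rightarrow> bool" where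
  "DP_preserving_isotopy \<Lambda> H \<longleftrightarrow>
     continuous_on ({0..1} \<times> thickened_plane) (\<lambda>(t, p). H t p) \<and>
     (\<forall>t\<in>{0..1}. \<exists>G. homeomorphism thickened_plane thickened_plane (H t) G) \<and>
     (\<forall>p\<in>thickened_plane. H 0 p = p) \<and>
     (\<forall>t\<in>{0..1}. \<exists>A. linear A \<and> inj A \<and>
        (\<forall>w\<in>\<Lambda>. \<forall>p\<in>thickened_plane. H t (shift w p) = shift (A w) (H t p)))"

definition DP_move :: "space set \<Rightarrow> space set \<Rightarrow> bool" where
  "DP_move S T \<longleftrightarrow> DP_tangle S \<and> DP_tangle T \<and>
     ((\<exists>\<Lambda> H. DP_tangle_over \<Lambda> S \<and> DP_preserving_isotopy \<Lambda> H \<and> H 1 ` S = T) \<or>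
      (\<exists>L w. orientation_preserving_affine L w \<and> T = (\<lambda>p. (L (fst p) + w, snd p)) ` S))"

text \<open>The equivalence closure allows consecutive isotopies to use different lattices of a tangle.\<close>

definition DP_isotopic :: "space set \<Rightarrow> space set \<Rightarrow> bool" where
  "DP_isotopic = equivclp DP_move"

definition DP_isotopy_class :: "space set \<Rightarrow> space set set" where
  "DP_isotopy_class T = {T'. DP_isotopic T T'}"


section \<open>Pseudo DP diagrams\<close>

text \<open>
  A diagram curve in the plane is given by a curve \<open>strands\<close> in \<open>plane \<times> real\<close> whose projection \<open>fst\<close> to
  the plane is the drawn curve. The last coordinate carries no crossing information; it only keeps the
  two strands through a double point apart, so that they can be referred to. The crossing information
  is in \<open>overs\<close>, which contains the upper one of the two strand points over each classical crossing. A
  precrossing is a double point neither of whose strand points is in \<open>overs\<close>.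

  For a strand point \<open>k\<close> over a precrossing, \<open>fst (marking k)\<close> names the class of homologous
  precrossings, and \<open>snd (marking k)\<close> tells whether the crossing is positive (\<open>True\<close>) or negative
  (\<open>False\<close>) when \<open>k\<close> is taken as the upper strand point. The values of \<open>marking\<close> elsewhere are
  irrelevant. Diagrams are not oriented, so which of the two types of a class is called positive is a
  convention; the names of classes and this convention can be changed (\<open>renaming\<close> below).
\<close>

record pseudo_diagram =
  strands :: "space set"
  overs :: "space set"
  marking :: "space \<Rightarrow> nat \<times> bool"

definition crossings :: "pseudo_diagram \<Rightarrow> plane set" where
  "crossings D = {x. \<exists>k\<in>strands D. \<exists>l\<in>strands D. k \<noteq> l \<and> fst k = x \<and> fst l = x}"

definition prepoints :: "pseudo_diagram \<Rightarrow> space set" where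
  "prepoints D = {k\<in>strands D. \<exists>l\<in>strands D. k \<noteq> l \<and> fst k = fst l \<and> k \<notin> overs D \<and> l \<notin> overs D}"

definition over_part :: "space set \<Rightarrow> plane set \<Rightarrow> space set" where
  "over_part K W = {k\<in>K. fst k \<in> W}"

text \<open>Transversality, in the topological category: a chart of the plane takes the two branches to the
  two coordinate axes.\<close>

definition simple_at :: "space set \<Rightarrow> plane \<Rightarrow> bool" where
  "simple_at K x \<longleftrightarrow>
     (\<exists>W g g' h. open W \<and> x \<in> W \<and> homeomorphism W (UNIV :: plane set) g g' \<and>
        homeomorphism (over_part K W) (UNIV \<times> {0}) (g \<circ> fst) h)"

definition transverse_double_at :: "space set \<Rightarrow> plane \<Rightarrow> bool" where
  "transverse_double_at K x \<longleftrightarrow>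
     (\<exists>W g g' A B h h'. open W \<and> x \<in> W \<and> homeomorphism W (UNIV :: plane set) g g' \<and> g x = (0, 0) \<and>
        over_part K W = A \<union> B \<and> A \<inter> B = {} \<and>
        openin (top_of_set (over_part K W)) A \<and> openin (top_of_set (over_part K W)) B \<and>
        homeomorphism A (UNIV \<times> {0}) (g \<circ> fst) h \<and>
        homeomorphism B ({0} \<times> UNIV) (g \<circ> fst) h')"

text \<open>
  \<open>motif \<Lambda> D\<close>: the lattice \<open>\<Lambda>\<close> supports \<open>D\<close> and is compatible with its marking, so that \<open>D\<close> modulo
  \<open>\<Lambda>\<close> is a marked pseudo link diagram in the torus. A class of homologous precrossings is a union of
  \<open>\<Lambda>\<close>-orbits, possibly of several ones (as happens in a finite cover).
\<close>

definition motif :: "plane set \<Rightarrow> pseudo_diagram \<Rightarrow> bool" where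
  "motif \<Lambda> D \<longleftrightarrow>
     is_lattice \<Lambda> \<and> closed (strands D) \<and> bounded (snd ` strands D) \<and>
     (\<forall>w\<in>\<Lambda>. shift w ` strands D = strands D \<and> shift w ` overs D = overs D \<and>
        (\<forall>k\<in>prepoints D. marking D (shift w k) = marking D k)) \<and>
     (\<forall>x\<in>fst ` strands D. simple_at (strands D) x \<or> transverse_double_at (strands D) x) \<and>
     (\<exists>F. finite F \<and> crossings D \<subseteq> {x + w | x w. x \<in> F \<and> w \<in> \<Lambda>}) \<and>
     overs D \<subseteq> over_part (strands D) (crossings D) \<and> inj_on fst (overs D) \<and>
     (\<forall>k\<in>prepoints D. \<forall>l\<in>prepoints D. k \<noteq> l \<and> fst k = fst l \<longrightarrow>
        fst (marking D k) = fst (marking D l) \<and> snd (marking D k) \<noteq> snd (marking D l))"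

text \<open>A pseudo DP diagram is the lift of a pseudo link diagram in the torus: precrossings are
  homologous exactly if they lie over the same precrossing in the torus.\<close>

definition pseudo_DP_diagram :: "pseudo_diagram \<Rightarrow> bool" where
  "pseudo_DP_diagram D \<longleftrightarrow>
     (\<exists>\<Lambda>. motif \<Lambda> D \<and>
       (\<forall>k\<in>prepoints D. \<forall>l\<in>prepoints D.
          fst (marking D k) = fst (marking D l) \<longleftrightarrow> (\<exists>w\<in>\<Lambda>. fst l = fst k + w)))"


section \<open>Moves on motifs\<close>

definition restrict_diagram :: "pseudo_diagram \<Rightarrow> plane set \<Rightarrow> pseudo_diagram" where
  "restrict_diagram D W = D\<lparr>strands := over_part (strands D) W, overs := over_part (overs D) W\<rparr>"

text \<open>\<open>carries g D D'\<close>: \<open>D'\<close> is the image of \<open>D\<close> under the map \<open>g\<close> of the plane, up to the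
  inessential last coordinate of the strands.\<close>

definition carries :: "(plane \<Rightarrow> plane) \<Rightarrow> pseudo_diagram \<Rightarrow> pseudo_diagram \<Rightarrow> bool" where
  "carries g D D' \<longleftrightarrow>
     (\<exists>\<theta> \<theta>'. homeomorphism (strands D) (strands D') \<theta> \<theta>' \<and>
        (\<forall>k\<in>strands D. fst (\<theta> k) = g (fst k) \<and> (\<theta> k \<in> overs D' \<longleftrightarrow> k \<in> overs D)) \<and>
        (\<forall>k\<in>prepoints D. marking D' (\<theta> k) = marking D k))"

text \<open>The lift to the plane of an isotopy of the torus starting at the identity.\<close>

definition torus_isotopy :: "plane set \<Rightarrow> (real \<Rightarrow> plane \<Rightarrow> plane) \<Rightarrow> bool" where
  "torus_isotopy \<Lambda> H \<longleftrightarrow>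
     continuous_on ({0..1} \<times> UNIV) (\<lambda>(t, x). H t x) \<and>
     (\<forall>t\<in>{0..1}. \<exists>G. homeomorphism UNIV UNIV (H t) G) \<and>
     (\<forall>x. H 0 x = x) \<and>
     (\<forall>t\<in>{0..1}. \<forall>w\<in>\<Lambda>. \<forall>x. H t (x + w) = H t x + w)"

definition renaming :: "pseudo_diagram \<Rightarrow> pseudo_diagram \<Rightarrow> bool" where
  "renaming D D' \<longleftrightarrow> strands D' = strands D \<and> overs D' = overs D \<and>
     (\<exists>\<rho> flip. inj (\<rho> :: nat \<Rightarrow> nat) \<and>
        (\<forall>k\<in>prepoints D.
           marking D' k = (\<rho> (fst (marking D k)), snd (marking D k) \<noteq> flip (fst (marking D k)))))"

text \<open>
  Each (pseudo) Reidemeister move replaces one model diagram in the square \<open>box\<close> by another one, where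
  the square is embedded in the torus in an arbitrary way. Embeddings may reverse the orientation, so
  a model stands for its mirror images, too.
\<close>

definition box :: "plane set" where
  "box = {-1..1} \<times> {-1..1}"

definition open_box :: "plane set" where
  "open_box = {-1<..<1} \<times> {-1<..<1}"

definition local_move ::
  "plane set \<Rightarrow> pseudo_diagram \<Rightarrow> pseudo_diagram \<Rightarrow> pseudo_diagram \<Rightarrow> pseudo_diagram \<Rightarrow> bool" where
  "local_move \<Lambda> M M' D D' \<longleftrightarrow>
     (\<exists>\<phi>. continuous_on box \<phi> \<and> inj_on \<phi> box \<and>
        (\<forall>w\<in>\<Lambda> - {0}. \<phi> ` box \<inter> (\<lambda>x. x + w) ` \<phi> ` box = {}) \<and>
        carries \<phi> M (restrict_diagram D (\<phi> ` box)) \<and>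
        carries \<phi> M' (restrict_diagram D' (\<phi> ` box)) \<and>
        (let C = - {\<phi> q + w | q w. q \<in> open_box \<and> w \<in> \<Lambda>} in
           over_part (strands D) C = over_part (strands D') C \<and>
           over_part (overs D) C = over_part (overs D') C \<and>
           (\<forall>k\<in>over_part (prepoints D) C. marking D k = marking D' k)))"

text \<open>Most models consist of graphs over \<open>{-1..1}\<close>; the last coordinate numbers the strands.\<close>

definition strand_graph :: "real \<Rightarrow> (real \<Rightarrow> real) \<Rightarrow> space set" where
  "strand_graph i f = {((x, f x), i) | x. x \<in> {-1..1}}"

text \<open>The marking of a model with one precrossing: taking strand \<open>i\<close> as the upper one gives the
  crossing of type \<open>b\<close>.\<close>

definition mark_strand :: "nat \<Rightarrow> bool \<Rightarrow> real \<Rightarrow> space \<Rightarrow> nat \<times> bool" where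
  "mark_strand c b i k = (c, (snd k = i) = b)"

definition no_marks :: "space \<Rightarrow> nat \<times> bool" where
  "no_marks k = (0, False)"

text \<open>A nodal cubic arc with its double point \<open>(0, 1/4)\<close> at the parameters \<open>\<plusminus> 1 / sqrt 2\<close>. The last
  coordinate is the parameter.\<close>

definition kink :: "space set" where
  "kink = {((2 * s ^ 3 - s, (1 - s\<^sup>2) / 2), s) | s. s \<in> {-1..1}}"

definition straight :: pseudo_diagram where
  "straight = \<lparr>strands = strand_graph 0 (\<lambda>x. 0), overs = {}, marking = no_marks\<rparr>"

definition classical_kink :: pseudo_diagram where
  "classical_kink = \<lparr>strands = kink, overs = {((0, 1/4), 1 / sqrt 2)}, marking = no_marks\<rparr>"

definition pre_kink :: "nat \<Rightarrow> bool \<Rightarrow> pseudo_diagram" where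
  "pre_kink c b = \<lparr>strands = kink, overs = {}, marking = mark_strand c b (1 / sqrt 2)\<rparr>"

text \<open>Two strands crossing each other at \<open>(-1/2, 0)\<close> and at \<open>(1/2, 0)\<close>.\<close>

definition twist_strands :: "space set" where
  "twist_strands = strand_graph 0 (\<lambda>x. \<bar>x\<bar> - 1/2) \<union> strand_graph 1 (\<lambda>x. 1/2 - \<bar>x\<bar>)"

definition parallel_strands :: pseudo_diagram where
  "parallel_strands =
     \<lparr>strands = strand_graph 0 (\<lambda>x. 1/2) \<union> strand_graph 1 (\<lambda>x. -1/2), overs = {}, marking = no_marks\<rparr>"

definition clasp :: pseudo_diagram where
  "clasp = \<lparr>strands = twist_strands, overs = {((-1/2, 0), 0), ((1/2, 0), 0)}, marking = no_marks\<rparr>"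

text \<open>
  The classical crossing is on the left, respectively on the right, and its over strand is descending
  from left to right in both cases. Thus it keeps its type, although the over strand is the strand 0
  in the first model and the strand 1 in the second one. In the same way, at the precrossing it is the
  descending strand that gives type \<open>b\<close> if it is the upper one.
\<close>

definition twist_pre_right :: "nat \<Rightarrow> bool \<Rightarrow> pseudo_diagram" where
  "twist_pre_right c b =
     \<lparr>strands = twist_strands, overs = {((-1/2, 0), 0)}, marking = mark_strand c b 1\<rparr>"

definition twist_pre_left :: "nat \<Rightarrow> bool \<Rightarrow> pseudo_diagram" where
  "twist_pre_left c b =
     \<lparr>strands = twist_strands, overs = {((1/2, 0), 1)}, marking = mark_strand c b 0\<rparr>"

text \<open>
  The strands 0 and 1 cross in the origin, and strand 2 passes above (\<open>\<sigma> = 1\<close>) or below (\<open>\<sigma> = -1\<close>) the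
  origin in the picture; \<open>upper\<close> tells whether strand 2 runs over or under the strands 0 and 1.
\<close>

definition triangle_strands :: "real \<Rightarrow> space set" where
  "triangle_strands \<sigma> =
     strand_graph 0 (\<lambda>x. x / 2) \<union> strand_graph 1 (\<lambda>x. - x / 2) \<union>
     strand_graph 2 (\<lambda>x. \<sigma> * (1 - \<bar>x\<bar>) / 2)"

definition slide_overs :: "bool \<Rightarrow> real \<Rightarrow> space set" where
  "slide_overs upper \<sigma> =
     (if upper then {((\<sigma> / 2, \<sigma> / 4), 2), ((- \<sigma> / 2, \<sigma> / 4), 2)}
      else {((\<sigma> / 2, \<sigma> / 4), 0), ((- \<sigma> / 2, \<sigma> / 4), 1)})"

definition classical_triangle :: "bool \<Rightarrow> real \<Rightarrow> pseudo_diagram" where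
  "classical_triangle upper \<sigma> =
     \<lparr>strands = triangle_strands \<sigma>, overs = insert ((0, 0), 0) (slide_overs upper \<sigma>),
      marking = no_marks\<rparr>"

definition pre_triangle :: "nat \<Rightarrow> bool \<Rightarrow> bool \<Rightarrow> real \<Rightarrow> pseudo_diagram" where
  "pre_triangle c b upper \<sigma> =
     \<lparr>strands = triangle_strands \<sigma>, overs = slide_overs upper \<sigma>, marking = mark_strand c b 0\<rparr>"

inductive reidemeister_model :: "pseudo_diagram \<Rightarrow> pseudo_diagram \<Rightarrow> bool" where
  R1: "reidemeister_model classical_kink straight"
| R2: "reidemeister_model clasp parallel_strands"
| R3: "reidemeister_model (classical_triangle upper 1) (classical_triangle upper (-1))"
| PR1: "reidemeister_model (pre_kink c b) straight"
| PR2: "reidemeister_model (twist_pre_right c b) (twist_pre_left c b)"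
| PR3: "reidemeister_model (pre_triangle c b True 1) (pre_triangle c b True (-1))"
| PR3': "reidemeister_model (pre_triangle c b False 1) (pre_triangle c b False (-1))"

text \<open>
  The generators of pseudo DP equivalence on motifs, where the pair \<open>(D, \<Lambda>)\<close> stands for the motif of
  \<open>D\<close> modulo \<open>\<Lambda>\<close>. Shifts of the longitude-meridian pair, re-scalings of the torus and Dehn twists act
  on the universal cover by translations, scalings and shears; all of them are instances of \<open>affine\<close>.
\<close>

inductive motif_move :: "pseudo_diagram \<times> plane set \<Rightarrow> pseudo_diagram \<times> plane set \<Rightarrow> bool" where
  surface_isotopy:
    "\<lbrakk>motif \<Lambda> D; motif \<Lambda> D'; torus_isotopy \<Lambda> H; carries (H 1) D D'\<rbrakk>
       \<Longrightarrow> motif_move (D, \<Lambda>) (D', \<Lambda>)"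
| renaming:
    "\<lbrakk>motif \<Lambda> D; motif \<Lambda> D'; renaming D D'\<rbrakk> \<Longrightarrow> motif_move (D, \<Lambda>) (D', \<Lambda>)"
| reidemeister:
    "\<lbrakk>motif \<Lambda> D; motif \<Lambda> D'; reidemeister_model M M'; local_move \<Lambda> M M' D D'\<rbrakk>
       \<Longrightarrow> motif_move (D, \<Lambda>) (D', \<Lambda>)"
| affine:
    "\<lbrakk>motif \<Lambda> D; motif (L ` \<Lambda>) D'; orientation_preserving_affine L w; carries (\<lambda>x. L x + w) D D'\<rbrakk>
       \<Longrightarrow> motif_move (D, \<Lambda>) (D', L ` \<Lambda>)"
| cover:
    "\<lbrakk>motif \<Lambda>\<^sub>0 D; motif \<Lambda>\<^sub>1 D; motif \<Lambda>\<^sub>2 D; \<Lambda>\<^sub>1 \<subseteq> \<Lambda>\<^sub>0; \<Lambda>\<^sub>2 \<subseteq> \<Lambda>\<^sub>0\<rbrakk>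
       \<Longrightarrow> motif_move (D, \<Lambda>\<^sub>1) (D, \<Lambda>\<^sub>2)"

text \<open>Equivalence of the pseudo DP tangles that are the spatial lifts of \<open>D\<close> and \<open>D'\<close>, expressed through
  motifs.\<close>

definition pseudo_DP_equivalent :: "pseudo_diagram \<Rightarrow> pseudo_diagram \<Rightarrow> bool" where
  "pseudo_DP_equivalent D D' \<longleftrightarrow>
     (\<exists>\<Lambda> \<Lambda>'. motif \<Lambda> D \<and> motif \<Lambda>' D' \<and> equivclp motif_move (D, \<Lambda>) (D', \<Lambda>'))"


section \<open>Resolutions and the WeRe set\<close>

text \<open>\<open>\<epsilon>\<close> assigns a type to every class of homologous precrossings (\<open>True\<close> is positive).\<close>

definition resolve :: "(nat \<Rightarrow> bool) \<Rightarrow> pseudo_diagram \<Rightarrow> pseudo_diagram" where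
  "resolve \<epsilon> D =
     D\<lparr>overs := overs D \<union> {k\<in>prepoints D. snd (marking D k) = \<epsilon> (fst (marking D k))}\<rparr>"

text \<open>A spatial lift of a diagram without precrossings; \<open>f\<close> gives the heights of the strands.\<close>

definition spatial_lift :: "pseudo_diagram \<Rightarrow> space set \<Rightarrow> bool" where
  "spatial_lift D T \<longleftrightarrow> DP_tangle T \<and>
     (\<exists>f. continuous_on (strands D) f \<and>
        (\<forall>k\<in>strands D. \<forall>l\<in>strands D. k \<noteq> l \<and> fst k = fst l \<and> k \<in> overs D \<longrightarrow> f l < f k) \<and>
        T = (\<lambda>k. (fst k, f k)) ` strands D)"

definition resolution :: "pseudo_diagram \<Rightarrow> (nat \<Rightarrow> bool) \<Rightarrow> space set \<Rightarrow> bool" where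
  "resolution D \<epsilon> T \<longleftrightarrow> spatial_lift (resolve \<epsilon> D) T"

definition precrossing_classes :: "pseudo_diagram \<Rightarrow> nat set" where
  "precrossing_classes D = (\<lambda>k. fst (marking D k)) ` prepoints D"

text \<open>Independent fair choices of the types of the classes of homologous precrossings.\<close>

definition random_assignment :: "pseudo_diagram \<Rightarrow> (nat \<Rightarrow> bool) pmf" where
  "random_assignment D = Pi_pmf (precrossing_classes D) False (\<lambda>_. bernoulli_pmf (1/2))"

definition WeRe :: "pseudo_diagram \<Rightarrow> (space set \<times> real) set" where
  "WeRe D = {(T, p). (\<exists>\<epsilon>. resolution D \<epsilon> T) \<and>
     p = measure_pmf.prob (random_assignment D) {\<epsilon>. \<exists>T'. resolution D \<epsilon> T' \<and> DP_isotopic T T'}}"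

definition up_to_DP_isotopy :: "(space set \<times> real) set \<Rightarrow> (space set set \<times> real) set" where
  "up_to_DP_isotopy P = (\<lambda>(T, p). (DP_isotopy_class T, p)) ` P"

end

theory Submission imports Defs begin

text \<open>
  For every generator of the equivalence other than a change of marking, the same assignment of types to
  the precrossing classes yields DP isotopic resolutions of both diagrams. A surface isotopy or an affine
  map carries the heights of the strands along. For a Reidemeister move, the lifts of one diagram with the
  same crossing data are related by a periodic vertical isotopy, so the heights inside the box of the move
  may be chosen at will; for suitable heights the strands in the box are moved, with ends fixed, by a
  chain of linear motions that keep distinct points apart. Such a motion extends to a homeomorphism of the
  box that is isotopic to the identity, and its lattice translates are inserted into the thickened plane.
  The events \<open>the resolution is isotopic to T\<close> therefore agree, and so do their
  probabilities, because such an event depends only on the classes that occur in both diagrams. A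
  renaming of the classes with changes of sign carries fair independent choices to fair independent ones.
\<close>

text \<open>The obstacle that shapes the treatment of heights: a resolution is a
  \<open>DP_tangle\<close> over some lattice of its own, which need not be \<Lambda>, while the
  moves are made \<Lambda>-periodically. If there is a crossing, the two lattices are commensurable,
  because both preserve the discrete set of crossings; averaging the heights over a finite quotient
  of \<Lambda> makes them periodic and respects the over/under order. Without crossings there is no
  order to respect, and constant heights serve. No isotopy extension theorem is used. Ambient
  isotopies come only from planar isotopies, from increasing maps of the vertical columns, and from
  maps of the form identity plus contraction. Hence the Lipschitz form of the motions and the
  explicit numerical separations in every model. The heights on the edge of a box are dictated by
  the rest of the diagram. Each model is therefore treated for arbitrary edge heights
  \<open>e\<close>; heights are chosen only in the middle of the strands, where all double points
  lie.\<close>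

declare split_paired_All [simp del] split_paired_Ex [simp del]

section \<open>Lattices\<close>

lemma lattice_basis:
  assumes "is_lattice \<Lambda>"
  obtains u v where "u \<noteq> v" "independent {u, v}" "\<Lambda> = lattice_of u v"
  using assms unfolding is_lattice_def by blast

lemma lattice_of_mem: "of_int x *\<^sub>R u + of_int y *\<^sub>R v \<in> lattice_of u v"
  unfolding lattice_of_def by blast

lemma lattice_zero: "is_lattice \<Lambda> \<Longrightarrow> 0 \<in> \<Lambda>"
  by (metis lattice_basis lattice_of_mem of_int_0 scaleR_zero_left add_0)

lemma lattice_add:
  assumes "is_lattice \<Lambda>" "w \<in> \<Lambda>" "w' \<in> \<Lambda>"
  shows "w + w' \<in> \<Lambda>"
proof -
  obtain u v where L: "\<Lambda> = lattice_of u v" using assms(1) by (rule lattice_basis)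
  obtain a b c d :: int
    where "w = of_int a *\<^sub>R u + of_int b *\<^sub>R v" "w' = of_int c *\<^sub>R u + of_int d *\<^sub>R v"
    using assms(2,3) unfolding L lattice_of_def by blast
  then have "w + w' = of_int (a + c) *\<^sub>R u + of_int (b + d) *\<^sub>R v"
    by (simp add: algebra_simps)
  then show ?thesis unfolding L using lattice_of_mem by metis
qed

lemma lattice_scale_int:
  assumes "is_lattice \<Lambda>" "w \<in> \<Lambda>"
  shows "of_int n *\<^sub>R w \<in> \<Lambda>"
proof -
  obtain u v where L: "\<Lambda> = lattice_of u v" using assms(1) by (rule lattice_basis)
  obtain a b :: int where "w = of_int a *\<^sub>R u + of_int b *\<^sub>R v"
    using assms(2) unfolding L lattice_of_def by blast
  then have "of_int n *\<^sub>R w = of_int (n * a) *\<^sub>R u + of_int (n * b) *\<^sub>R v"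
    by (simp add: algebra_simps)
  then show ?thesis unfolding L using lattice_of_mem by metis
qed

lemma lattice_scale_nat: "is_lattice \<Lambda> \<Longrightarrow> w \<in> \<Lambda> \<Longrightarrow> real n *\<^sub>R w \<in> \<Lambda>"
  using lattice_scale_int[of \<Lambda> w "int n"] by simp

lemma lattice_uminus: "is_lattice \<Lambda> \<Longrightarrow> w \<in> \<Lambda> \<Longrightarrow> - w \<in> \<Lambda>"
  using lattice_scale_int[of \<Lambda> w "-1"] by simp

lemma lattice_diff: "is_lattice \<Lambda> \<Longrightarrow> w \<in> \<Lambda> \<Longrightarrow> w' \<in> \<Lambda> \<Longrightarrow> w - w' \<in> \<Lambda>"
  using lattice_add[of \<Lambda> w "- w'"] lattice_uminus[of \<Lambda> w'] by simp

lemma basis_coordinates: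
  fixes u v :: plane
  assumes "u \<noteq> v" "independent {u, v}"
  shows "inj (\<lambda>p :: plane. fst p *\<^sub>R u + snd p *\<^sub>R v)"
    and "\<exists>a b. x = a *\<^sub>R u + b *\<^sub>R v"
proof -
  have "card {u, v} = 2" using assms(1) by simp
  then have "UNIV \<subseteq> span {u, v}"
    using assms(2) by (intro card_ge_dim_independent) auto
  then show ex: "\<exists>a b. x = a *\<^sub>R u + b *\<^sub>R v" for x
  proof -
    have "x \<in> span {u, v}" using \<open>UNIV \<subseteq> span {u, v}\<close> by blast
    then obtain a where "x - a *\<^sub>R u \<in> span {v}" using span_breakdown_eq by blast
    then obtain b where "x - a *\<^sub>R u = b *\<^sub>R v" unfolding span_singleton by blast
    then have "x = a *\<^sub>R u + b *\<^sub>R v" by (simp add: algebra_simps)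
    then show ?thesis by blast
  qed
  have lin: "linear (\<lambda>p :: plane. fst p *\<^sub>R u + snd p *\<^sub>R v)"
    by (intro linearI) (auto simp: algebra_simps)
  have "surj (\<lambda>p :: plane. fst p *\<^sub>R u + snd p *\<^sub>R v)"
  proof (unfold surj_def, intro allI)
    fix y
    obtain a b where "y = a *\<^sub>R u + b *\<^sub>R v" using ex by blast
    then show "\<exists>x. y = fst x *\<^sub>R u + snd x *\<^sub>R v"
      by (intro exI[of _ "(a, b)"]) simp
  qed
  then show "inj (\<lambda>p :: plane. fst p *\<^sub>R u + snd p *\<^sub>R v)"
    using lin linear_surjective_imp_injective by blast
qed

text \<open>The coordinate map of a basis is injective and linear, hence bounded below, so a bound
  on the vector bounds both integer coordinates. The offset \<open>x\<close> makes this the local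
  finiteness statement for lattice sums and for translates of a compact set.\<close>

lemma lattice_finite_bounded:
  assumes "is_lattice \<Lambda>"
  shows "finite {w \<in> \<Lambda>. norm (w + x) \<le> r}"
proof -
  obtain u v where uv: "u \<noteq> v" "independent {u, v}" and L: "\<Lambda> = lattice_of u v"
    using assms by (rule lattice_basis)
  have lin: "linear (\<lambda>p :: plane. fst p *\<^sub>R u + snd p *\<^sub>R v)"
    by (intro linearI) (auto simp: algebra_simps)
  obtain B where B: "B > 0" "\<And>p :: plane. B * norm p \<le> norm (fst p *\<^sub>R u + snd p *\<^sub>R v)"
    using linear_inj_bounded_below_pos[OF lin basis_coordinates(1)[OF uv]]
    by (metis mult.commute)
  define N where "N = \<lceil>(r + norm x) / B\<rceil>"
  have "{w \<in> \<Lambda>. norm (w + x) \<le> r} \<subseteq>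
      (\<lambda>(a, b). of_int a *\<^sub>R u + of_int b *\<^sub>R v) ` ({-N..N} \<times> {-N..N})"
  proof
    fix w assume "w \<in> {w \<in> \<Lambda>. norm (w + x) \<le> r}"
    then have w: "w \<in> \<Lambda>" "norm (w + x) \<le> r" by auto
    obtain a b :: int where ab: "w = of_int a *\<^sub>R u + of_int b *\<^sub>R v"
      using w unfolding L lattice_of_def by blast
    have "norm w \<le> r + norm x" using w norm_triangle_ineq4[of "w + x" x] by simp
    then have "B * norm (real_of_int a, real_of_int b) \<le> r + norm x"
      using B(2)[of "(of_int a, of_int b)"] ab by simp
    then have "norm (real_of_int a, real_of_int b) \<le> (r + norm x) / B"
      using B(1) by (simp add: field_simps)
    moreover have "\<bar>real_of_int a\<bar> \<le> norm (real_of_int a, real_of_int b)"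
      "\<bar>real_of_int b\<bar> \<le> norm (real_of_int a, real_of_int b)"
      using norm_fst_le[of "real_of_int a" "real_of_int b"]
        norm_snd_le[of "real_of_int b" "real_of_int a"] by auto
    ultimately have "\<bar>real_of_int a\<bar> \<le> N" "\<bar>real_of_int b\<bar> \<le> N"
      unfolding N_def by linarith+
    then have "a \<in> {-N..N}" "b \<in> {-N..N}" by auto
    then show "w \<in> (\<lambda>(a, b). of_int a *\<^sub>R u + of_int b *\<^sub>R v) ` ({-N..N} \<times> {-N..N})"
      using ab by (auto intro!: image_eqI[of _ _ "(a, b)"])
  qed
  then show ?thesis by (rule finite_subset) auto
qed

lemma lattice_cocompact:
  assumes "is_lattice \<Lambda>"
  obtains R where "R > 0" "\<And>x. \<exists>w\<in>\<Lambda>. norm (x + w) \<le> R"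
proof -
  obtain u v where uv: "u \<noteq> v" "independent {u, v}" and L: "\<Lambda> = lattice_of u v"
    using assms by (rule lattice_basis)
  \<comment> \<open>Rounding both coordinates down leaves fractional parts in the unit interval; the
    summand 1 only makes the radius positive.\<close>
  have "\<exists>w\<in>\<Lambda>. norm (x + w) \<le> norm u + norm v + 1" for x
  proof -
    obtain a b where ab: "x = a *\<^sub>R u + b *\<^sub>R v" using basis_coordinates(2)[OF uv] by blast
    define w where "w = of_int (- \<lfloor>a\<rfloor>) *\<^sub>R u + of_int (- \<lfloor>b\<rfloor>) *\<^sub>R v"
    have "x + w = (a - of_int \<lfloor>a\<rfloor>) *\<^sub>R u + (b - of_int \<lfloor>b\<rfloor>) *\<^sub>R v"
      unfolding ab w_def by (simp add: algebra_simps)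
    also have "norm \<dots> \<le> \<bar>a - of_int \<lfloor>a\<rfloor>\<bar> * norm u + \<bar>b - of_int \<lfloor>b\<rfloor>\<bar> * norm v"
      by (metis norm_triangle_ineq norm_scaleR)
    also have "\<dots> \<le> 1 * norm u + 1 * norm v"
      by (intro add_mono mult_right_mono) (auto, linarith+)
    finally have "norm (x + w) \<le> norm u + norm v + 1" by simp
    moreover have "w \<in> \<Lambda>" unfolding w_def L by (rule lattice_of_mem)
    ultimately show ?thesis by blast
  qed
  then show ?thesis using that[of "norm u + norm v + 1"] by (smt (verit) norm_ge_zero)
qed

lemma lattice_linear_image:
  assumes "is_lattice \<Lambda>" "linear A" "inj A"
  shows "is_lattice (A ` \<Lambda>)"
proof -
  obtain u v where uv: "u \<noteq> v" "independent {u, v}" and L: "\<Lambda> = lattice_of u v"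
    using assms(1) by (rule lattice_basis)
  have "independent (A ` {u, v})"
    by (rule linear_independent_injective_image[OF assms(2) uv(2) inj_on_subset[OF assms(3) subset_UNIV]])
  moreover have "A u \<noteq> A v" using uv assms(3) by (meson injD)
  moreover have "A ` \<Lambda> = lattice_of (A u) (A v)"
  proof -
    have *: "A (of_int x *\<^sub>R u + of_int y *\<^sub>R v) = of_int x *\<^sub>R A u + of_int y *\<^sub>R A v" for x y :: int
      by (simp only: linear_add[OF assms(2)] linear_scale[OF assms(2)])
    show ?thesis
    proof (intro equalityI subsetI)
      fix z assume "z \<in> A ` \<Lambda>"
      then obtain x y :: int where "z = A (of_int x *\<^sub>R u + of_int y *\<^sub>R v)"
        unfolding L lattice_of_def by blast
      then show "z \<in> lattice_of (A u) (A v)" by (simp only: * lattice_of_mem)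
    next
      fix z assume "z \<in> lattice_of (A u) (A v)"
      then obtain x y :: int where "z = of_int x *\<^sub>R A u + of_int y *\<^sub>R A v"
        unfolding lattice_of_def by blast
      then show "z \<in> A ` \<Lambda>" by (simp only: *[symmetric] L lattice_of_mem imageI)
    qed
  qed
  ultimately have "A u \<noteq> A v \<and> independent {A u, A v} \<and> A ` \<Lambda> = lattice_of (A u) (A v)"
    by simp
  then show ?thesis unfolding is_lattice_def by (intro exI)
qed

section \<open>Tangles and their images\<close>

lemma shift_zero [simp]: "shift 0 k = k"
  by (simp add: shift_def)

lemma shift_shift [simp]: "shift w (shift w' k) = shift (w + w') k"
  by (simp add: shift_def ac_simps)

lemma fst_shift [simp]: "fst (shift w k) = fst k + w"
  and snd_shift [simp]: "snd (shift w k) = snd k"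
  by (simp_all add: shift_def)

lemma inj_shift: "inj (shift w)"
  by (rule injI) (auto simp: shift_def prod_eq_iff)

lemma continuous_on_shift [continuous_intros]:
  "continuous_on S f \<Longrightarrow> continuous_on S g \<Longrightarrow> continuous_on S (\<lambda>x. shift (f x) (g x))"
  unfolding shift_def by (intro continuous_intros)

lemma shift_invariantI:
  assumes "is_lattice \<Lambda>" "\<And>w k. w \<in> \<Lambda> \<Longrightarrow> k \<in> T \<Longrightarrow> shift w k \<in> T" "w \<in> \<Lambda>"
  shows "shift w ` T = T"
proof
  show "shift w ` T \<subseteq> T" using assms by blast
  show "T \<subseteq> shift w ` T"
  proof
    fix k assume "k \<in> T"
    then have "shift (- w) k \<in> T" using assms lattice_uminus by blast
    then show "k \<in> shift w ` T" by (intro image_eqI[of _ _ "shift (- w) k"]) auto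
  qed
qed

text \<open>One time slice of an isotopy that preserves double periodicity, with the linear map on
  the lattice made explicit. It also covers affine maps and inverses of slices, which are not
  presented as ends of isotopies here.\<close>

definition DP_homeo :: "plane set \<Rightarrow> (plane \<Rightarrow> plane) \<Rightarrow> (space \<Rightarrow> space) \<Rightarrow> (space \<Rightarrow> space) \<Rightarrow> bool" where
  "DP_homeo \<Lambda> A h h' \<longleftrightarrow> homeomorphism thickened_plane thickened_plane h h' \<and> linear A \<and> inj A \<and>
     (\<forall>w\<in>\<Lambda>. \<forall>p\<in>thickened_plane. h (shift w p) = shift (A w) (h p))"

lemma DP_tangle_over_image:
  assumes T: "DP_tangle_over \<Lambda> T" and h: "DP_homeo \<Lambda> A h h'" and int: "h ` T \<subseteq> UNIV \<times> {0<..<1}"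
  shows "DP_tangle_over (A ` \<Lambda>) (h ` T)"
proof -
  have lat: "is_lattice \<Lambda>" and sub: "T \<subseteq> UNIV \<times> {0<..<1}" and cl: "closed T"
    and inv: "\<And>w. w \<in> \<Lambda> \<Longrightarrow> shift w ` T = T"
    and loc: "\<And>p. p \<in> T \<Longrightarrow> \<exists>U. openin (top_of_set T) U \<and> p \<in> U \<and> U homeomorphic (UNIV :: real set)"
    using T unfolding DP_tangle_over_def by auto
  have hom: "homeomorphism thickened_plane thickened_plane h h'" and A: "linear A" "inj A"
    and com: "\<And>w p. w \<in> \<Lambda> \<Longrightarrow> p \<in> thickened_plane \<Longrightarrow> h (shift w p) = shift (A w) (h p)"
    using h unfolding DP_homeo_def by auto
  have sub': "T \<subseteq> thickened_plane" using sub by fastforce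
  have homT: "homeomorphism T (h ` T) h h'"
    using homeomorphism_of_subsets[OF hom sub' _ refl] sub' by blast
  have "closedin (top_of_set thickened_plane) (h ` T)"
    using homeomorphism_imp_closed_map[OF hom] cl sub'
    by (metis closed_subset)
  moreover have "closed (thickened_plane)" by (intro closed_Times) auto
  ultimately have "closed (h ` T)" using closedin_closed_trans by blast
  moreover have "is_lattice (A ` \<Lambda>)" using lattice_linear_image lat A by blast
  moreover have "shift w ` h ` T = h ` T" if w: "w \<in> A ` \<Lambda>" for w
  proof -
    obtain w' where w': "w' \<in> \<Lambda>" "w = A w'" using w by blast
    have "shift w ` h ` T = h ` shift w' ` T"
      unfolding image_image using com[OF w'(1)] sub' w'(2) by (intro image_cong) auto
    then show ?thesis using inv[OF w'(1)] by simp
  qed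
  moreover have "\<exists>U. openin (top_of_set (h ` T)) U \<and> p \<in> U \<and> U homeomorphic (UNIV :: real set)"
    if p: "p \<in> h ` T" for p
  proof -
    obtain q where q: "q \<in> T" "p = h q" using p by blast
    obtain U where U: "openin (top_of_set T) U" "q \<in> U" "U homeomorphic (UNIV :: real set)"
      using loc q by blast
    have "openin (top_of_set (h ` T)) (h ` U)"
      using homeomorphism_imp_open_map[OF homT U(1)] .
    moreover have "homeomorphism U (h ` U) h h'"
      using homeomorphism_of_subsets[OF homT _ _ refl] U(1) openin_imp_subset by blast
    then have "h ` U homeomorphic (UNIV :: real set)"
      using U(3) homeomorphic_trans homeomorphic_sym homeomorphic_def by metis
    ultimately show ?thesis using q U(2) by blast
  qed
  ultimately show ?thesis unfolding DP_tangle_over_def using int by blast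
qed

lemma DP_isotopic_refl [simp]: "DP_isotopic T T"
  by (simp add: DP_isotopic_def)

lemma DP_isotopic_sym: "DP_isotopic S T \<Longrightarrow> DP_isotopic T S"
  unfolding DP_isotopic_def by (rule equivclp_sym)

lemma DP_isotopic_trans: "DP_isotopic S T \<Longrightarrow> DP_isotopic T U \<Longrightarrow> DP_isotopic S U"
  unfolding DP_isotopic_def by (rule equivclp_trans)

lemma DP_preserving_isotopy_homeo:
  assumes "DP_preserving_isotopy \<Lambda> H" "t \<in> {0..1}"
  shows "\<exists>A G. DP_homeo \<Lambda> A (H t) G"
proof -
  have "\<exists>G. homeomorphism thickened_plane thickened_plane (H t) G"
    using assms unfolding DP_preserving_isotopy_def by (elim conjE) (drule (1) bspec)
  moreover have "\<exists>A. linear A \<and> inj A \<and>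
        (\<forall>w\<in>\<Lambda>. \<forall>p\<in>thickened_plane. H t (shift w p) = shift (A w) (H t p))"
    using assms unfolding DP_preserving_isotopy_def by (elim conjE) (drule (1) bspec)+
  ultimately show ?thesis unfolding DP_homeo_def by (elim exE) (intro exI conjI, auto)
qed

lemma DP_isotopic_isotopy:
  assumes "DP_tangle_over \<Lambda> S" "DP_preserving_isotopy \<Lambda> H" "H 1 ` S \<subseteq> UNIV \<times> {0<..<1}"
  shows "DP_isotopic S (H 1 ` S)"
    and "\<exists>A. linear A \<and> inj A \<and> DP_tangle_over (A ` \<Lambda>) (H 1 ` S)"
proof -
  have "(1::real) \<in> {0..1}" by simp
  from DP_preserving_isotopy_homeo[OF assms(2) this] obtain A G where h: "DP_homeo \<Lambda> A (H 1) G"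
    by blast
  have "linear A \<and> inj A" using h unfolding DP_homeo_def by blast
  then have *: "linear A \<and> inj A \<and> DP_tangle_over (A ` \<Lambda>) (H 1 ` S)"
    using DP_tangle_over_image[OF assms(1) h assms(3)] by blast
  then show "\<exists>A. linear A \<and> inj A \<and> DP_tangle_over (A ` \<Lambda>) (H 1 ` S)" by blast
  have "\<exists>\<Lambda> K. DP_tangle_over \<Lambda> S \<and> DP_preserving_isotopy \<Lambda> K \<and> K 1 ` S = H 1 ` S"
    using assms(1,2) by (metis (no_types))
  moreover have "DP_tangle S" "DP_tangle (H 1 ` S)" unfolding DP_tangle_def using assms(1) * by blast+
  ultimately have "DP_move S (H 1 ` S)" unfolding DP_move_def by blast
  then show "DP_isotopic S (H 1 ` S)" unfolding DP_isotopic_def by (rule r_into_equivclp)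
qed

lemma DP_tangle_over_relattice:
  assumes "DP_tangle_over \<Lambda> T" "is_lattice \<Lambda>'" "\<And>w k. w \<in> \<Lambda>' \<Longrightarrow> k \<in> T \<Longrightarrow> shift w k \<in> T"
  shows "DP_tangle_over \<Lambda>' T"
proof -
  have "\<forall>w\<in>\<Lambda>'. shift w ` T = T" using shift_invariantI[OF assms(2,3)] by blast
  then show ?thesis using assms(1,2) unfolding DP_tangle_over_def by (elim conjE) (intro conjI)
qed

section \<open>Isotopies of a cell\<close>

lemma lipschitz_extension:
  fixes a :: "'i \<Rightarrow> 'a :: metric_space" and f :: "'i \<Rightarrow> real"
  assumes "\<And>i j. i \<in> I \<Longrightarrow> j \<in> I \<Longrightarrow> \<bar>f i - f j\<bar> \<le> L * dist (a i) (a j)" and "0 \<le> L"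
  obtains F where "\<And>i. i \<in> I \<Longrightarrow> F (a i) = f i" "\<And>x y. \<bar>F x - F y\<bar> \<le> L * dist x y"
proof (cases "I = {}")
  case True
  then show ?thesis using that[of "\<lambda>_. 0"] assms(2) by simp
next
  case False
  \<comment> \<open>McShane's extension: the lower envelope of cones of slope \<open>L\<close>. The
    data are indexed families, so that moving points and fixed points can be prescribed together;
    consistency at coinciding points follows from the assumed inequality.\<close>
  define F where "F x = (INF i\<in>I. f i + L * dist x (a i))" for x
  obtain k where k: "k \<in> I" using False by blast
  \<comment> \<open>All cones lie above the downward cone of one fixed index, so the infimum is
    finite everywhere.\<close>
  have lower: "f k - L * dist x (a k) \<le> f i + L * dist x (a i)" if "i \<in> I" for i x
  proof -
    have "f k - f i \<le> L * dist (a k) (a i)" using assms(1)[OF k that] by linarith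
    also have "\<dots> \<le> L * (dist x (a k) + dist x (a i))"
      by (intro mult_left_mono assms(2)) (metis dist_commute dist_triangle)
    finally show ?thesis by (simp add: algebra_simps)
  qed
  have bdd: "bdd_below ((\<lambda>i. f i + L * dist x (a i)) ` I)" for x
    using lower by (intro bdd_belowI2) blast
  have le: "F x \<le> F y + L * dist x y" for x y
  proof -
    have "F x - L * dist x y \<le> f i + L * dist y (a i)" if "i \<in> I" for i
    proof -
      have "F x \<le> f i + L * dist x (a i)" unfolding F_def by (rule cINF_lower[OF bdd that])
      also have "\<dots> \<le> f i + L * (dist x y + dist y (a i))"
        by (intro add_left_mono mult_left_mono assms(2) dist_triangle)
      finally show ?thesis by (simp add: algebra_simps)
    qed
    then have "F x - L * dist x y \<le> F y" unfolding F_def[of y] by (rule cINF_greatest[OF False])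
    then show ?thesis by simp
  qed
  have "F (a i) = f i" if "i \<in> I" for i
  proof (rule antisym)
    show "F (a i) \<le> f i" unfolding F_def using cINF_lower[OF bdd that, of "a i"] by simp
    show "f i \<le> F (a i)" unfolding F_def
    proof (rule cINF_greatest[OF False])
      fix j assume "j \<in> I"
      then show "f i \<le> f j + L * dist (a i) (a j)" using assms(1)[OF that] by fastforce
    qed
  qed
  moreover have "\<bar>F x - F y\<bar> \<le> L * dist x y" for x y
    using le[of x y] le[of y x] by (simp add: dist_commute abs_le_iff)
  ultimately show ?thesis using that by blast
qed

lemma abs_components_le_norm:
  fixes z :: space
  shows "\<bar>fst (fst z)\<bar> \<le> norm z" "\<bar>snd (fst z)\<bar> \<le> norm z" "\<bar>snd z\<bar> \<le> norm z"
    and "norm z \<le> \<bar>fst (fst z)\<bar> + \<bar>snd (fst z)\<bar> + \<bar>snd z\<bar>"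
proof -
  obtain a b c where z: "z = ((a, b), c)" by (cases z) auto
  have "norm (fst z) \<le> norm z" using norm_fst_le[of "fst z" "snd z"] by simp
  moreover have "\<bar>fst (fst z)\<bar> \<le> norm (fst z)" "\<bar>snd (fst z)\<bar> \<le> norm (fst z)"
    using norm_fst_le[of "fst (fst z)" "snd (fst z)"] norm_snd_le[of "snd (fst z)" "fst (fst z)"] by auto
  ultimately show "\<bar>fst (fst z)\<bar> \<le> norm z" "\<bar>snd (fst z)\<bar> \<le> norm z" by linarith+
  show "\<bar>snd z\<bar> \<le> norm z" using norm_snd_le[of "snd z" "fst z"] by simp
  have "norm z \<le> norm (fst z) + norm (snd z)" using norm_Pair_le[of "fst z" "snd z"] by simp
  moreover have "norm (fst z) \<le> norm (fst (fst z)) + norm (snd (fst z))"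
    using norm_Pair_le[of "fst (fst z)" "snd (fst z)"] by simp
  ultimately show "norm z \<le> \<bar>fst (fst z)\<bar> + \<bar>snd (fst z)\<bar> + \<bar>snd z\<bar>" by simp
qed

text \<open>Each coordinate is extended separately; the factor 3 is the price of bounding the norm
  by the sum of the three coordinates.\<close>

lemma lipschitz_extension_space:
  fixes a :: "'i \<Rightarrow> 'a :: metric_space" and f :: "'i \<Rightarrow> space"
  assumes f: "\<And>i j. i \<in> I \<Longrightarrow> j \<in> I \<Longrightarrow> norm (f i - f j) \<le> L * dist (a i) (a j)" and "0 \<le> L"
  obtains F where "\<And>i. i \<in> I \<Longrightarrow> F (a i) = f i" "\<And>x y. dist (F x) (F y) \<le> 3 * L * dist x y"
proof -
  obtain F1 where F1: "\<And>i. i \<in> I \<Longrightarrow> F1 (a i) = fst (fst (f i))" "\<And>x y. \<bar>F1 x - F1 y\<bar> \<le> L * dist x y"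
    using lipschitz_extension[of I "\<lambda>i. fst (fst (f i))" L a]
      order_trans[OF abs_components_le_norm(1) f] assms(2) by (metis fst_diff)
  obtain F2 where F2: "\<And>i. i \<in> I \<Longrightarrow> F2 (a i) = snd (fst (f i))" "\<And>x y. \<bar>F2 x - F2 y\<bar> \<le> L * dist x y"
    using lipschitz_extension[of I "\<lambda>i. snd (fst (f i))" L a]
      order_trans[OF abs_components_le_norm(2) f] assms(2) by (metis fst_diff snd_diff)
  obtain F3 where F3: "\<And>i. i \<in> I \<Longrightarrow> F3 (a i) = snd (f i)" "\<And>x y. \<bar>F3 x - F3 y\<bar> \<le> L * dist x y"
    using lipschitz_extension[of I "\<lambda>i. snd (f i)" L a]
      order_trans[OF abs_components_le_norm(3) f] assms(2) by (metis snd_diff)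
  have "dist ((F1 x, F2 x), F3 x) ((F1 y, F2 y), F3 y) \<le> 3 * L * dist x y" for x y
    using abs_components_le_norm(4)[of "((F1 x, F2 x), F3 x) - ((F1 y, F2 y), F3 y)"]
      F1(2)[of x y] F2(2)[of x y] F3(2)[of x y] by (simp add: dist_norm)
  then show ?thesis using that[of "\<lambda>x. ((F1 x, F2 x), F3 x)"] F1(1) F2(1) F3(1) by simp
qed

section \<open>Isotopies supported in the cell\<close>

definition cell :: "space set" where
  "cell = open_box \<times> {0<..<1}"

text \<open>The maps act on the whole space and are the identity off the open cell. This is the form
  in which extended displacement fields arise, and it makes translated copies fit together.\<close>

definition cell_isotopy :: "(real \<Rightarrow> space \<Rightarrow> space) \<Rightarrow> bool" where
  "cell_isotopy h \<longleftrightarrow> continuous_on ({0..1} \<times> UNIV) (\<lambda>(t, p). h t p) \<and>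
     (\<forall>t\<in>{0..1}. (\<exists>h'. homeomorphism UNIV UNIV (h t) h') \<and> (\<forall>p. p \<notin> cell \<longrightarrow> h t p = p)) \<and>
     (\<forall>p. h 0 p = p)"

text \<open>The map changes distances by a factor of at least \<open>1 - c\<close>, which gives
  injectivity and a Lipschitz inverse; surjectivity is Banach's fixed point theorem.\<close>

lemma contraction_perturbation_homeomorphism:
  fixes V :: "'a :: banach \<Rightarrow> 'a"
  assumes c: "0 \<le> c" "c < 1" and V: "\<And>x y. dist (V x) (V y) \<le> c * dist x y"
  shows "\<exists>h'. homeomorphism UNIV UNIV (\<lambda>x. x + V x) h'"
proof -
  have low: "(1 - c) * dist x y \<le> dist (x + V x) (y + V y)" for x y
  proof -
    have "norm (x - y) \<le> norm ((x - y) + (V x - V y)) + norm (V x - V y)"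
      using norm_triangle_ineq4[of "(x - y) + (V x - V y)" "V x - V y"] by simp
    then show ?thesis using V[of x y] by (simp add: dist_norm algebra_simps)
  qed
  have "inj (\<lambda>x. x + V x)"
  proof (rule injI)
    fix x y assume "x + V x = y + V y"
    then show "x = y" using low[of x y] c by (simp add: mult_le_0_iff)
  qed
  moreover have "\<exists>x. x + V x = y" for y
  proof -
    \<comment> \<open>Solving \<open>x + V x = y\<close> means finding a fixed point of the
      contraction that sends \<open>x\<close> to \<open>y - V x\<close>.\<close>
    have "\<exists>!x. y - V x = x"
    proof (rule banach_fix_type[OF c], intro allI)
      fix x z show "dist (y - V x) (y - V z) \<le> c * dist x z"
        using V[of x z] by (simp add: dist_norm norm_minus_commute)
    qed
    then show ?thesis by (metis diff_add_cancel)
  qed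
  ultimately have bij: "bij (\<lambda>x. x + V x)" unfolding bij_def surj_def by metis
  define h' where "h' = inv (\<lambda>x. x + V x)"
  have h': "h' (x + V x) = x" "h' y + V (h' y) = y" for x y
    unfolding h'_def using inv_f_f[OF bij_is_inj[OF bij], of x] surj_f_inv_f[OF bij_is_surj[OF bij], of y]
    by auto
  have "continuous_on UNIV V" by (rule lipschitz_on_continuous_on[of c]) (auto simp: lipschitz_on_def V c)
  moreover have "continuous_on UNIV h'"
  proof (rule lipschitz_on_continuous_on[of "1 / (1 - c)"])
    show "(1 / (1 - c))-lipschitz_on UNIV h'"
    proof (rule lipschitz_onI)
      fix x y show "dist (h' x) (h' y) \<le> 1 / (1 - c) * dist x y"
        using low[of "h' x" "h' y"] h'(2) c by (simp add: field_simps)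
    qed (use c in auto)
  qed
  ultimately have "homeomorphism UNIV UNIV (\<lambda>x. x + V x) h'"
    by (intro homeomorphismI continuous_intros) (auto simp: h')
  then show ?thesis by blast
qed

text \<open>Scaling \<open>V\<close> by a time in the unit interval does not increase its Lipschitz
  constant, so every stage is again identity plus contraction.\<close>

lemma cell_isotopy_push:
  assumes c: "0 \<le> c" "c < 1" and V: "\<And>x y. dist (V x) (V y) \<le> c * dist x y"
    and out: "\<And>x. x \<notin> cell \<Longrightarrow> V x = 0"
  shows "cell_isotopy (\<lambda>t p. p + t *\<^sub>R V p)"
proof -
  have "continuous_on UNIV V" by (rule lipschitz_on_continuous_on[of c]) (auto simp: lipschitz_on_def V c)
  then have "continuous_on ({0..1} \<times> UNIV) (\<lambda>z. snd z + fst z *\<^sub>R V (snd z))"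
    by (intro continuous_intros continuous_on_compose2[of UNIV V _ snd] subset_UNIV)
  moreover have "\<exists>h'. homeomorphism UNIV UNIV (\<lambda>p. p + t *\<^sub>R V p) h'" if "t \<in> {0..1}" for t
  proof (rule contraction_perturbation_homeomorphism[OF c])
    fix x y
    have "dist (t *\<^sub>R V x) (t *\<^sub>R V y) = t * dist (V x) (V y)"
      using that by (simp only: dist_norm scaleR_diff_right[symmetric] norm_scaleR) simp
    also have "\<dots> \<le> 1 * dist (V x) (V y)" using that by (intro mult_right_mono) auto
    finally show "dist (t *\<^sub>R V x) (t *\<^sub>R V y) \<le> c * dist x y" using V[of x y] by simp
  qed
  moreover have "p + t *\<^sub>R V p = p" if "p \<notin> cell" for p t
    using out[OF that] by simp
  ultimately show ?thesis unfolding cell_isotopy_def case_prod_beta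
    by (intro conjI ballI allI impI) (assumption | simp)+
qed

definition cell_move :: "space set \<Rightarrow> space set \<Rightarrow> bool" where
  "cell_move P Q \<longleftrightarrow> (\<exists>h. cell_isotopy h \<and> h 1 ` P = Q)"

text \<open>The points \<open>p s\<close> run along segments to \<open>q s\<close>. The first bound
  says that at each time the displacement is a Lipschitz function of the current position; the
  second says that it remains Lipschitz when continued by 0 outside the cell. The constant must be
  uniform in time.\<close>

definition linear_motion :: "'s set \<Rightarrow> ('s \<Rightarrow> space) \<Rightarrow> ('s \<Rightarrow> space) \<Rightarrow> bool" where
  "linear_motion S p q \<longleftrightarrow> (\<exists>C. \<forall>t\<in>{0..1}. \<forall>s\<in>S.
     (\<forall>s'\<in>S. norm ((q s - p s) - (q s' - p s')) \<le>
         C * dist (p s + t *\<^sub>R (q s - p s)) (p s' + t *\<^sub>R (q s' - p s'))) \<and>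
     (\<forall>x. x \<notin> cell \<longrightarrow> norm (q s - p s) \<le> C * dist (p s + t *\<^sub>R (q s - p s)) x))"

text \<open>The bounds hold for all times, so substituting \<open>1 - t\<close> for \<open>t\<close>
  reverses the motion with the same constant.\<close>

lemma linear_motion_sym:
  assumes "linear_motion S p q"
  shows "linear_motion S q p"
proof -
  obtain C where C: "\<And>t s s'. t \<in> {0..1} \<Longrightarrow> s \<in> S \<Longrightarrow> s' \<in> S \<Longrightarrow> norm ((q s - p s) - (q s' - p s')) \<le>
         C * dist (p s + t *\<^sub>R (q s - p s)) (p s' + t *\<^sub>R (q s' - p s'))"
     "\<And>t s x. t \<in> {0..1} \<Longrightarrow> s \<in> S \<Longrightarrow> x \<notin> cell \<Longrightarrow>
         norm (q s - p s) \<le> C * dist (p s + t *\<^sub>R (q s - p s)) x"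
    using assms unfolding linear_motion_def by metis
  have *: "q s + t *\<^sub>R (p s - q s) = p s + (1 - t) *\<^sub>R (q s - p s)" for s t
    by (simp add: algebra_simps)
  show ?thesis unfolding linear_motion_def *
  proof (intro exI[of _ C] ballI conjI allI impI)
    fix t s s' assume "t \<in> {0..1::real}" "s \<in> S" "s' \<in> S"
    then have "norm ((q s - p s) - (q s' - p s')) \<le>
         C * dist (p s + (1 - t) *\<^sub>R (q s - p s)) (p s' + (1 - t) *\<^sub>R (q s' - p s'))"
      by (intro C) auto
    moreover have "(p s - q s) - (p s' - q s') = - ((q s - p s) - (q s' - p s'))" by simp
    ultimately show "norm ((p s - q s) - (p s' - q s')) \<le>
         C * dist (p s + (1 - t) *\<^sub>R (q s - p s)) (p s' + (1 - t) *\<^sub>R (q s' - p s'))"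
      by (metis norm_minus_cancel)
  next
    fix t s x assume "t \<in> {0..1::real}" "s \<in> S" "x \<notin> cell"
    then have "norm (q s - p s) \<le> C * dist (p s + (1 - t) *\<^sub>R (q s - p s)) x"
      by (intro C) auto
    then show "norm (p s - q s) \<le> C * dist (p s + (1 - t) *\<^sub>R (q s - p s)) x"
      by (simp add: norm_minus_commute)
  qed
qed

text \<open>
  A linear motion is cut into steps so short that the displacement is a Lipschitz function of the
  current position with a constant less than 1; a Lipschitz extension of it to the whole space is a
  push by a contraction.
\<close>

lemma linear_motion_cell_moves:
  assumes "linear_motion S p q"
  shows "cell_move\<^sup>*\<^sup>* (p ` S) (q ` S)"
proof -
  obtain C where C: "\<And>t s s'. t \<in> {0..1} \<Longrightarrow> s \<in> S \<Longrightarrow> s' \<in> S \<Longrightarrow> norm ((q s - p s) - (q s' - p s')) \<le>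
         C * dist (p s + t *\<^sub>R (q s - p s)) (p s' + t *\<^sub>R (q s' - p s'))"
     "\<And>t s x. t \<in> {0..1} \<Longrightarrow> s \<in> S \<Longrightarrow> x \<notin> cell \<Longrightarrow>
         norm (q s - p s) \<le> C * dist (p s + t *\<^sub>R (q s - p s)) x"
    using assms unfolding linear_motion_def by metis
  define r where "r t s = p s + t *\<^sub>R (q s - p s)" for t s
  obtain N :: nat where N: "6 * \<bar>C\<bar> < real N" using reals_Archimedean2 by blast
  have "N > 0"
  proof (rule ccontr)
    assume "\<not> N > 0"
    then show False using N by simp
  qed
  define L where "L = \<bar>C\<bar> / N"
  have L: "0 \<le> L" "3 * L < 1" using N \<open>N > 0\<close> unfolding L_def by (auto simp: field_simps)
  have CL: "norm x / N \<le> L * dist y z" if "norm x \<le> C * dist y z" for x y z :: space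
  proof -
    have "norm x \<le> \<bar>C\<bar> * dist y z" using that by (smt (verit) mult_right_mono zero_le_dist)
    then show ?thesis using \<open>N > 0\<close> unfolding L_def by (simp add: field_simps)
  qed
  have step: "cell_move (r (j / N) ` S) (r (Suc j / N) ` S)" if j: "j < N" for j
  proof -
    define t where "t = real j / N"
    have t: "t \<in> {0..1}" using j unfolding t_def by auto
    \<comment> \<open>The left summand indexes the moving points at their current positions, with
      the displacement of one step; the right one indexes all points off the cell, with displacement
      0. A single extension then meets both requirements.\<close>
    define a where "a i = (case i of Inl s \<Rightarrow> r t s | Inr x \<Rightarrow> x)" for i :: "_ + space"
    define f where "f i = (case i of Inl s \<Rightarrow> (1 / N) *\<^sub>R (q s - p s) | Inr x \<Rightarrow> 0)" for i :: "_ + space"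
    have lip: "norm (f i - f i') \<le> L * dist (a i) (a i')" if "i \<in> S <+> - cell" "i' \<in> S <+> - cell" for i i'
    proof -
      have ss: "norm ((1 / N) *\<^sub>R (q s - p s) - (1 / N) *\<^sub>R (q s' - p s')) \<le> L * dist (r t s) (r t s')"
        if "s \<in> S" "s' \<in> S" for s s'
        using CL[OF C(1)[OF t that]] \<open>N > 0\<close>
        by (simp only: scaleR_diff_right[symmetric] norm_scaleR r_def) simp
      have sx: "norm ((1 / N) *\<^sub>R (q s - p s)) \<le> L * dist (r t s) x" if "s \<in> S" "x \<notin> cell" for s x
        using CL[OF C(2)[OF t that]] \<open>N > 0\<close> by (simp only: norm_scaleR r_def) simp
      have xs: "norm (0 - (1 / N) *\<^sub>R (q s - p s)) \<le> L * dist x (r t s)" if "s \<in> S" "x \<notin> cell" for s x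
        using sx[OF that] by (simp only: diff_0 norm_minus_cancel dist_commute)
      show ?thesis
      proof (cases i)
        case i: (Inl s)
        show ?thesis
        proof (cases i')
          case (Inl s')
          then show ?thesis using i that ss[of s s'] unfolding a_def f_def by (simp add: Plus_def image_iff)
        next
          case (Inr x)
          then show ?thesis using i that sx[of s x] unfolding a_def f_def by (simp add: Plus_def image_iff)
        qed
      next
        case i: (Inr x)
        show ?thesis
        proof (cases i')
          case (Inl s')
          then show ?thesis using i that xs[of s' x] unfolding a_def f_def by (simp add: Plus_def image_iff)
        next
          case (Inr x')
          then show ?thesis using i L(1) unfolding a_def f_def by simp
        qed
      qed
    qed
    obtain V where V: "\<And>i. i \<in> S <+> - cell \<Longrightarrow> V (a i) = f i"
        "\<And>x y. dist (V x) (V y) \<le> 3 * L * dist x y"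
      using lipschitz_extension_space[of "S <+> - cell" f L a, OF lip L(1)] by blast
    have Vs: "V (r t s) = (1 / N) *\<^sub>R (q s - p s)" if "s \<in> S" for s
      using V(1)[of "Inl s"] that unfolding a_def f_def by auto
    have "V x = 0" if "x \<notin> cell" for x
      using V(1)[of "Inr x"] that unfolding a_def f_def by auto
    then have "cell_isotopy (\<lambda>t p. p + t *\<^sub>R V p)"
      by (intro cell_isotopy_push[of "3 * L"] V(2)) (use L in simp_all)
    moreover have "(\<lambda>p. p + 1 *\<^sub>R V p) ` r t ` S = r (Suc j / N) ` S"
      unfolding image_image
    proof (rule image_cong[OF refl])
      fix s assume "s \<in> S"
      have "r t s + V (r t s) = p s + (t + 1 / N) *\<^sub>R (q s - p s)"
        unfolding Vs[OF \<open>s \<in> S\<close>] unfolding r_def by (simp only: scaleR_add_left add.assoc)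
      moreover have "t + 1 / N = Suc j / N" unfolding t_def by (simp add: add_divide_distrib)
      ultimately show "r t s + 1 *\<^sub>R V (r t s) = r (Suc j / N) s" unfolding r_def by simp
    qed
    ultimately show ?thesis unfolding cell_move_def t_def by (intro exI conjI)
  qed
  have "cell_move\<^sup>*\<^sup>* (r 0 ` S) (r (j / N) ` S)" if "j \<le> N" for j
    using that
  proof (induction j)
    case (Suc j)
    then show ?case using step[of j] by (simp add: rtranclp.rtrancl_into_rtrancl)
  qed simp
  from this[of N] have "cell_move\<^sup>*\<^sup>* (r 0 ` S) (r 1 ` S)" using \<open>N > 0\<close> by simp
  then show ?thesis unfolding r_def by simp
qed

section \<open>Periodic copies of a cell\<close>

lemma open_box_subset_box: "open_box \<subseteq> box"
  by (auto simp: box_def open_box_def)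

lemma compact_box: "compact box"
  unfolding box_def by (intro compact_Times) auto

lemma open_open_box: "open open_box"
  unfolding open_box_def by (intro open_Times) auto

lemma cell_homeomorphism:
  assumes hom: "homeomorphism UNIV UNIV g g'" and out: "\<And>p. p \<notin> cell \<Longrightarrow> g p = p"
  shows "p \<notin> cell \<Longrightarrow> g' p = p" and "p \<in> cell \<Longrightarrow> g p \<in> cell" and "p \<in> cell \<Longrightarrow> g' p \<in> cell"
proof -
  have gg: "g' (g x) = x" "g (g' x) = x" for x using hom unfolding homeomorphism_def by auto
  show "p \<notin> cell \<Longrightarrow> g' p = p" using out gg by metis
  show "p \<in> cell \<Longrightarrow> g p \<in> cell" using out gg by metis
  show "p \<in> cell \<Longrightarrow> g' p \<in> cell" using out gg by metis
qed

text \<open>Disjointness is required of the closed boxes, so that box coordinates and the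
  translating vector are unique on the edges, too.\<close>

locale embedded_box =
  fixes \<Lambda> :: "plane set" and \<phi> :: "plane \<Rightarrow> plane"
  assumes lattice: "is_lattice \<Lambda>"
    and cont: "continuous_on box \<phi>" and inj: "inj_on \<phi> box"
    and disjoint: "\<And>w. w \<in> \<Lambda> - {0} \<Longrightarrow> \<phi> ` box \<inter> (\<lambda>x. x + w) ` \<phi> ` box = {}"
begin

text \<open>The edges of the boxes belong to \<open>outer\<close>. Thus \<open>outer\<close> and the
  translated closed boxes form a closed cover that overlaps exactly along the edges.\<close>

definition outer :: "plane set" where
  "outer = - {\<phi> q + w | q w. q \<in> open_box \<and> w \<in> \<Lambda>}"

definition place :: "plane \<Rightarrow> space \<Rightarrow> space" where
  "place w r = (\<phi> (fst r) + w, snd r)"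

lemma fst_place [simp]: "fst (place w r) = \<phi> (fst r) + w"
  and snd_place [simp]: "snd (place w r) = snd r"
  by (simp_all add: place_def)

lemma box_unique:
  assumes "q \<in> box" "q' \<in> box" "w \<in> \<Lambda>" "w' \<in> \<Lambda>" "\<phi> q + w = \<phi> q' + w'"
  shows "q = q'" and "w = w'"
proof -
  have eq: "\<phi> q = \<phi> q' + (w' - w)" using assms(5) by (simp add: algebra_simps) 
  have d: "w' - w \<in> \<Lambda>" using lattice_diff[OF lattice] assms by blast
  show "w = w'"
  proof (rule ccontr)
    assume "w \<noteq> w'"
    then have "\<phi> ` box \<inter> (\<lambda>x. x + (w' - w)) ` \<phi> ` box = {}" using d by (intro disjoint) auto
    moreover have "\<phi> q \<in> \<phi> ` box" "\<phi> q \<in> (\<lambda>x. x + (w' - w)) ` \<phi> ` box"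
      using eq assms(1,2) by blast+
    ultimately show False by blast
  qed
  then show "q = q'" using eq inj assms by (auto dest: inj_onD)
qed

lemma place_cases:
  obtains (outer) "fst p \<in> outer" | (inner) q w where "q \<in> open_box" "w \<in> \<Lambda>" "p = place w (q, snd p)"
proof (cases "fst p \<in> outer")
  case False
  then obtain q w where "q \<in> open_box" "w \<in> \<Lambda>" "fst p = \<phi> q + w" unfolding outer_def by blast
  then show ?thesis using inner unfolding place_def by (metis fst_conv snd_conv prod.collapse)
qed (rule outer)

lemma outer_boundary: "q \<in> box \<Longrightarrow> w \<in> \<Lambda> \<Longrightarrow> \<phi> q + w \<in> outer \<longleftrightarrow> q \<notin> open_box"
  unfolding outer_def using box_unique(1) open_box_subset_box by blast

lemma outer_shift:
  assumes "w \<in> \<Lambda>"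
  shows "x + w \<in> outer \<longleftrightarrow> x \<in> outer"
proof -
  have *: "x + w \<notin> outer" if "x \<notin> outer" "w \<in> \<Lambda>" for x w
  proof -
    obtain q v where "q \<in> open_box" "v \<in> \<Lambda>" "x = \<phi> q + v" using \<open>x \<notin> outer\<close> unfolding outer_def by blast
    then have "x + w = \<phi> q + (v + w)" "v + w \<in> \<Lambda>" using lattice_add[OF lattice] that by (auto simp: add.assoc)
    then show ?thesis using \<open>q \<in> open_box\<close> unfolding outer_def by blast
  qed
  show ?thesis using *[of x w] *[of "x + w" "- w"] lattice_uminus[OF lattice assms] assms by auto
qed

text \<open>The image of the open square is open by invariance of domain, and \<open>outer\<close>
  is the complement of its translates.\<close>

lemma closed_outer: "closed outer"
proof -
  have "open (\<phi> ` open_box)"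
    by (rule invariance_of_domain)
      (use cont inj open_open_box open_box_subset_box in \<open>auto intro: continuous_on_subset inj_on_subset\<close>)
  then have "open ((+) w ` \<phi> ` open_box)" for w by (rule open_translation)
  then have "open (\<Union>w\<in>\<Lambda>. (+) w ` \<phi> ` open_box)" by blast
  moreover have "outer = - (\<Union>w\<in>\<Lambda>. (+) w ` \<phi> ` open_box)"
    unfolding outer_def image_def by (simp only: UN_iff mem_Collect_eq add.commute) blast
  ultimately show ?thesis by (simp only: closed_def double_complement)
qed

text \<open>The closed cover by \<open>outer\<close> and the translated boxes is locally finite, so
  the pasting lemma applies. The projection \<pi> to the plane is a parameter because the lemma
  serves both for time-dependent maps of space and for height functions on strands.\<close>

lemma continuous_on_glue:
  fixes F :: "'a :: topological_space \<Rightarrow> 'b :: topological_space"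
  assumes \<pi>: "continuous_on S \<pi>" and out: "continuous_on {s \<in> S. \<pi> s \<in> outer} F"
    and inn: "\<And>w. w \<in> \<Lambda> \<Longrightarrow> continuous_on {s \<in> S. \<pi> s - w \<in> \<phi> ` box} F"
  shows "continuous_on S F"
proof -
  define T where "T i = (case i of None \<Rightarrow> {s \<in> S. \<pi> s \<in> outer} | Some w \<Rightarrow> {s \<in> S. \<pi> s - w \<in> \<phi> ` box})"
    for i
  define I where "I = insert None (Some ` \<Lambda>)"
  have B: "compact (\<phi> ` box)" using compact_continuous_image[OF cont compact_box] .
  obtain R where R: "\<And>x. x \<in> \<phi> ` box \<Longrightarrow> norm x \<le> R" using compact_imp_bounded[OF B] unfolding bounded_iff by blast
  have "continuous_map (top_of_set S) euclidean F"
  proof (rule pasting_lemma_locally_finite[where I = I and T = T and f = "\<lambda>_. F"])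
    fix s assume "s \<in> topspace (top_of_set S)"
    then have s: "s \<in> S" by simp
    define V where "V = S \<inter> \<pi> -` ball (\<pi> s) 1"
    \<comment> \<open>A translate that meets the unit ball around \<open>\<pi> s\<close> has its
      vector within \<open>R + 1\<close> of \<open>\<pi> s\<close>, where \<open>R\<close> bounds
      the compact box.\<close>
    have "{i \<in> I. T i \<inter> V \<noteq> {}} \<subseteq> insert None (Some ` {w \<in> \<Lambda>. norm (w + - \<pi> s) \<le> R + 1})"
    proof
      fix i assume i: "i \<in> {i \<in> I. T i \<inter> V \<noteq> {}}"
      show "i \<in> insert None (Some ` {w \<in> \<Lambda>. norm (w + - \<pi> s) \<le> R + 1})"
      proof (cases i)
        case (Some w)
        then obtain s' where s': "\<pi> s' - w \<in> \<phi> ` box" "dist (\<pi> s) (\<pi> s') < 1" and "w \<in> \<Lambda>"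
        proof -
          have "w \<in> \<Lambda>" "T (Some w) \<inter> V \<noteq> {}" using i Some unfolding I_def by auto
          then obtain s' where "s' \<in> T (Some w)" "s' \<in> V" by blast
          then show ?thesis using that \<open>w \<in> \<Lambda>\<close> unfolding T_def V_def by simp blast
        qed
        have "norm (w + - \<pi> s) \<le> norm (\<pi> s' - w) + norm (\<pi> s - \<pi> s')"
          using norm_triangle_ineq4[of "- (\<pi> s' - w)" "\<pi> s - \<pi> s'"] by (simp add: algebra_simps norm_minus_commute)
        then show ?thesis using R[OF s'(1)] s'(2) \<open>w \<in> \<Lambda>\<close> Some by (auto simp: dist_norm)
      qed simp
    qed
    moreover have "finite (insert None (Some ` {w \<in> \<Lambda>. norm (w + - \<pi> s) \<le> R + 1}))"
      using lattice_finite_bounded[OF lattice, of "- \<pi> s" "R + 1"] by simp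
    ultimately have "finite {i \<in> I. T i \<inter> V \<noteq> {}}" by (rule finite_subset)
    moreover have "openin (top_of_set S) V" unfolding V_def
      using \<pi> continuous_on_open_gen[of \<pi> S UNIV] by (auto simp: continuous_openin_preimage_gen)
    moreover have "s \<in> V" using s unfolding V_def by simp
    ultimately show "\<exists>V. openin (top_of_set S) V \<and> s \<in> V \<and> finite {i \<in> I. T i \<inter> V \<noteq> {}}" by blast
  next
    fix i assume "i \<in> I"
    show "closedin (top_of_set S) (T i)"
    proof (cases i)
      case None
      then show ?thesis using continuous_closedin_preimage[OF \<pi> closed_outer] unfolding T_def
        by (simp add: vimage_def Int_def)
    next
      case (Some w)
      have "continuous_on S (\<lambda>s. \<pi> s - w)" by (intro continuous_intros \<pi>)
      from continuous_closedin_preimage[OF this compact_imp_closed[OF B]]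
      show ?thesis using Some unfolding T_def by (simp add: vimage_def Int_def)
    qed
  next
    fix i assume i: "i \<in> I"
    have TS: "T i \<subseteq> S" unfolding T_def by (auto split: option.splits)
    have "continuous_on (T i) F" using i inn out unfolding T_def I_def by (auto split: option.splits)
    then show "continuous_map (subtopology (top_of_set S) (T i)) euclidean F"
      using TS by (simp add: subtopology_subtopology Int_absorb1)
  next
    fix s assume "s \<in> topspace (top_of_set S)"
    then have s: "s \<in> S" by simp
    have "\<exists>i\<in>I. s \<in> T i"
    proof (cases "\<pi> s \<in> outer")
      case True
      then show ?thesis using s unfolding I_def T_def by auto
    next
      case False
      then obtain q w where "q \<in> open_box" "w \<in> \<Lambda>" "\<pi> s = \<phi> q + w" unfolding outer_def by blast
      then show ?thesis using s open_box_subset_box unfolding I_def T_def by (intro bexI[of _ "Some w"]) auto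
    qed
    then show "\<exists>j. j \<in> I \<and> s \<in> T j \<and> F s = F s" by blast
  qed auto
  then show ?thesis by simp
qed

definition unplace :: "space \<Rightarrow> space \<times> plane" where
  "unplace p = (SOME rw. fst (fst rw) \<in> box \<and> snd rw \<in> \<Lambda> \<and> p = place (snd rw) (fst rw))"

lemma unplace_place [simp]:
  assumes "fst r \<in> box" "w \<in> \<Lambda>"
  shows "unplace (place w r) = (r, w)"
  unfolding unplace_def
proof (rule some_equality)
  fix rw assume rw: "fst (fst rw) \<in> box \<and> snd rw \<in> \<Lambda> \<and> place w r = place (snd rw) (fst rw)"
  then have "\<phi> (fst r) + w = \<phi> (fst (fst rw)) + snd rw" "snd r = snd (fst rw)"
    by (auto simp: place_def)
  then show "rw = (r, w)"
    using box_unique[of "fst r" "fst (fst rw)" w "snd rw"] rw assms by (auto intro!: prod_eqI)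
qed (use assms in auto)

text \<open>Copies \<open>g\<close> into the column over every translated box. On the edges
  \<open>g\<close> is the identity if it is so off the cell, and therefore both branches agree
  there, as \<open>ext_place\<close> records.\<close>

definition ext :: "(space \<Rightarrow> space) \<Rightarrow> space \<Rightarrow> space" where
  "ext g p = (if fst p \<in> outer then p else place (snd (unplace p)) (g (fst (unplace p))))"

lemma ext_outer [simp]: "fst p \<in> outer \<Longrightarrow> ext g p = p"
  by (simp add: ext_def)

lemma not_open_box_not_cell: "fst r \<notin> open_box \<Longrightarrow> r \<notin> cell"
  by (cases r) (simp add: cell_def)

lemma ext_place [simp]:
  assumes "\<And>p. p \<notin> cell \<Longrightarrow> g p = p" "fst r \<in> box" "w \<in> \<Lambda>"
  shows "ext g (place w r) = place w (g r)"
proof (cases "fst r \<in> open_box")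
  case True
  then have "fst (place w r) \<notin> outer" using outer_boundary assms by simp
  then show ?thesis unfolding ext_def using assms by simp
next
  case False
  then have "fst (place w r) \<in> outer" using outer_boundary assms by simp
  then show ?thesis using assms(1)[OF not_open_box_not_cell[OF False]] by simp
qed

lemma continuous_on_ext:
  fixes h :: "'t :: topological_space \<Rightarrow> space \<Rightarrow> space"
  assumes h: "continuous_on (J \<times> UNIV) (\<lambda>(t, p). h t p)"
    and out: "\<And>t p. t \<in> J \<Longrightarrow> p \<notin> cell \<Longrightarrow> h t p = p"
    and box: "\<And>t p. t \<in> J \<Longrightarrow> fst p \<in> box \<Longrightarrow> fst (h t p) \<in> box"
  shows "continuous_on (J \<times> UNIV) (\<lambda>(t, p). ext (h t) p)"
proof (rule continuous_on_glue[where \<pi> = "\<lambda>z. fst (snd z)"])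
  show "continuous_on (J \<times> UNIV) (\<lambda>z. fst (snd z :: space))" by (intro continuous_intros)
  show "continuous_on {s \<in> J \<times> UNIV. fst (snd s) \<in> outer} (\<lambda>(t, p). ext (h t) p)"
    by (rule continuous_on_eq[of _ snd]) (auto intro!: continuous_intros)
  \<comment> \<open>By compactness the inverse of \<open>\<phi>\<close> on the box is continuous, so
    over a translated box the extended map can be written in box coordinates.\<close>
  define \<psi> where "\<psi> = inv_into box \<phi>"
  have \<psi>: "continuous_on (\<phi> ` box) \<psi>" unfolding \<psi>_def by (rule continuous_on_inv[OF cont compact_box]) (simp add: inj)
  fix w assume w: "w \<in> \<Lambda>"
  let ?S = "{s \<in> J \<times> (UNIV :: space set). fst (snd s) - w \<in> \<phi> ` box}"
  define F where "F s = place w (h (fst s) (\<psi> (fst (snd s) - w), snd (snd s)))" for s :: "'t \<times> space"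
  show "continuous_on ?S (\<lambda>(t, p). ext (h t) p)"
  proof (rule continuous_on_eq[of _ F])
    have c1: "continuous_on ?S (\<lambda>s. \<psi> (fst (snd s) - w))"
      by (rule continuous_on_compose2[OF \<psi>]) (auto intro!: continuous_intros)
    have c2: "continuous_on ?S (\<lambda>s. (fst s, (\<psi> (fst (snd s) - w), snd (snd s))))"
      by (intro continuous_intros c1)
    have "continuous_on ?S (\<lambda>s. (\<lambda>(t, p). h t p) (fst s, (\<psi> (fst (snd s) - w), snd (snd s))))"
      by (rule continuous_on_compose2[OF h c2]) auto
    then have c3: "continuous_on ?S (\<lambda>s. h (fst s) (\<psi> (fst (snd s) - w), snd (snd s)))" by simp
    have "continuous_on ?S (\<lambda>s. \<phi> (fst (h (fst s) (\<psi> (fst (snd s) - w), snd (snd s)))))"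
    proof (rule continuous_on_compose2[OF cont])
      show "continuous_on ?S (\<lambda>s. fst (h (fst s) (\<psi> (fst (snd s) - w), snd (snd s))))"
        by (intro continuous_intros c3)
      show "(\<lambda>s. fst (h (fst s) (\<psi> (fst (snd s) - w), snd (snd s)))) ` ?S \<subseteq> box"
      proof
        fix y assume "y \<in> (\<lambda>s. fst (h (fst s) (\<psi> (fst (snd s) - w), snd (snd s)))) ` ?S"
        then obtain s where s: "s \<in> ?S" "y = fst (h (fst s) (\<psi> (fst (snd s) - w), snd (snd s)))"
          by blast
        have "\<psi> (fst (snd s) - w) \<in> box" unfolding \<psi>_def using s(1) by (intro inv_into_into) simp
        then show "y \<in> box" using s box[of "fst s" "(\<psi> (fst (snd s) - w), snd (snd s))"]
          by (simp add: mem_Times_iff)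
      qed
    qed
    then show "continuous_on ?S F" unfolding F_def place_def by (intro continuous_intros c3)
  next
    fix s :: "'t \<times> space" assume s: "s \<in> ?S"
    then have t: "fst s \<in> J" by (simp add: mem_Times_iff)
    obtain q where q: "q \<in> box" "fst (snd s) - w = \<phi> q" using s by blast
    have "\<psi> (fst (snd s) - w) = q" unfolding \<psi>_def q(2) using q(1) inj by simp
    moreover have "snd s = place w (q, snd (snd s))"
      using q(2) unfolding place_def by (intro prod_eqI) (simp_all add: algebra_simps)
    moreover have "ext (h (fst s)) (place w (q, snd (snd s))) = place w (h (fst s) (q, snd (snd s)))"
      by (rule ext_place) (use out t q w in auto)
    ultimately show "F s = (\<lambda>(t, p). ext (h t) p) s" unfolding F_def by (simp add: case_prod_beta)
  qed
qed

lemma ext_inverse: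
  assumes gg: "\<And>p. g (g' p) = p" and out: "\<And>p. p \<notin> cell \<Longrightarrow> g p = p" "\<And>p. p \<notin> cell \<Longrightarrow> g' p = p"
    and cell: "\<And>p. p \<in> cell \<Longrightarrow> g' p \<in> cell"
  shows "ext g (ext g' p) = p"
proof (cases p rule: place_cases)
  case (inner q w)
  define r where "r = (q, snd p)"
  have p: "p = place w r" "fst r \<in> box" using inner open_box_subset_box unfolding r_def by auto
  have "fst (g' r) \<in> box"
  proof (cases "r \<in> cell")
    case True
    then show ?thesis using cell[OF True] open_box_subset_box unfolding cell_def by auto
  next
    case False
    then show ?thesis using out p by simp
  qed
  then show ?thesis using out p gg \<open>w \<in> \<Lambda>\<close> by simp
qed simp

lemma ext_shift:
  assumes out: "\<And>p. p \<notin> cell \<Longrightarrow> g p = p" and "w \<in> \<Lambda>"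
  shows "ext g (shift w p) = shift w (ext g p)"
proof (cases p rule: place_cases)
  case outer
  then show ?thesis using outer_shift assms(2) by simp
next
  case (inner q v)
  define r where "r = (q, snd p)"
  have p: "p = place v r" "fst r \<in> box" using inner open_box_subset_box unfolding r_def by auto
  have *: "shift w (place v r) = place (v + w) r" for r
    by (simp add: place_def shift_def add.assoc)
  show ?thesis unfolding p(1) using p(2) assms lattice_add[OF lattice inner(2) assms(2)] inner(2)
    by (simp add: *)
qed

lemma ext_level:
  assumes out: "\<And>p. p \<notin> cell \<Longrightarrow> g p = p" and cell: "\<And>p. p \<in> cell \<Longrightarrow> g p \<in> cell"
    and Z: "{0<..<1} \<subseteq> Z" "snd p \<in> Z"
  shows "snd (ext g p) \<in> Z"
proof (cases p rule: place_cases)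
  case (inner q w)
  define r where "r = (q, snd p)"
  have p: "p = place w r" "fst r \<in> box" using inner open_box_subset_box unfolding r_def by auto
  have "ext g p = place w (g r)" unfolding p(1) using p(2) out inner(2) by simp
  moreover have "snd (g r) \<in> Z"
  proof (cases "r \<in> cell")
    case True
    then show ?thesis using cell[OF True] Z unfolding cell_def by auto
  next
    case False
    then show ?thesis using out Z p by simp
  qed
  ultimately show ?thesis by simp
qed (use Z in simp)

text \<open>Since the same map is inserted in every translate, each stage commutes with the shifts,
  and the linear map on the lattice is the identity at all times.\<close>

lemma DP_preserving_ext:
  assumes h: "cell_isotopy h"
  shows "DP_preserving_isotopy \<Lambda> (\<lambda>t. ext (h t))"
proof -
  have cont_h: "continuous_on ({0..1} \<times> UNIV) (\<lambda>(t, p). h t p)"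
    and hom: "\<And>t. t \<in> {0..1} \<Longrightarrow> \<exists>h'. homeomorphism UNIV UNIV (h t) h'"
    and out: "\<And>t p. t \<in> {0..1} \<Longrightarrow> p \<notin> cell \<Longrightarrow> h t p = p" and init: "\<And>p. h 0 p = p"
    using h unfolding cell_isotopy_def by blast+
  have keep: "fst (g p) \<in> box" if "\<And>p. p \<notin> cell \<Longrightarrow> g p = p" "\<And>p. p \<in> cell \<Longrightarrow> g p \<in> cell" "fst p \<in> box" for g p
  proof (cases "p \<in> cell")
    case True
    then show ?thesis using that(2)[OF True] open_box_subset_box unfolding cell_def by auto
  qed (use that in simp)
  have cell: "h t p \<in> cell" if "t \<in> {0..1}" "p \<in> cell" for t p
    using hom[OF that(1)] cell_homeomorphism(2)[OF _ out[OF that(1)] that(2)] by blast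
  have "continuous_on ({0..1} \<times> UNIV) (\<lambda>(t, p). ext (h t) p)"
    by (rule continuous_on_ext[OF cont_h out]) (use keep out cell in blast)+
  then have c1: "continuous_on ({0..1} \<times> thickened_plane) (\<lambda>(t, p). ext (h t) p)"
    by (rule continuous_on_subset) auto
  have c2: "\<exists>G. homeomorphism thickened_plane thickened_plane (ext (h t)) G" if t: "t \<in> {0..1}" for t
  proof -
    obtain h' where h': "homeomorphism UNIV UNIV (h t) h'" using hom[OF t] by blast
    note out' = cell_homeomorphism(1)[OF h' out[OF t]] and cell' = cell_homeomorphism(3)[OF h' out[OF t]]
    have hh: "h' (h t p) = p" "h t (h' p) = p" for p using h' unfolding homeomorphism_def by auto
    have cont_single: "continuous_on thickened_plane (ext g)"
      if g: "continuous_on UNIV g" "\<And>p. p \<notin> cell \<Longrightarrow> g p = p" "\<And>p. p \<in> cell \<Longrightarrow> g p \<in> cell" for g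
    proof -
      \<comment> \<open>A single map is treated as a family over the one time 0, so that the
        continuity lemma for families applies to the inverse as well.\<close>
      have "continuous_on ({0::real} \<times> UNIV) (\<lambda>z. g (snd z))"
        by (rule continuous_on_compose2[OF g(1)]) (auto intro!: continuous_intros)
      then have "continuous_on ({0::real} \<times> UNIV) (\<lambda>(t, p). g p)" by (simp add: case_prod_beta)
      then have c: "continuous_on ({0::real} \<times> UNIV) (\<lambda>(t, p). ext g p)"
        by (rule continuous_on_ext) (use keep g in blast)+
      have "continuous_on thickened_plane (\<lambda>p. (\<lambda>(t, p). ext g p) (0 :: real, p))"
        by (rule continuous_on_compose2[OF c]) (auto intro!: continuous_intros)
      then show ?thesis by simp
    qed
    have "continuous_on UNIV (h t)" "continuous_on UNIV h'" using h' unfolding homeomorphism_def by auto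
    then have "continuous_on thickened_plane (ext (h t))" "continuous_on thickened_plane (ext h')"
      using cont_single out[OF t] cell[OF t] out' cell' by blast+
    moreover have "ext (h t) (ext h' p) = p" "ext h' (ext (h t) p) = p" for p
      by (rule ext_inverse; use hh out[OF t] out' cell[OF t] cell' in blast)+
    moreover have "ext g p \<in> thickened_plane" if "p \<in> thickened_plane"
        "\<And>p. p \<notin> cell \<Longrightarrow> g p = p" "\<And>p. p \<in> cell \<Longrightarrow> g p \<in> cell" for g p
    proof -
      have "{0<..<1} \<subseteq> {0..1::real}" "snd p \<in> {0..1}" using that(1) by (auto simp: mem_Times_iff)
      from ext_level[OF that(2,3) this] show ?thesis by (simp add: mem_Times_iff)
    qed
    ultimately have "homeomorphism thickened_plane thickened_plane (ext (h t)) (ext h')"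
      using out[OF t] out' cell[OF t] cell' by (intro homeomorphismI) blast+
    then show ?thesis by blast
  qed
  have c3: "ext (h 0) p = p" for p
  proof (cases p rule: place_cases)
    case (inner q w)
    then have "ext (h 0) (place w (q, snd p)) = place w (q, snd p)"
      using init open_box_subset_box by (subst ext_place) auto
    then show ?thesis using inner(3) by simp
  qed simp
  have c4: "\<exists>A. linear A \<and> inj A \<and>
        (\<forall>w\<in>\<Lambda>. \<forall>p\<in>thickened_plane. ext (h t) (shift w p) = shift (A w) (ext (h t) p))" if t: "t \<in> {0..1}" for t
    using ext_shift[of "h t", OF out[OF t]]
    by (intro exI[of _ "\<lambda>x. x"]) (auto simp: linear_ident)
  show ?thesis unfolding DP_preserving_isotopy_def using c1 c2 c3 c4 by (intro conjI ballI)
qed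

section \<open>Moving the contents of all boxes at once\<close>

definition insert_cells :: "space set \<Rightarrow> space set \<Rightarrow> space set" where
  "insert_cells Q P = Q \<union> {place w r | w r. w \<in> \<Lambda> \<and> r \<in> P}"

text \<open>\<open>Q\<close> is the part over \<open>outer\<close>, which the extended isotopy fixes
  pointwise; \<open>P\<close> is the content of one box in model coordinates, repeated over the
  lattice.\<close>

lemma insert_cells_move:
  assumes T: "DP_tangle_over \<Lambda> (insert_cells Q P)" and Q: "fst ` Q \<subseteq> outer" and P: "fst ` P \<subseteq> box"
    and move: "cell_move P P'"
  shows "DP_isotopic (insert_cells Q P) (insert_cells Q P')" and "DP_tangle_over \<Lambda> (insert_cells Q P')"
    and "fst ` P' \<subseteq> box"
proof -
  obtain h where h: "cell_isotopy h" and P': "P' = h 1 ` P" using move unfolding cell_move_def by blast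
  have "(1::real) \<in> {0..1}" by simp
  then obtain h' where h': "homeomorphism UNIV UNIV (h 1) h'" and out: "\<And>p. p \<notin> cell \<Longrightarrow> h 1 p = p"
    using h unfolding cell_isotopy_def by blast
  note cell = cell_homeomorphism(2)[OF h' out]
  show "fst ` P' \<subseteq> box"
  proof
    fix y assume "y \<in> fst ` P'"
    then obtain r where r: "r \<in> P" "y = fst (h 1 r)" unfolding P' by blast
    then show "y \<in> box" using cell[of r] out[of r] P open_box_subset_box
      by (cases "r \<in> cell") (auto simp: cell_def)
  qed
  have img: "ext (h 1) ` insert_cells Q P = insert_cells Q P'"
  proof -
    have "ext (h 1) ` Q = Q" using Q by (force simp: image_iff)
    moreover have "ext (h 1) ` {place w r | w r. w \<in> \<Lambda> \<and> r \<in> P} = {place w r | w r. w \<in> \<Lambda> \<and> r \<in> P'}"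
    proof -
      have *: "ext (h 1) (place w r) = place w (h 1 r)" if "w \<in> \<Lambda>" "r \<in> P" for w r
        using that P out by (intro ext_place) auto
      show ?thesis unfolding P'
      proof (intro equalityI subsetI)
        fix y assume "y \<in> ext (h 1) ` {place w r | w r. w \<in> \<Lambda> \<and> r \<in> P}"
        then obtain w r where "w \<in> \<Lambda>" "r \<in> P" "y = ext (h 1) (place w r)" by blast
        then show "y \<in> {place w r | w r. w \<in> \<Lambda> \<and> r \<in> h 1 ` P}" using * by blast
      next
        fix y assume "y \<in> {place w r | w r. w \<in> \<Lambda> \<and> r \<in> h 1 ` P}"
        then obtain w r where wr: "w \<in> \<Lambda>" "r \<in> P" "y = place w (h 1 r)" by blast
        then have "y = ext (h 1) (place w r)" using * by simp
        then show "y \<in> ext (h 1) ` {place w r | w r. w \<in> \<Lambda> \<and> r \<in> P}" using wr by blast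
      qed
    qed
    ultimately show ?thesis unfolding insert_cells_def by (simp add: image_Un)
  qed
  have "ext (h 1) ` insert_cells Q P \<subseteq> UNIV \<times> {0<..<1}"
  proof (rule image_subsetI)
    fix p assume "p \<in> insert_cells Q P"
    then have "snd p \<in> {0<..<1}" using T unfolding DP_tangle_over_def by fastforce
    then show "ext (h 1) p \<in> UNIV \<times> {0<..<1}"
      using ext_level[OF out cell order_refl] by (simp add: mem_Times_iff)
  qed
  note iso = DP_isotopic_isotopy[OF T DP_preserving_ext[OF h] this, unfolded img]
  show "DP_isotopic (insert_cells Q P) (insert_cells Q P')" by (rule iso(1))
  obtain A where "DP_tangle_over (A ` \<Lambda>) (insert_cells Q P')" using iso(2) by blast
  \<comment> \<open>The general result gives a tangle over some linear image of \<Lambda>; as the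
    extended map commutes with the shifts, \<Lambda> itself is again a lattice of the
    result.\<close>
  then show "DP_tangle_over \<Lambda> (insert_cells Q P')"
  proof (rule DP_tangle_over_relattice[OF _ lattice])
    fix w k assume w: "w \<in> \<Lambda>" and "k \<in> insert_cells Q P'"
    then obtain p where p: "p \<in> insert_cells Q P" "k = ext (h 1) p" using img by blast
    have "shift w p \<in> insert_cells Q P" using T w p(1) unfolding DP_tangle_over_def by blast
    moreover have "shift w k = ext (h 1) (shift w p)" using ext_shift[OF out w] p(2) by simp
    ultimately show "shift w k \<in> insert_cells Q P'" using img by blast
  qed
qed

lemma insert_cells_moves:
  assumes "cell_move\<^sup>*\<^sup>* P P'" "DP_tangle_over \<Lambda> (insert_cells Q P)" "fst ` Q \<subseteq> outer" "fst ` P \<subseteq> box"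
  shows "DP_isotopic (insert_cells Q P) (insert_cells Q P') \<and> DP_tangle_over \<Lambda> (insert_cells Q P') \<and> fst ` P' \<subseteq> box"
  using assms(1)
proof (induction rule: rtranclp_induct)
  case base
  then show ?case using assms by simp
next
  case (step P' P'')
  then show ?case using insert_cells_move[of Q P' P''] assms(3) DP_isotopic_trans by blast
qed

end

section \<open>Vertical isotopies\<close>

definition raise :: "(space \<Rightarrow> real) \<Rightarrow> space set \<Rightarrow> space set" where
  "raise f K = (\<lambda>k. (fst k, f k)) ` K"

text \<open>Bijectivity holds column by column. The slab is not compact, so continuity of the
  inverse is checked locally, over closed discs.\<close>

lemma fibrewise_homeomorphism:
  fixes e :: "plane \<Rightarrow> real \<Rightarrow> real"
  assumes cont: "continuous_on thickened_plane (\<lambda>p. e (fst p) (snd p))"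
    and mono: "\<And>y z z'. 0 \<le> z \<Longrightarrow> z < z' \<Longrightarrow> z' \<le> 1 \<Longrightarrow> e y z < e y z'"
    and ends: "\<And>y. e y 0 = 0" "\<And>y. e y 1 = 1"
  shows "\<exists>G. homeomorphism thickened_plane thickened_plane (\<lambda>p. (fst p, e (fst p) (snd p))) G"
proof -
  define h where "h p = (fst p, e (fst p) (snd p))" for p
  have hc: "continuous_on thickened_plane h" unfolding h_def by (intro continuous_intros cont)
  have mono': "e y z \<le> e y z'" if "0 \<le> z" "z \<le> z'" "z' \<le> 1" for y z z'
    using mono[of z z' y] that by (cases "z = z'") auto
  have inj: "inj_on h thickened_plane"
  proof (rule inj_onI)
    fix p q assume pq: "p \<in> thickened_plane" "q \<in> thickened_plane" "h p = h q"
    have "fst p = fst q" "e (fst p) (snd p) = e (fst p) (snd q)" using pq(3) unfolding h_def by auto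
    then have "snd p = snd q"
      using mono[of "snd p" "snd q" "fst p"] mono[of "snd q" "snd p" "fst p"] pq(1,2)
      by (auto simp: mem_Times_iff) (metis linorder_cases order_less_irrefl)
    then show "p = q" using \<open>fst p = fst q\<close> by (rule prod_eqI[rotated])
  qed
  \<comment> \<open>Columns are preserved, so the slab over any \<open>C\<close> is mapped onto
    itself; this is what allows the restriction to compact pieces.\<close>
  have imC: "h ` (C \<times> {0..1}) = C \<times> {0..1}" for C
  proof (intro equalityI subsetI)
    fix q assume "q \<in> h ` (C \<times> {0..1})"
    then obtain p where p: "p \<in> C \<times> {0..1}" "q = h p" by blast
    then show "q \<in> C \<times> {0..1}"
      using mono'[of 0 "snd p" "fst p"] mono'[of "snd p" 1 "fst p"] ends unfolding h_def
      by (auto simp: mem_Times_iff)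
  next
    fix q :: space assume q: "q \<in> C \<times> {0..1}"
    have "continuous_on {0..1} (\<lambda>z. e (fst q) z)"
    proof -
      have "continuous_on {0..1} (\<lambda>z. (fst q, z :: real))" by (intro continuous_intros)
      from continuous_on_compose2[OF cont this] show ?thesis by auto
    qed
    then obtain z where "0 \<le> z" "z \<le> 1" "e (fst q) z = snd q"
      using IVT'[of "e (fst q)" 0 "snd q" 1] ends q by (auto simp: mem_Times_iff)
    then have "h (fst q, z) = q" "(fst q, z) \<in> C \<times> {0..1}" using q unfolding h_def by (auto simp: mem_Times_iff)
    then show "q \<in> h ` (C \<times> {0..1})" by (metis image_eqI)
  qed
  define G where "G = inv_into thickened_plane h"
  have hG: "h (G q) = q" "G q \<in> thickened_plane" if "q \<in> thickened_plane" for q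
    unfolding G_def using that imC[of UNIV] by (auto intro: f_inv_into_f inv_into_into simp del: mem_Times_iff)
  have Gh: "G (h p) = p" if "p \<in> thickened_plane" for p
    unfolding G_def using that inj by simp
  have "continuous (at p within thickened_plane) G" if p: "p \<in> thickened_plane" for p
  proof -
    \<comment> \<open>The slab over the unit disc is compact and is a neighbourhood of
      \<open>p\<close> within the slab.\<close>
    define C where "C = cball (fst p) 1 \<times> {0..1::real}"
    have "compact C" unfolding C_def by (intro compact_Times) auto
    have CT: "C \<subseteq> thickened_plane" unfolding C_def by auto
    have "continuous_on (h ` C) G"
      by (rule continuous_on_inv[OF continuous_on_subset[OF hc CT] \<open>compact C\<close>]) (use Gh CT in blast)
    then have "continuous_on C G" unfolding C_def imC .
    moreover have "p \<in> C" using p unfolding C_def by (auto simp: mem_Times_iff)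
    ultimately have "continuous (at p within C) G" by (simp add: continuous_on_eq_continuous_within)
    moreover have "at p within C = at p within thickened_plane"
    proof (rule at_within_nhd[of p "ball (fst p) 1 \<times> UNIV"])
      show "p \<in> ball (fst p) 1 \<times> UNIV" by (simp add: mem_Times_iff)
      show "open (ball (fst p) 1 \<times> (UNIV :: real set))" by (intro open_Times) auto
      show "C \<inter> (ball (fst p) 1 \<times> UNIV) - {p} = thickened_plane \<inter> (ball (fst p) 1 \<times> UNIV) - {p}"
        unfolding C_def by auto
    qed
    ultimately show ?thesis by simp
  qed
  then have "continuous_on thickened_plane G" by (simp add: continuous_on_eq_continuous_within)
  then have "homeomorphism thickened_plane thickened_plane h G"
    by (intro homeomorphismI hc) (use imC[of UNIV] hG Gh in blast)+
  then show ?thesis unfolding h_def by blast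
qed

definition spline :: "real \<Rightarrow> real \<Rightarrow> real \<Rightarrow> real \<Rightarrow> real \<Rightarrow> real" where
  \<comment> \<open>the piecewise linear map of the unit interval through \<open>(a1, b1)\<close> and \<open>(a2, b2)\<close>\<close>
  "spline a1 b1 a2 b2 z = b1 * min (z / a1) 1 + (b2 - b1) * max 0 (min ((z - a1) / (a2 - a1)) 1) +
     (1 - b2) * max 0 ((z - a2) / (1 - a2))"

lemma spline_values:
  assumes "0 < a1" "a1 < a2" "a2 < 1" "0 < b1" "b1 < b2" "b2 < 1"
  shows "spline a1 b1 a2 b2 0 = 0" "spline a1 b1 a2 b2 1 = 1"
    "spline a1 b1 a2 b2 a1 = b1" "spline a1 b1 a2 b2 a2 = b2"
proof -
  have "min ((0 - a1) / (a2 - a1)) 1 = (0 - a1) / (a2 - a1)" "max 0 ((0 - a1) / (a2 - a1)) = 0"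
    "max 0 ((0 - a2) / (1 - a2)) = 0" "max 0 ((a1 - a2) / (1 - a2)) = 0"
    "min ((1 - a1) / (a2 - a1)) 1 = 1" "min (1 / a1) 1 = 1" "min (a2 / a1) 1 = 1"
    using assms by (auto simp: min_def max_def field_simps divide_le_0_iff)
  then show "spline a1 b1 a2 b2 0 = 0" "spline a1 b1 a2 b2 1 = 1"
    "spline a1 b1 a2 b2 a1 = b1" "spline a1 b1 a2 b2 a2 = b2"
    using assms unfolding spline_def by simp_all
qed

text \<open>All three summands are weakly increasing, and the position of \<open>z\<close> decides
  which one is strict. The outer two are not clamped at 0 and at 1, respectively, so monotonicity
  holds on the whole line.\<close>

lemma spline_strict_mono:
  assumes a: "0 < a1" "a1 < a2" "a2 < 1" and b: "0 < b1" "b1 < b2" "b2 < 1" and z: "z < z'"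
  shows "spline a1 b1 a2 b2 z < spline a1 b1 a2 b2 z'"
proof -
  have q: "z / a1 < z' / a1" "(z - a1) / (a2 - a1) < (z' - a1) / (a2 - a1)" "(z - a2) / (1 - a2) < (z' - a2) / (1 - a2)"
    using a z by (auto simp: divide_strict_right_mono)
  have le: "min (z / a1) 1 \<le> min (z' / a1) 1"
    "max 0 (min ((z - a1) / (a2 - a1)) 1) \<le> max 0 (min ((z' - a1) / (a2 - a1)) 1)"
    "max 0 ((z - a2) / (1 - a2)) \<le> max 0 ((z' - a2) / (1 - a2))"
    using q by (auto simp: min_def max_def)
  have le': "b1 * min (z / a1) 1 \<le> b1 * min (z' / a1) 1"
    "(b2 - b1) * max 0 (min ((z - a1) / (a2 - a1)) 1) \<le> (b2 - b1) * max 0 (min ((z' - a1) / (a2 - a1)) 1)"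
    "(1 - b2) * max 0 ((z - a2) / (1 - a2)) \<le> (1 - b2) * max 0 ((z' - a2) / (1 - a2))"
    using le b by (auto intro: mult_left_mono)
  consider "z < a1" | "a1 \<le> z" "z < a2" | "a2 \<le> z" by linarith
  then show ?thesis
  proof cases
    case 1
    then have "z / a1 < 1" using a by (simp add: field_simps)
    then have "min (z / a1) 1 < min (z' / a1) 1" using q by (auto simp: min_def)
    then have "b1 * min (z / a1) 1 < b1 * min (z' / a1) 1" using b by simp
    then show ?thesis using le' unfolding spline_def by linarith
  next
    case 2
    then have "0 \<le> (z - a1) / (a2 - a1)" "(z - a1) / (a2 - a1) < 1" using a by (auto simp: field_simps)
    then have "max 0 (min ((z - a1) / (a2 - a1)) 1) < max 0 (min ((z' - a1) / (a2 - a1)) 1)"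
      using q by (auto simp: min_def max_def)
    then have "(b2 - b1) * max 0 (min ((z - a1) / (a2 - a1)) 1) < (b2 - b1) * max 0 (min ((z' - a1) / (a2 - a1)) 1)"
      using b by simp
    then show ?thesis using le' unfolding spline_def by linarith
  next
    case 3
    then have "0 \<le> (z - a2) / (1 - a2)" using a by (auto simp: field_simps)
    then have "max 0 ((z - a2) / (1 - a2)) < max 0 ((z' - a2) / (1 - a2))"
      using q by (auto simp: max_def)
    then have "(1 - b2) * max 0 ((z - a2) / (1 - a2)) < (1 - b2) * max 0 ((z' - a2) / (1 - a2))"
      using b by simp
    then show ?thesis using le' unfolding spline_def by linarith
  qed
qed

text \<open>The index set of the sum jumps with \<open>y\<close>. Near a given point it may be
  replaced by one fixed finite set, because the added terms vanish.\<close>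

lemma lattice_sum_continuous:
  fixes g :: "plane \<Rightarrow> 'z :: t2_space \<Rightarrow> real"
  assumes "is_lattice \<Lambda>" and g: "continuous_on (UNIV \<times> Z) (\<lambda>(y, z). g y z)"
    and supp: "\<And>y z. norm y > R \<Longrightarrow> z \<in> Z \<Longrightarrow> g y z = 0"
  shows "continuous_on (UNIV \<times> Z) (\<lambda>(y, z). \<Sum>w | w \<in> \<Lambda> \<and> norm (w + y) \<le> R. g (w + y) z)"
proof -
  let ?G = "\<lambda>(y, z). \<Sum>w | w \<in> \<Lambda> \<and> norm (w + y) \<le> R. g (w + y) z"
  have "continuous (at p within UNIV \<times> Z) ?G" if p: "p \<in> UNIV \<times> Z" for p
  proof -
    \<comment> \<open>The radius grows by 1 because the comparison is made on the unit ball around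
      \<open>p\<close>.\<close>
    define W where "W = {w \<in> \<Lambda>. norm (w + fst p) \<le> R + 1}"
    define V where "V = ball (fst p) 1 \<times> Z"
    have W: "finite W" unfolding W_def by (rule lattice_finite_bounded[OF assms(1)])
    have "continuous_on V ?G"
    proof (rule continuous_on_eq[of _ "\<lambda>s. \<Sum>w\<in>W. (\<lambda>(y, z). g y z) (w + fst s, snd s)"])
      have "continuous_on V (\<lambda>s. (\<lambda>(y, z). g y z) (w + fst s, snd s))" for w
        by (rule continuous_on_compose2[OF g]) (auto simp: V_def intro!: continuous_intros)
      then show "continuous_on V (\<lambda>s. \<Sum>w\<in>W. (\<lambda>(y, z). g y z) (w + fst s, snd s))"
        by (intro continuous_intros)
      fix s assume s: "s \<in> V"
      have "(\<Sum>w | w \<in> \<Lambda> \<and> norm (w + fst s) \<le> R. g (w + fst s) (snd s)) = (\<Sum>w\<in>W. g (w + fst s) (snd s))"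
      proof (rule sum.mono_neutral_left[OF W])
        have near: "norm (w + fst p) \<le> norm (w + fst s) + 1" for w
          using s norm_triangle_ineq[of "w + fst s" "fst p - fst s"] unfolding V_def
          by (simp add: mem_Times_iff dist_norm)
        show "{w \<in> \<Lambda>. norm (w + fst s) \<le> R} \<subseteq> W"
        proof
          fix w assume "w \<in> {w \<in> \<Lambda>. norm (w + fst s) \<le> R}"
          then show "w \<in> W" unfolding W_def using near[of w] by simp
        qed
        show "\<forall>w\<in>W - {w \<in> \<Lambda>. norm (w + fst s) \<le> R}. g (w + fst s) (snd s) = 0"
        proof
          fix w assume "w \<in> W - {w \<in> \<Lambda>. norm (w + fst s) \<le> R}"
          then have "norm (w + fst s) > R" unfolding W_def by auto
          moreover have "snd s \<in> Z" using s unfolding V_def by (simp add: mem_Times_iff)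
          ultimately show "g (w + fst s) (snd s) = 0" by (rule supp)
        qed
      qed
      then show "(\<Sum>w\<in>W. (\<lambda>(y, z). g y z) (w + fst s, snd s)) = ?G s" by (simp add: case_prod_beta)
    qed
    moreover have "p \<in> V" using p unfolding V_def by (simp add: mem_Times_iff)
    ultimately have "continuous (at p within V) ?G" by (simp add: continuous_on_eq_continuous_within)
    moreover have "at p within V = at p within UNIV \<times> Z"
    proof (rule at_within_nhd[of p "ball (fst p) 1 \<times> UNIV"])
      show "p \<in> ball (fst p) 1 \<times> UNIV" by (simp add: mem_Times_iff)
      show "open (ball (fst p) 1 \<times> (UNIV :: 'z set))" by (intro open_Times) auto
      show "V \<inter> (ball (fst p) 1 \<times> UNIV) - {p} = UNIV \<times> Z \<inter> (ball (fst p) 1 \<times> UNIV) - {p}"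
        unfolding V_def by auto
    qed
    ultimately show ?thesis by simp
  qed
  then show ?thesis by (simp add: continuous_on_eq_continuous_within)
qed

lemma lattice_sum_periodic:
  assumes "is_lattice \<Lambda>" "v \<in> \<Lambda>"
  shows "(\<Sum>w | w \<in> \<Lambda> \<and> norm (w + (y + v)) \<le> R. g (w + (y + v))) = (\<Sum>w | w \<in> \<Lambda> \<and> norm (w + y) \<le> R. g (w + y) :: real)"
proof (rule sum.reindex_bij_witness[of _ "\<lambda>w. w - v" "\<lambda>w. w + v"])
  fix w
  have eq: "w + v + y = w + (y + v)" "w - v + (y + v) = w + y" by (simp_all add: algebra_simps)
  show "w \<in> {w \<in> \<Lambda>. norm (w + (y + v)) \<le> R} \<Longrightarrow> w + v \<in> {w \<in> \<Lambda>. norm (w + y) \<le> R}"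
    "w \<in> {w \<in> \<Lambda>. norm (w + (y + v)) \<le> R} \<Longrightarrow> g (w + v + y) = g (w + (y + v))"
    "w \<in> {w \<in> \<Lambda>. norm (w + y) \<le> R} \<Longrightarrow> w - v \<in> {w \<in> \<Lambda>. norm (w + (y + v)) \<le> R}"
    unfolding eq mem_Collect_eq using lattice_add[OF assms(1)] lattice_diff[OF assms(1)] assms(2) eq by simp_all
qed simp_all

section \<open>Comparing two height functions on the same strands\<close>

definition tame_strands :: "space set \<Rightarrow> bool" where
  "tame_strands K \<longleftrightarrow> closed K \<and> bounded (snd ` K) \<and>
     (\<forall>x\<in>fst ` K. simple_at K x \<or> transverse_double_at K x)"

text \<open>The bounded last coordinate confines the strands to a compact factor, and projection
  along a compact factor is closed.\<close>

lemma closed_fst_tame: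
  assumes "tame_strands K"
  shows "closed (fst ` K)"
proof -
  obtain b where b: "\<And>k. k \<in> K \<Longrightarrow> \<bar>snd k\<bar> \<le> b"
    using assms unfolding tame_strands_def bounded_iff by auto
  have "closed ((\<lambda>p. (snd p, fst p)) -` K)"
    using assms unfolding tame_strands_def by (intro closed_vimage continuous_intros) auto
  then have "closed {y. \<exists>x. x \<in> {-b..b} \<and> (x, y) \<in> (\<lambda>p. (snd p, fst p)) -` K}"
    by (intro closed_compact_projection) auto
  moreover have "fst ` K = {y. \<exists>x. x \<in> {-b..b} \<and> (x, y) \<in> (\<lambda>p. (snd p, fst p)) -` K}"
  proof (intro equalityI subsetI)
    fix y assume "y \<in> fst ` K"
    then obtain k where "k \<in> K" "y = fst k" by blast
    then show "y \<in> {y. \<exists>x. x \<in> {-b..b} \<and> (x, y) \<in> (\<lambda>p. (snd p, fst p)) -` K}"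
      using b[of k] by (auto intro!: exI[of _ "snd k"])
  next
    fix y assume "y \<in> {y. \<exists>x. x \<in> {-b..b} \<and> (x, y) \<in> (\<lambda>p. (snd p, fst p)) -` K}"
    then obtain x where "(y, x) \<in> K" by auto
    then show "y \<in> fst ` K" by (rule image_eqI[rotated]) simp
  qed
  ultimately show ?thesis by simp
qed

text \<open>The two functions order the strand points over each point of the plane alike. Exactly
  this permits an increasing map of every vertical column that takes one set of heights to the
  other.\<close>

locale two_heights =
  fixes K :: "space set" and f f' :: "space \<Rightarrow> real"
  assumes tame: "tame_strands K"
    and cont: "continuous_on K f" "continuous_on K f'"
    and range: "\<And>k. k \<in> K \<Longrightarrow> 0 < f k \<and> f k < 1" "\<And>k. k \<in> K \<Longrightarrow> 0 < f' k \<and> f' k < 1"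
    and same_order: "\<And>k l. k \<in> K \<Longrightarrow> l \<in> K \<Longrightarrow> k \<noteq> l \<Longrightarrow> fst k = fst l \<Longrightarrow>
      f k < f l \<and> f' k < f' l \<or> f l < f k \<and> f' l < f' k"
begin

text \<open>A continuous family of increasing column maps over a small disc, taking the heights
  \<open>f\<close> of the strands to the heights \<open>f'\<close>.\<close>

definition local_profile :: "plane \<Rightarrow> real \<Rightarrow> (plane \<Rightarrow> real \<Rightarrow> real) \<Rightarrow> bool" where
  "local_profile x r \<mu> \<longleftrightarrow> 0 < r \<and> continuous_on (cball x r \<times> {0..1}) (\<lambda>(y, z). \<mu> y z) \<and>
     (\<forall>y\<in>cball x r. \<mu> y 0 = 0 \<and> \<mu> y 1 = 1 \<and> (\<forall>z z'. z < z' \<longrightarrow> \<mu> y z < \<mu> y z')) \<and>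
     (\<forall>k\<in>K. fst k \<in> cball x r \<longrightarrow> \<mu> (fst k) (f k) = f' k)"

text \<open>The heights of the nearby strands are values of two continuous sections. Their order at
  \<open>x\<close> persists on a small disc, and there the spline through the two pairs of values is
  a profile. Sections that no strand uses may serve as fillers.\<close>

lemma local_profile_sections:
  assumes W: "open W" "x \<in> W"
    and c: "continuous_on W a1" "continuous_on W b1" "continuous_on W a2" "continuous_on W b2"
    and r: "\<And>y. y \<in> W \<Longrightarrow> 0 < a1 y \<and> a2 y < 1 \<and> 0 < b1 y \<and> b2 y < 1"
    and less: "a1 x < a2 x" "b1 x < b2 x"
    and k: "\<And>k. k \<in> K \<Longrightarrow> fst k \<in> W \<Longrightarrow>
      f k = a1 (fst k) \<and> f' k = b1 (fst k) \<or> f k = a2 (fst k) \<and> f' k = b2 (fst k)"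
  shows "\<exists>r \<mu>. local_profile x r \<mu>"
proof -
  have "open (W \<inter> (\<lambda>y. a2 y - a1 y) -` {0<..})" "open (W \<inter> (\<lambda>y. b2 y - b1 y) -` {0<..})"
    by (intro continuous_open_preimage continuous_intros c W open_greaterThan)+
  then have "open ((W \<inter> (\<lambda>y. a2 y - a1 y) -` {0<..}) \<inter> (W \<inter> (\<lambda>y. b2 y - b1 y) -` {0<..}))" by blast
  moreover have "x \<in> (W \<inter> (\<lambda>y. a2 y - a1 y) -` {0<..}) \<inter> (W \<inter> (\<lambda>y. b2 y - b1 y) -` {0<..})"
    using less W by simp
  ultimately obtain r where r0: "r > 0"
    and sub: "cball x r \<subseteq> (W \<inter> (\<lambda>y. a2 y - a1 y) -` {0<..}) \<inter> (W \<inter> (\<lambda>y. b2 y - b1 y) -` {0<..})"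
    unfolding open_contains_cball by blast
  have in_W: "y \<in> W" and ab: "0 < a1 y" "a1 y < a2 y" "a2 y < 1" "0 < b1 y" "b1 y < b2 y" "b2 y < 1"
    if "y \<in> cball x r" for y
    using subsetD[OF sub that] r by auto
  define \<mu> where "\<mu> y = spline (a1 y) (b1 y) (a2 y) (b2 y)" for y
  have c': "continuous_on (cball x r \<times> {0..1::real}) (\<lambda>p. g (fst p))" if "continuous_on W g" for g :: "plane \<Rightarrow> real"
    by (rule continuous_on_compose2[OF that]) (use in_W in \<open>auto intro!: continuous_intros simp del: mem_cball\<close>)
  have ne: "a1 (fst p) \<noteq> 0" "a2 (fst p) - a1 (fst p) \<noteq> 0" "1 - a2 (fst p) \<noteq> 0"
    if "p \<in> cball x r \<times> {0..1::real}" for p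
    using ab[of "fst p"] that by (auto simp: mem_Times_iff simp del: mem_cball)
  have "continuous_on (cball x r \<times> {0..1}) (\<lambda>(y, z). \<mu> y z)"
    unfolding \<mu>_def spline_def case_prod_beta
    by (intro continuous_intros c' c) (use ne in blast)+
  moreover have "\<mu> (fst k) (f k) = f' k" if "k \<in> K" "fst k \<in> cball x r" for k
    using k[OF that(1) in_W[OF that(2)]] spline_values(3,4)[OF ab[OF that(2)]] unfolding \<mu>_def by auto
  ultimately have "local_profile x r \<mu>"
    unfolding local_profile_def using r0 spline_values(1,2)[OF ab] spline_strict_mono[OF ab] unfolding \<mu>_def
    by blast
  then show ?thesis by blast
qed

lemma local_profile_exists: "\<exists>r \<mu>. local_profile x r \<mu>"
proof (cases "x \<in> fst ` K")
  case False
  \<comment> \<open>With no strand nearby two arbitrary ordered constants do, and the spline is the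
    identity on the unit interval.\<close>
  show ?thesis
  proof (rule local_profile_sections[of "- fst ` K" x "\<lambda>_. 1/3" "\<lambda>_. 1/3" "\<lambda>_. 2/3" "\<lambda>_. 2/3"])
    show "open (- fst ` K)" using closed_fst_tame[OF tame] by (rule open_Compl)
  qed (use False in auto)
next
  case True
  then consider "simple_at K x" | "transverse_double_at K x" using tame unfolding tame_strands_def by blast
  then show ?thesis
  proof cases
    case 1
    then obtain W g g' h where W: "open W" "x \<in> W" and g: "homeomorphism W (UNIV :: plane set) g g'"
      and h: "homeomorphism (over_part K W) (UNIV \<times> {0}) (g \<circ> fst) h"
      unfolding simple_at_def by blast
    have hK: "h p \<in> K" if "p \<in> UNIV \<times> {0}" for p
      using h that unfolding homeomorphism_def over_part_def by blast
    \<comment> \<open>In the chart the strand is the horizontal axis. Projecting to the axis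
      attaches a strand point to every \<open>y\<close> in \<open>W\<close>, which extends heights
      from the strand to a full neighbourhood.\<close>
    define s where "s y = h (fst (g y), 0)" for y
    have sc: "continuous_on W s" unfolding s_def
    proof (rule continuous_on_compose2[of "UNIV \<times> {0}" h])
      show "continuous_on (UNIV \<times> {0}) h" using h unfolding homeomorphism_def by blast
      show "continuous_on W (\<lambda>y. (fst (g y), 0 :: real))"
        using g unfolding homeomorphism_def by (intro continuous_intros) blast
    qed auto
    have sK: "s y \<in> K" for y unfolding s_def by (rule hK) simp
    have sk: "s (fst k) = k" if "k \<in> K" "fst k \<in> W" for k
    proof -
      have k: "k \<in> over_part K W" using that unfolding over_part_def by simp
      then have "g (fst k) \<in> UNIV \<times> {0}" using h unfolding homeomorphism_def by auto
      then have "(fst (g (fst k)), 0) = (g \<circ> fst) k" by (simp add: mem_Times_iff prod_eq_iff)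
      then show ?thesis unfolding s_def using h k unfolding homeomorphism_def by metis
    qed
    have c: "continuous_on W (\<lambda>y. f (s y))" "continuous_on W (\<lambda>y. f' (s y))"
      using sK by (auto intro!: continuous_on_compose2[OF cont(1) sc] continuous_on_compose2[OF cont(2) sc])
    show ?thesis
    \<comment> \<open>There is one strand only; the second section is a filler halfway between it
      and the level 1.\<close>
    proof (rule local_profile_sections[OF W c(1) c(2), of "\<lambda>y. (f (s y) + 1) / 2" "\<lambda>y. (f' (s y) + 1) / 2"])
      fix y show "0 < f (s y) \<and> (f (s y) + 1) / 2 < 1 \<and> 0 < f' (s y) \<and> (f' (s y) + 1) / 2 < 1"
        using range[OF sK[of y]] by simp
    next
      show "f (s x) < (f (s x) + 1) / 2" "f' (s x) < (f' (s x) + 1) / 2" using range[OF sK[of x]] by auto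
    qed (use sk c in \<open>auto intro!: continuous_intros\<close>)
  next
    case 2
    then obtain W g g' A B h h' where W: "open W" "x \<in> W" and g: "homeomorphism W (UNIV :: plane set) g g'"
      and gx: "g x = (0, 0)" and AB: "over_part K W = A \<union> B" "A \<inter> B = {}"
      and h: "homeomorphism A (UNIV \<times> {0}) (g \<circ> fst) h" and h': "homeomorphism B ({0} \<times> UNIV) (g \<circ> fst) h'"
      unfolding transverse_double_at_def by (elim exE conjE) (rule that)
    have gc: "continuous_on W g" and "\<forall>y\<in>W. g' (g y) = y" using g unfolding homeomorphism_def by blast+
    then have ginj: "inj_on g W" by (auto intro: inj_on_inverseI)
    \<comment> \<open>The two branches are the coordinate axes of the chart; projecting to each axis
      extends the heights of both branches to all of \<open>W\<close>.\<close>
    define s where "s y = h (fst (g y), 0)" for y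
    define s' where "s' y = h' (0, snd (g y))" for y
    have sc: "continuous_on W s" unfolding s_def
    proof (rule continuous_on_compose2[of "UNIV \<times> {0}" h])
      show "continuous_on (UNIV \<times> {0}) h" using h unfolding homeomorphism_def by blast
    qed (auto intro!: continuous_intros gc)
    have sc': "continuous_on W s'" unfolding s'_def
    proof (rule continuous_on_compose2[of "{0} \<times> UNIV" h'])
      show "continuous_on ({0} \<times> UNIV) h'" using h' unfolding homeomorphism_def by blast
    qed (auto intro!: continuous_intros gc)
    have sA: "s y \<in> A" for y unfolding s_def using h unfolding homeomorphism_def by blast
    have sB: "s' y \<in> B" for y unfolding s'_def using h' unfolding homeomorphism_def by blast
    have sK: "s y \<in> K" "s' y \<in> K" "fst (s y) \<in> W" "fst (s' y) \<in> W" for y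
      using sA sB AB(1) unfolding over_part_def by blast+
    have hA: "h (g (fst k)) = k" "g (fst k) \<in> UNIV \<times> {0}" if "k \<in> A" for k
      using homeomorphism_apply1[OF h that] homeomorphism_image1[OF h] that by auto
    have hB: "h' (g (fst k)) = k" "g (fst k) \<in> {0} \<times> UNIV" if "k \<in> B" for k
      using homeomorphism_apply1[OF h' that] homeomorphism_image1[OF h'] that by auto
    have skA: "s (fst k) = k" if "k \<in> A" for k
    proof -
      have "(fst (g (fst k)), 0) = g (fst k)" using hA(2)[OF that] by (simp add: mem_Times_iff prod_eq_iff)
      then show ?thesis unfolding s_def using hA(1)[OF that] by simp
    qed
    have skB: "s' (fst k) = k" if "k \<in> B" for k
    proof -
      have "(0, snd (g (fst k))) = g (fst k)" using hB(2)[OF that] by (simp add: mem_Times_iff prod_eq_iff)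
      then show ?thesis unfolding s'_def using hB(1)[OF that] by simp
    qed
    have z: "((0::real), (0::real)) \<in> UNIV \<times> {0}" "((0::real), (0::real)) \<in> {0} \<times> UNIV" by auto
    have "g (fst (s x)) = g x"
      using homeomorphism_apply2[OF h z(1)] unfolding s_def gx fst_conv snd_conv comp_apply .
    from inj_onD[OF ginj this sK(3) W(2)] have fx: "fst (s x) = x" .
    have "g (fst (s' x)) = g x"
      using homeomorphism_apply2[OF h' z(2)] unfolding s'_def gx fst_conv snd_conv comp_apply .
    from inj_onD[OF ginj this sK(4) W(2)] have fx': "fst (s' x) = x" .
    have "s x \<noteq> s' x"
    proof
      assume "s x = s' x"
      then have "s x \<in> A \<inter> B" using sA[of x] sB[of x] by simp
      then show False unfolding AB(2) by simp
    qed
    have c: "continuous_on W (\<lambda>y. f (s y))" "continuous_on W (\<lambda>y. f' (s y))"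
      "continuous_on W (\<lambda>y. f (s' y))" "continuous_on W (\<lambda>y. f' (s' y))"
      using sK(1,2) continuous_on_compose2[OF cont(1) sc] continuous_on_compose2[OF cont(2) sc]
        continuous_on_compose2[OF cont(1) sc'] continuous_on_compose2[OF cont(2) sc'] by blast+
    have cases: "s (fst k) = k \<or> s' (fst k) = k" if "k \<in> K" "fst k \<in> W" for k
    proof -
      have "k \<in> A \<union> B" using that AB(1) unfolding over_part_def by blast
      then show ?thesis using skA skB by blast
    qed
    have r: "0 < f (s y) \<and> f (s' y) < 1 \<and> 0 < f' (s y) \<and> f' (s' y) < 1"
      "0 < f (s' y) \<and> f (s y) < 1 \<and> 0 < f' (s' y) \<and> f' (s y) < 1" for y
      using range(1)[OF sK(1)[of y]] range(2)[OF sK(1)[of y]] range(1)[OF sK(2)[of y]] range(2)[OF sK(2)[of y]]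
      by linarith+
    have vals: "f k = f (s (fst k)) \<and> f' k = f' (s (fst k)) \<or> f k = f (s' (fst k)) \<and> f' k = f' (s' (fst k))"
      if "k \<in> K" "fst k \<in> W" for k
      using cases[OF that] by (elim disjE) simp_all
    have "f (s x) < f (s' x) \<and> f' (s x) < f' (s' x) \<or> f (s' x) < f (s x) \<and> f' (s' x) < f' (s x)"
      by (rule same_order[OF sK(1,2) \<open>s x \<noteq> s' x\<close>]) (simp only: fx fx')
    \<comment> \<open>Which branch is the lower one at \<open>x\<close> decides the order of the two
      sections.\<close>
    then show ?thesis
    proof (elim disjE conjE)
      assume "f (s x) < f (s' x)" "f' (s x) < f' (s' x)"
      from local_profile_sections[OF W c r(1) this vals] show ?thesis .
    next
      assume "f (s' x) < f (s x)" "f' (s' x) < f' (s x)"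
      from local_profile_sections[OF W c(3,4,1,2) r(2) this vals[THEN disj_commute[THEN iffD1]]] show ?thesis .
    qed
  qed
qed

end

locale periodic_heights = two_heights +
  fixes \<Lambda> :: "plane set"
  assumes lattice: "is_lattice \<Lambda>"
    and periodic: "\<And>w k. w \<in> \<Lambda> \<Longrightarrow> k \<in> K \<Longrightarrow> \<exists>k'\<in>K. fst k' = fst k + w \<and> f k' = f k \<and> f' k' = f' k"
begin

text \<open>
  Increasing maps of the unit interval with prescribed values form a convex set, so the local profiles
  can be glued by periodic weights.
\<close>

lemma profile_exists:
  obtains m :: "plane \<Rightarrow> real \<Rightarrow> real"
  where "continuous_on thickened_plane (\<lambda>p. m (fst p) (snd p))"
    and "\<And>y. m y 0 = 0" "\<And>y. m y 1 = 1" "\<And>y z z'. 0 \<le> z \<Longrightarrow> z < z' \<Longrightarrow> z' \<le> 1 \<Longrightarrow> m y z < m y z'"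
    and "\<And>k. k \<in> K \<Longrightarrow> m (fst k) (f k) = f' k" "\<And>w y z. w \<in> \<Lambda> \<Longrightarrow> m (y + w) z = m y z"
proof -
  have "\<forall>x. \<exists>r \<mu>. local_profile x r \<mu>" using local_profile_exists by blast
  then obtain r \<mu> where prof: "\<And>x. local_profile x (r x) (\<mu> x)" by metis
  have r0: "0 < r x" and \<mu>c: "continuous_on (cball x (r x) \<times> {0..1}) (\<lambda>(y, z). \<mu> x y z)" for x
    using prof[of x] unfolding local_profile_def by blast+
  have \<mu>0: "\<mu> x y 0 = 0" and \<mu>1: "\<mu> x y 1 = 1" and \<mu>mono: "\<And>z z'. z < z' \<Longrightarrow> \<mu> x y z < \<mu> x y z'"
    if "y \<in> cball x (r x)" for x y
    using prof[of x] that unfolding local_profile_def by blast+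
  have \<mu>f: "\<mu> x (fst k) (f k) = f' k" if "k \<in> K" "fst k \<in> cball x (r x)" for x k
    using prof[of x] that unfolding local_profile_def by blast
  obtain R where R: "\<And>x. \<exists>w\<in>\<Lambda>. norm (x + w) \<le> R"
    by (rule lattice_cocompact[OF lattice]) (rule that)
  \<comment> \<open>Every lattice orbit meets this disc, so finitely many profile discs and their
    translates cover the plane.\<close>
  have all: "cball 0 R \<subseteq> (\<Union>x\<in>UNIV. ball x (r x))"
  proof
    fix y
    have "y \<in> ball y (r y)" using r0[of y] by simp
    then show "y \<in> (\<Union>x\<in>UNIV. ball x (r x))" by (rule UN_I[OF UNIV_I])
  qed
  obtain X where "X \<subseteq> UNIV" and X: "finite X" and cover: "cball 0 R \<subseteq> (\<Union>x\<in>X. ball x (r x))"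
    by (rule compactE_image[OF compact_cball open_ball all]) (rule that)
  have "bounded (\<Union>x\<in>X. cball x (r x))" using X by auto
  then obtain R' where R': "norm y \<le> R'" if "x \<in> X" "y \<in> cball x (r x)" for x y
    unfolding bounded_iff by blast
  \<comment> \<open>A tent function as unnormalised weight; it vanishes outside the disc on which
    the profile at \<open>x\<close> is known.\<close>
  define d where "d x y = max 0 (r x - dist x y)" for x y :: plane
  have d0: "0 \<le> d x y" for x y unfolding d_def by simp
  have d_in: "y \<in> cball x (r x)" if "d x y \<noteq> 0" for x y using that unfolding d_def by (auto split: if_splits simp: max_def)
  define g where "g y z = (\<Sum>x\<in>X. if y \<in> cball x (r x) then d x y * \<mu> x y z else 0)" for y z
  \<comment> \<open>The second argument is a dummy, so that the continuity lemma for lattice sums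
    applies to the total weight, too.\<close>
  define D where "D y z = (\<Sum>x\<in>X. d x y)" for y and z :: real
  have "continuous_on (UNIV \<times> {0..1}) (\<lambda>p. if fst p \<in> cball x (r x) then d x (fst p) * \<mu> x (fst p) (snd p) else 0)" for x
  proof -
    have "continuous_on (cball x (r x) \<times> {0..1} \<union> (- ball x (r x)) \<times> {0..1})
      (\<lambda>p. if fst p \<in> cball x (r x) then d x (fst p) * \<mu> x (fst p) (snd p) else 0)"
    proof (rule continuous_on_cases)
      show "closed (cball x (r x) \<times> {0..1::real})" "closed ((- ball x (r x)) \<times> {0..1::real})"
        by (auto intro!: closed_Times simp: closed_Compl)
      show "continuous_on (cball x (r x) \<times> {0..1}) (\<lambda>p. d x (fst p) * \<mu> x (fst p) (snd p))"
        using \<mu>c[of x] unfolding d_def case_prod_beta by (intro continuous_intros)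
      show "\<forall>p. p \<in> cball x (r x) \<times> {0..1} \<and> fst p \<notin> cball x (r x) \<or>
          p \<in> (- ball x (r x)) \<times> {0..1} \<and> fst p \<in> cball x (r x) \<longrightarrow> d x (fst p) * \<mu> x (fst p) (snd p) = 0"
        unfolding d_def by (auto simp: mem_Times_iff)
    qed (rule continuous_on_const)
    moreover have "cball x (r x) \<times> {0..1} \<union> (- ball x (r x)) \<times> {0..1} = (UNIV :: plane set) \<times> {0..1::real}"
      by auto
    ultimately show ?thesis by simp
  qed
  then have gc: "continuous_on (UNIV \<times> {0..1}) (\<lambda>(y, z). g y z)"
    unfolding g_def case_prod_beta by (intro continuous_on_sum)
  have Dc: "continuous_on (UNIV \<times> {0..1::real}) (\<lambda>(y, z). D y z)"
    unfolding D_def d_def case_prod_beta by (intro continuous_intros)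
  have far: "d x y = 0" if "x \<in> X" "norm y > R'" for x y
    using R'[OF that(1)] d_in[of x y] that(2) by fastforce
  \<comment> \<open>\<open>G\<close> sums the weighted profiles over all translates and
    \<open>E\<close> sums the weights. Their quotient is a convex combination of profiles, so it is
    increasing and has the same ends and the same prescribed values.\<close>
  define G where "G y z = (\<Sum>w | w \<in> \<Lambda> \<and> norm (w + y) \<le> R'. g (w + y) z)" for y z
  define E where "E y z = (\<Sum>w | w \<in> \<Lambda> \<and> norm (w + y) \<le> R'. D (w + y) z)" for y and z :: real
  have Gc: "continuous_on (UNIV \<times> {0..1}) (\<lambda>(y, z). G y z)" unfolding G_def
    by (rule lattice_sum_continuous[OF lattice gc]) (auto simp: g_def far intro!: sum.neutral)
  have Ec: "continuous_on (UNIV \<times> {0..1}) (\<lambda>(y, z). E y z)" unfolding E_def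
    by (rule lattice_sum_continuous[OF lattice Dc]) (simp add: D_def far)
  have fin: "finite {w \<in> \<Lambda>. norm (w + y) \<le> R'}" for y by (rule lattice_finite_bounded[OF lattice])
  have pos: "\<exists>w x. w \<in> \<Lambda> \<and> norm (w + y) \<le> R' \<and> x \<in> X \<and> 0 < d x (w + y)" for y
  proof -
    obtain w where w: "w \<in> \<Lambda>" "norm (y + w) \<le> R" using R by blast
    then obtain x where x: "x \<in> X" "y + w \<in> ball x (r x)" using cover by auto
    then have "0 < d x (w + y)" unfolding d_def by (simp add: add.commute)
    moreover have "norm (w + y) \<le> R'" using R'[OF x(1), of "w + y"] x(2) by (simp add: add.commute)
    ultimately show ?thesis using w x by blast
  qed
  have Epos: "0 < E y z" for y z
  proof -
    obtain w x where wx: "w \<in> \<Lambda>" "norm (w + y) \<le> R'" "x \<in> X" "0 < d x (w + y)" using pos by blast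
    have "0 < D (w + y) z" unfolding D_def
      by (rule sum_pos2[where f = "\<lambda>x. d x (w + y)", OF X wx(3,4)]) (rule d0)
    moreover have "0 \<le> D (w' + y) z" for w' unfolding D_def by (rule sum_nonneg) (rule d0)
    ultimately show ?thesis unfolding E_def using wx
      by (intro sum_pos2[OF fin, where i = w]) simp_all
  qed
  have g_eq: "g y z = c * D y z'" if "\<And>x. x \<in> X \<Longrightarrow> y \<in> cball x (r x) \<Longrightarrow> \<mu> x y z = c" for y z z' c
    unfolding g_def D_def sum_distrib_left
    using that d_in by (intro sum.cong refl) (metis mult.commute mult_zero_right)
  have G_eq: "G y z = c * E y z'"
    if "\<And>w x. w \<in> \<Lambda> \<Longrightarrow> x \<in> X \<Longrightarrow> w + y \<in> cball x (r x) \<Longrightarrow> \<mu> x (w + y) z = c" for y z z' c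
    unfolding G_def E_def sum_distrib_left using that g_eq[of _ z c z'] by (intro sum.cong refl) blast
  have g_le: "g y z \<le> g y z'" if "z < z'" for y z z'
    unfolding g_def
  proof (rule sum_mono)
    fix x
    show "(if y \<in> cball x (r x) then d x y * \<mu> x y z else 0) \<le> (if y \<in> cball x (r x) then d x y * \<mu> x y z' else 0)"
      using mult_left_mono[OF less_imp_le[OF \<mu>mono[OF _ that]] d0, of y x x y] by simp
  qed
  have g_less: "g y z < g y z'" if "z < z'" "x \<in> X" "0 < d x y" for y z z' x
    unfolding g_def
  proof (rule sum_strict_mono_ex1[OF X])
    show "\<forall>x\<in>X. (if y \<in> cball x (r x) then d x y * \<mu> x y z else 0) \<le> (if y \<in> cball x (r x) then d x y * \<mu> x y z' else 0)"
      using mult_left_mono[OF less_imp_le[OF \<mu>mono[OF _ that(1)]] d0] by simp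
    have "y \<in> cball x (r x)" using d_in that(3) by fastforce
    then show "\<exists>x\<in>X. (if y \<in> cball x (r x) then d x y * \<mu> x y z else 0) < (if y \<in> cball x (r x) then d x y * \<mu> x y z' else 0)"
      using \<mu>mono[OF _ that(1)] that(2,3) by (intro bexI[of _ x]) auto
  qed
  have G_less: "G y z < G y z'" if zz: "z < z'" for y z z'
    unfolding G_def
  proof (rule sum_strict_mono_ex1[OF fin])
    show "\<forall>w\<in>{w \<in> \<Lambda>. norm (w + y) \<le> R'}. g (w + y) z \<le> g (w + y) z'" using g_le[OF zz] by blast
    obtain w x where "w \<in> \<Lambda>" "norm (w + y) \<le> R'" "x \<in> X" "0 < d x (w + y)" using pos by blast
    then show "\<exists>w\<in>{w \<in> \<Lambda>. norm (w + y) \<le> R'}. g (w + y) z < g (w + y) z'"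
      using g_less[OF zz] by blast
  qed
  show ?thesis
  proof (rule that[of "\<lambda>y z. G y z / E y 0"])
    have E0: "continuous_on thickened_plane (\<lambda>p. E (fst p) 0)"
      using Ec unfolding case_prod_beta E_def D_def .
    show "continuous_on thickened_plane (\<lambda>p. G (fst p) (snd p) / E (fst p) 0)"
      by (rule continuous_on_divide[OF Gc[unfolded case_prod_beta] E0]) (metis Epos less_irrefl)
    show "G y 0 / E y 0 = 0" for y using G_eq[of y 0 0 0] \<mu>0 by simp
    show "G y 1 / E y 0 = 1" for y using G_eq[of y 1 1 0] \<mu>1 Epos[of y 0] by simp
    show "G y z / E y 0 < G y z' / E y 0" if "z < z'" for y z z'
      by (rule divide_strict_right_mono[OF G_less[OF that] Epos])
    show "G (fst k) (f k) / E (fst k) 0 = f' k" if k: "k \<in> K" for k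
    proof -
      have "G (fst k) (f k) = f' k * E (fst k) 0"
      proof (rule G_eq)
        fix w x assume "w \<in> \<Lambda>" "x \<in> X" and wx: "w + fst k \<in> cball x (r x)"
        obtain k' where k': "k' \<in> K" "fst k' = fst k + w" "f k' = f k" "f' k' = f' k"
          using periodic[OF \<open>w \<in> \<Lambda>\<close> k] by blast
        then have "w + fst k = fst k'" by (simp add: add.commute)
        then show "\<mu> x (w + fst k) (f k) = f' k" using \<mu>f[OF k'(1)] k' wx by metis
      qed
      then show ?thesis using Epos[of "fst k" 0] by simp
    qed
    show "G (y + w) z / E (y + w) 0 = G y z / E y 0" if "w \<in> \<Lambda>" for w y z
      unfolding G_def E_def using lattice_sum_periodic[OF lattice that, where y = y and R = R' and g = "\<lambda>x. g x z"]
        lattice_sum_periodic[OF lattice that, where y = y and R = R' and g = "\<lambda>x. D x 0"] by simp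
  qed
qed

text \<open>In each column the identity is joined linearly to the profile; convex combinations of
  increasing maps with the same ends are again such maps. Periodicity of the profile makes the
  isotopy commute with \<Lambda>.\<close>

lemma vertical_isotopy:
  assumes T: "DP_tangle_over \<Lambda> (raise f K)"
  shows "DP_isotopic (raise f K) (raise f' K)" and "DP_tangle_over \<Lambda> (raise f' K)"
proof -
  obtain m where mc: "continuous_on thickened_plane (\<lambda>p. m (fst p) (snd p))"
    and m0: "\<And>y. m y 0 = 0" and m1: "\<And>y. m y 1 = 1"
    and mono: "\<And>y z z'. 0 \<le> z \<Longrightarrow> z < z' \<Longrightarrow> z' \<le> 1 \<Longrightarrow> m y z < m y z'"
    and mf: "\<And>k. k \<in> K \<Longrightarrow> m (fst k) (f k) = f' k"
    and mp: "\<And>w y z. w \<in> \<Lambda> \<Longrightarrow> m (y + w) z = m y z"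
    by (rule profile_exists) (rule that)
  define e where "e t y z = (1 - t) * z + t * m y z" for t y z
  define H where "H t p = (fst p, e t (fst p) (snd p))" for t p
  have mc': "continuous_on ({0..1::real} \<times> thickened_plane) (\<lambda>s. m (fst (snd s)) (snd (snd s)))"
    by (rule continuous_on_compose2[OF mc, of _ snd]) (auto intro: continuous_intros)
  have Hc: "continuous_on ({0..1} \<times> thickened_plane) (\<lambda>(t, p). H t p)"
    unfolding H_def e_def case_prod_beta by (intro continuous_intros mc')
  have Hh: "\<exists>G. homeomorphism thickened_plane thickened_plane (H t) G" if t: "t \<in> {0..1}" for t
    unfolding H_def
  proof (rule fibrewise_homeomorphism)
    show "continuous_on thickened_plane (\<lambda>p. e t (fst p) (snd p))"
      unfolding e_def by (intro continuous_intros mc)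
    show "e t y z < e t y z'" if z: "0 \<le> z" "z < z'" "z' \<le> 1" for y z z'
    proof (cases "t = 1")
      case True
      then show ?thesis unfolding e_def using mono[OF z] by simp
    next
      case False
      have "(1 - t) * z < (1 - t) * z'" using False t z by simp
      moreover have "t * m y z \<le> t * m y z'" using mono[OF z, of y] t by (intro mult_left_mono) auto
      ultimately show ?thesis unfolding e_def by linarith
    qed
  qed (simp_all add: e_def m0 m1)
  have H0: "H 0 p = p" for p unfolding H_def e_def by simp
  have Hw: "H t (shift w p) = shift w (H t p)" if "w \<in> \<Lambda>" for t w p
    unfolding H_def e_def shift_def using mp[OF that] by simp
  have iso: "DP_preserving_isotopy \<Lambda> H"
    unfolding DP_preserving_isotopy_def
  proof (intro conjI ballI)
    show "\<exists>A. linear A \<and> inj A \<and> (\<forall>w\<in>\<Lambda>. \<forall>p\<in>thickened_plane. H t (shift w p) = shift (A w) (H t p))" for t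
      by (rule exI[of _ "\<lambda>w. w"]) (simp add: linear_ident Hw)
  qed (rule Hc Hh H0; assumption)+
  have H1: "H 1 ` raise f K = raise f' K"
    unfolding raise_def image_image using mf by (intro image_cong refl) (simp add: H_def e_def)
  have "raise f' K \<subseteq> UNIV \<times> {0<..<1}" unfolding raise_def using range(2) by auto
  then have sub: "H 1 ` raise f K \<subseteq> UNIV \<times> {0<..<1}" unfolding H1 .
  note iso' = DP_isotopic_isotopy[OF T iso sub, unfolded H1]
  show "DP_isotopic (raise f K) (raise f' K)" by (rule iso'(1))
  obtain A where "DP_tangle_over (A ` \<Lambda>) (raise f' K)" using iso'(2) by blast
  then show "DP_tangle_over \<Lambda> (raise f' K)"
  proof (rule DP_tangle_over_relattice[OF _ lattice])
    fix w p assume w: "w \<in> \<Lambda>" and "p \<in> raise f' K"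
    then obtain k where k: "k \<in> K" "p = (fst k, f' k)" unfolding raise_def by blast
    obtain k' where k': "k' \<in> K" "fst k' = fst k + w" "f' k' = f' k" using periodic[OF w k(1)] by blast
    then have "shift w p = (fst k', f' k')" unfolding k shift_def by simp
    then show "shift w p \<in> raise f' K" unfolding raise_def using k'(1) by blast
  qed
qed

end

section \<open>Periodic heights for resolutions\<close>

text \<open>What a resolution retains of a motif: markings are gone, and at every double point
  exactly one of the two strand points is an over point.\<close>

definition classical_motif :: "plane set \<Rightarrow> pseudo_diagram \<Rightarrow> bool" where
  "classical_motif \<Lambda> R \<longleftrightarrow> is_lattice \<Lambda> \<and> tame_strands (strands R) \<and>
     (\<forall>w\<in>\<Lambda>. \<forall>k\<in>strands R. shift w k \<in> strands R \<and> (shift w k \<in> overs R \<longleftrightarrow> k \<in> overs R)) \<and>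
     (\<exists>F. finite F \<and> crossings R \<subseteq> {x + w | x w. x \<in> F \<and> w \<in> \<Lambda>}) \<and>
     (\<forall>k\<in>strands R. \<forall>l\<in>strands R. k \<noteq> l \<and> fst k = fst l \<longrightarrow> (k \<in> overs R \<longleftrightarrow> l \<notin> overs R))"

text \<open>The height functions of \<open>spatial_lift\<close>, with the interior condition of
  \<open>DP_tangle\<close> made explicit but without any periodicity.\<close>

definition heights :: "pseudo_diagram \<Rightarrow> (space \<Rightarrow> real) \<Rightarrow> bool" where
  "heights R f \<longleftrightarrow> continuous_on (strands R) f \<and> (\<forall>k\<in>strands R. 0 < f k \<and> f k < 1) \<and>
     (\<forall>k\<in>strands R. \<forall>l\<in>strands R. k \<noteq> l \<and> fst k = fst l \<and> k \<in> overs R \<longrightarrow> f l < f k)"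

lemma heightsD:
  assumes "heights R f"
  shows "continuous_on (strands R) f" "k \<in> strands R \<Longrightarrow> 0 < f k \<and> f k < 1"
    "k \<in> strands R \<Longrightarrow> l \<in> strands R \<Longrightarrow> k \<noteq> l \<Longrightarrow> fst k = fst l \<Longrightarrow> k \<in> overs R \<Longrightarrow> f l < f k"
  using assms unfolding heights_def by blast+

text \<open>There are no triple points: in the chart each branch projects injectively, so a branch
  contains at most one strand point over a given point, and there are at most two branches.\<close>

lemma tame_two_strands:
  assumes K: "tame_strands K" and k: "k \<in> K" "l \<in> K" "j \<in> K" "fst l = fst k" "fst j = fst k"
    and ne: "k \<noteq> l" "k \<noteq> j"
  shows "l = j"
proof -
  define x where "x = fst k"
  have "simple_at K x \<or> transverse_double_at K x"
    using K k(1) unfolding tame_strands_def x_def by blast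
  then show ?thesis
  proof
    assume "simple_at K x"
    then obtain W g g' h where "open W" and W: "x \<in> W" and "homeomorphism W (UNIV :: plane set) g g'" and h: "homeomorphism (over_part K W) (UNIV \<times> {0}) (g \<circ> fst) h"
      unfolding simple_at_def by (elim exE conjE) (rule that)
    have "k \<in> over_part K W" "l \<in> over_part K W" using W k(1,2,4) unfolding over_part_def x_def by simp_all
    from homeomorphism_apply1[OF h this(1)] homeomorphism_apply1[OF h this(2)]
    show ?thesis using k(4) ne(1) by simp
  next
    assume "transverse_double_at K x"
    then obtain W g g' A B h h' where "open W" and W: "x \<in> W" and "homeomorphism W (UNIV :: plane set) g g'"
      and "g x = (0, 0)" and AB: "over_part K W = A \<union> B" and "A \<inter> B = {}"
      and "openin (top_of_set (over_part K W)) A" "openin (top_of_set (over_part K W)) B"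
      and h: "homeomorphism A (UNIV \<times> {0}) (g \<circ> fst) h" and h': "homeomorphism B ({0} \<times> UNIV) (g \<circ> fst) h'"
      unfolding transverse_double_at_def by (elim exE conjE) (rule that)
    have U: "k \<in> A \<union> B" "l \<in> A \<union> B" "j \<in> A \<union> B"
      using W k unfolding AB[symmetric] over_part_def x_def by simp_all
    have A: "i = i'" if "i \<in> A" "i' \<in> A" "fst i = fst i'" for i i'
      using homeomorphism_apply1[OF h that(1)] homeomorphism_apply1[OF h that(2)] that(3) by simp
    have B: "i = i'" if "i \<in> B" "i' \<in> B" "fst i = fst i'" for i i'
      using homeomorphism_apply1[OF h' that(1)] homeomorphism_apply1[OF h' that(2)] that(3) by simp
    have e: "fst k = fst l" "fst k = fst j" "fst l = fst j" using k(4,5) by simp_all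
    have n: "\<not> (k \<in> A \<and> l \<in> A)" "\<not> (k \<in> A \<and> j \<in> A)" "\<not> (k \<in> B \<and> l \<in> B)" "\<not> (k \<in> B \<and> j \<in> B)"
      using A[OF _ _ e(1)] A[OF _ _ e(2)] B[OF _ _ e(1)] B[OF _ _ e(2)] ne by blast+
    then have "l \<in> A \<and> j \<in> A \<or> l \<in> B \<and> j \<in> B" using U unfolding Un_iff by blast
    then show ?thesis using A[OF _ _ e(3)] B[OF _ _ e(3)] by blast
  qed
qed

lemma resolve_simps [simp]: "strands (resolve \<epsilon> D) = strands D"
    "overs (resolve \<epsilon> D) = overs D \<union> {k\<in>prepoints D. snd (marking D k) = \<epsilon> (fst (marking D k))}"
  by (simp_all add: resolve_def)

lemma crossings_resolve [simp]: "crossings (resolve \<epsilon> D) = crossings D"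
  by (simp add: crossings_def)

lemma motifD:
  assumes "motif \<Lambda> D"
  shows "is_lattice \<Lambda>" "tame_strands (strands D)" "w \<in> \<Lambda> \<Longrightarrow> shift w ` strands D = strands D"
    "w \<in> \<Lambda> \<Longrightarrow> shift w ` overs D = overs D"
    "w \<in> \<Lambda> \<Longrightarrow> k \<in> prepoints D \<Longrightarrow> marking D (shift w k) = marking D k"
    "\<exists>F. finite F \<and> crossings D \<subseteq> {x + w | x w. x \<in> F \<and> w \<in> \<Lambda>}"
    "overs D \<subseteq> over_part (strands D) (crossings D)" "inj_on fst (overs D)"
    "k \<in> prepoints D \<Longrightarrow> l \<in> prepoints D \<Longrightarrow> k \<noteq> l \<Longrightarrow> fst k = fst l \<Longrightarrow>
        fst (marking D k) = fst (marking D l) \<and> snd (marking D k) \<noteq> snd (marking D l)"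
  using assms unfolding motif_def tame_strands_def by blast+

lemma motif_shift:
  assumes D: "motif \<Lambda> D" and w: "w \<in> \<Lambda>"
  shows "shift w k \<in> strands D \<longleftrightarrow> k \<in> strands D" "shift w k \<in> overs D \<longleftrightarrow> k \<in> overs D"
    "shift w k \<in> prepoints D \<longleftrightarrow> k \<in> prepoints D"
proof -
  have s: "shift w k \<in> strands D \<longleftrightarrow> k \<in> strands D" if "w \<in> \<Lambda>" for w k
    using motifD(3)[OF D that] inj_image_mem_iff[OF inj_shift] by metis
  have o: "shift w k \<in> overs D \<longleftrightarrow> k \<in> overs D" if "w \<in> \<Lambda>" for w k
    using motifD(4)[OF D that] inj_image_mem_iff[OF inj_shift] by metis
  have p: "shift w k \<in> prepoints D" if k: "k \<in> prepoints D" and w: "w \<in> \<Lambda>" for w k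
  proof -
    obtain l where l: "k \<in> strands D" "l \<in> strands D" "k \<noteq> l" "fst k = fst l" "k \<notin> overs D" "l \<notin> overs D"
      using k unfolding prepoints_def by blast
    have "shift w k \<noteq> shift w l" using l(3) inj_shift by (metis injD)
    moreover have "fst (shift w k) = fst (shift w l)" using l(4) by simp
    ultimately show ?thesis unfolding prepoints_def using s[OF w] o[OF w] l by blast
  qed
  show "shift w k \<in> strands D \<longleftrightarrow> k \<in> strands D" "shift w k \<in> overs D \<longleftrightarrow> k \<in> overs D" using s o w by auto
  have "shift (- w) (shift w k) = k" by simp
  then show "shift w k \<in> prepoints D \<longleftrightarrow> k \<in> prepoints D"
    using p[OF _ w, of k] p[OF _ lattice_uminus[OF motifD(1)[OF D] w], of "shift w k"] by metis
qed

text \<open>At a classical crossing one strand point is over already and neither is a prepoint. At a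
  precrossing the two strand points share a class and have opposite signs, so any assignment selects
  exactly one of them.\<close>

lemma classical_motif_resolve:
  assumes D: "motif \<Lambda> D"
  shows "classical_motif \<Lambda> (resolve \<epsilon> D)"
proof -
  have one: "k \<in> overs (resolve \<epsilon> D) \<longleftrightarrow> l \<notin> overs (resolve \<epsilon> D)"
    if kl: "k \<in> strands D" "l \<in> strands D" "k \<noteq> l" "fst k = fst l" for k l
  proof -
    have pre: "k \<in> prepoints D \<longleftrightarrow> k \<notin> overs D \<and> l \<notin> overs D"
      if kl: "k \<in> strands D" "l \<in> strands D" "k \<noteq> l" "fst k = fst l" for k l
    proof
      assume "k \<in> prepoints D"
      then obtain j where j: "j \<in> strands D" "k \<noteq> j" "fst k = fst j" "k \<notin> overs D" "j \<notin> overs D"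
        unfolding prepoints_def by blast
      have "l = j" using tame_two_strands[OF motifD(2)[OF D] kl(1,2) j(1)] kl j by simp
      then show "k \<notin> overs D \<and> l \<notin> overs D" using j by simp
    next
      assume "k \<notin> overs D \<and> l \<notin> overs D"
      then show "k \<in> prepoints D" unfolding prepoints_def using kl by blast
    qed
    have pk: "k \<in> prepoints D \<longleftrightarrow> k \<notin> overs D \<and> l \<notin> overs D" by (rule pre[OF kl])
    have pl: "l \<in> prepoints D \<longleftrightarrow> l \<notin> overs D \<and> k \<notin> overs D"
      by (rule pre[OF kl(2,1) kl(3)[symmetric] kl(4)[symmetric]])
    have both: "\<not> (k \<in> overs D \<and> l \<in> overs D)" using inj_onD[OF motifD(8)[OF D] kl(4)] kl(3) by blast
    show ?thesis
    proof (cases "k \<in> overs D \<or> l \<in> overs D")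
      case True
      then show ?thesis using pk pl both by auto
    next
      case False
      then have p: "k \<in> prepoints D" "l \<in> prepoints D" using pk pl by auto
      then show ?thesis using False motifD(9)[OF D p kl(3,4)] by auto
    qed
  qed
  have sh: "shift w k \<in> overs (resolve \<epsilon> D) \<longleftrightarrow> k \<in> overs (resolve \<epsilon> D)" if w: "w \<in> \<Lambda>" for w k
  proof -
    have "shift w k \<in> prepoints D \<and> snd (marking D (shift w k)) = \<epsilon> (fst (marking D (shift w k))) \<longleftrightarrow>
      k \<in> prepoints D \<and> snd (marking D k) = \<epsilon> (fst (marking D k))"
      using motif_shift(3)[OF D w, of k] motifD(5)[OF D w, of k] by auto
    then show ?thesis using motif_shift(2)[OF D w, of k] by simp
  qed
  have "\<forall>w\<in>\<Lambda>. \<forall>k\<in>strands (resolve \<epsilon> D). shift w k \<in> strands (resolve \<epsilon> D) \<and>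
      (shift w k \<in> overs (resolve \<epsilon> D) \<longleftrightarrow> k \<in> overs (resolve \<epsilon> D))"
    using sh motif_shift(1)[OF D] unfolding resolve_simps(1) by blast
  moreover have "\<forall>k\<in>strands (resolve \<epsilon> D). \<forall>l\<in>strands (resolve \<epsilon> D). k \<noteq> l \<and> fst k = fst l \<longrightarrow>
      (k \<in> overs (resolve \<epsilon> D) \<longleftrightarrow> l \<notin> overs (resolve \<epsilon> D))"
    using one unfolding resolve_simps(1) by blast
  ultimately show ?thesis
    unfolding classical_motif_def crossings_resolve resolve_simps(1)
    using motifD(1,2,6)[OF D] by blast
qed

section \<open>Commensurable lattices and averaging of heights\<close>

lemma commensurable:
  assumes L: "is_lattice \<Lambda>" and M: "is_lattice M" and F: "finite F" and X: "X \<subseteq> {x + w | x w. x \<in> F \<and> w \<in> \<Lambda>}"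
    and inv: "\<And>x w. x \<in> X \<Longrightarrow> w \<in> \<Lambda> \<Longrightarrow> x + w \<in> X" "\<And>x w. x \<in> X \<Longrightarrow> w \<in> M \<Longrightarrow> x + w \<in> X"
    and x0: "x0 \<in> X" and w: "w \<in> \<Lambda>"
  shows "\<exists>n>0. real n *\<^sub>R w \<in> M"
proof -
  \<comment> \<open>Pigeonhole: each point \<open>x0 + n w\<close> is brought back to a fixed disc
    by a vector of \<open>M\<close> and stays in \<open>X\<close>, which has finitely many points in
    the disc. Two of the results coincide, so a positive multiple of \<open>w\<close> lies in
    \<open>M\<close>.\<close>
  obtain R where R: "\<And>x. \<exists>v\<in>M. norm (x + v) \<le> R"
    by (rule lattice_cocompact[OF M]) (rule that)
  then have "\<forall>n. \<exists>v. v \<in> M \<and> norm (x0 + real n *\<^sub>R w + v) \<le> R" by blast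
  from choice[OF this] obtain v
    where v: "\<And>n :: nat. v n \<in> M" "\<And>n. norm (x0 + real n *\<^sub>R w + v n) \<le> R" by blast
  define y where "y n = x0 + real n *\<^sub>R w + v n" for n
  have "{x \<in> X. norm x \<le> R} \<subseteq> (\<Union>a\<in>F. (\<lambda>w. a + w) ` {w \<in> \<Lambda>. norm (w + a) \<le> R})"
  proof
    fix x assume x: "x \<in> {x \<in> X. norm x \<le> R}"
    then obtain a u where "a \<in> F" "u \<in> \<Lambda>" "x = a + u" using X by blast
    then show "x \<in> (\<Union>a\<in>F. (\<lambda>w. a + w) ` {w \<in> \<Lambda>. norm (w + a) \<le> R})"
      using x by (intro UN_I[of a] image_eqI[of _ _ u]) (simp_all add: add.commute)
  qed
  then have fin: "finite {x \<in> X. norm x \<le> R}"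
    by (rule finite_subset) (intro finite_UN_I F finite_imageI lattice_finite_bounded[OF L])
  have "y n \<in> {x \<in> X. norm x \<le> R}" for n
    unfolding y_def using v inv(2)[OF inv(1)[OF x0 lattice_scale_nat[OF L w]] v(1)] by simp
  then have "range y \<subseteq> {x \<in> X. norm x \<le> R}" by blast
  then have "finite (range y)" using fin by (rule finite_subset)
  then have "\<not> inj y" using finite_imageD infinite_UNIV_nat by blast
  then obtain m n where mn: "m \<noteq> n" "y m = y n" unfolding inj_def by blast
  have *: "\<exists>n>0. real n *\<^sub>R w \<in> M" if "m < n" "y m = y n" for m n
  proof (intro exI conjI)
    have "real (n - m) *\<^sub>R w = real n *\<^sub>R w - real m *\<^sub>R w" using that(1) by (simp add: of_nat_diff scaleR_diff_left)
    also have "\<dots> = v m - v n" using that(2) unfolding y_def by (simp add: algebra_simps)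
    finally have "real (n - m) *\<^sub>R w = v m - v n" .
    then show "real (n - m) *\<^sub>R w \<in> M" using lattice_diff[OF M v(1) v(1)] by simp
    show "0 < n - m" using that(1) by simp
  qed
  show ?thesis using mn *[of m n] *[of n m] by (metis linorder_neqE_nat)
qed

lemma sum_rotate:
  fixes g :: "nat \<Rightarrow> real"
  assumes "g N = g 0"
  shows "(\<Sum>i<N. g (Suc i)) = (\<Sum>i<N. g i)"
proof (cases N)
  case (Suc n)
  have "(\<Sum>i<N. g (Suc i)) + g 0 = (\<Sum>i<Suc N. g i)" by (subst sum.lessThan_Suc_shift) simp
  also have "\<dots> = (\<Sum>i<N. g i) + g N" by simp
  finally show ?thesis using assms by simp
qed simp

text \<open>This is averaging over the finite group \<Lambda> modulo \<open>N\<close> times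
  \<Lambda>. Shifting by a basis vector rotates one summation index cyclically; arbitrary integer
  combinations follow by induction.\<close>

lemma average_periodic:
  fixes f :: "space \<Rightarrow> real"
  assumes L: "\<Lambda> = lattice_of u v" and N: "N > 0"
    and Nu: "\<And>k. k \<in> K \<Longrightarrow> f (shift (real N *\<^sub>R u) k) = f k"
    and Nv: "\<And>k. k \<in> K \<Longrightarrow> f (shift (real N *\<^sub>R v) k) = f k"
    and K: "\<And>w k. w \<in> \<Lambda> \<Longrightarrow> k \<in> K \<Longrightarrow> shift w k \<in> K"
    and w: "w \<in> \<Lambda>" and k: "k \<in> K"
  shows "(\<Sum>i<N. \<Sum>j<N. f (shift (real i *\<^sub>R u + real j *\<^sub>R v + w) k)) =
    (\<Sum>i<N. \<Sum>j<N. f (shift (real i *\<^sub>R u + real j *\<^sub>R v) k))"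
proof -
  define a where "a k = (\<Sum>i<N. \<Sum>j<N. f (shift (real i *\<^sub>R u + real j *\<^sub>R v) k))" for k
  have mem: "real i *\<^sub>R u + real j *\<^sub>R v \<in> \<Lambda>" for i j
    using lattice_of_mem[of "int i" u "int j" v] unfolding L by simp
  have au: "a (shift u k) = a k" if k: "k \<in> K" for k
  proof -
    have "a (shift u k) = (\<Sum>i<N. \<Sum>j<N. f (shift (real (Suc i) *\<^sub>R u + real j *\<^sub>R v) k))"
      unfolding a_def by (simp add: algebra_simps)
    also have "\<dots> = a k" unfolding a_def
    proof (rule sum_rotate)
      have "f (shift (real N *\<^sub>R u + real j *\<^sub>R v) k) = f (shift (real 0 *\<^sub>R u + real j *\<^sub>R v) k)" for j
        using Nu[OF K[OF mem[of 0 j] k]] by (simp add: add.commute)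
      then show "(\<Sum>j<N. f (shift (real N *\<^sub>R u + real j *\<^sub>R v) k)) = (\<Sum>j<N. f (shift (real 0 *\<^sub>R u + real j *\<^sub>R v) k))"
        by (rule sum.cong[OF refl])
    qed
    finally show ?thesis .
  qed
  have av: "a (shift v k) = a k" if k: "k \<in> K" for k
  proof -
    have "a (shift v k) = (\<Sum>i<N. \<Sum>j<N. f (shift (real i *\<^sub>R u + real (Suc j) *\<^sub>R v) k))"
      unfolding a_def by (simp add: algebra_simps)
    also have "\<dots> = a k" unfolding a_def
    proof (rule sum.cong[OF refl], rule sum_rotate)
      fix i show "f (shift (real i *\<^sub>R u + real N *\<^sub>R v) k) = f (shift (real i *\<^sub>R u + real 0 *\<^sub>R v) k)"
        using Nv[OF K[OF mem[of i 0] k]] by (simp add: add.commute)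
    qed
    finally show ?thesis .
  qed
  have iter: "a (shift (of_int n *\<^sub>R t) k) = a k"
    if t: "t \<in> {u, v}" and k: "k \<in> K" for n t k
  proof (induction n rule: int_induct[where k = 0])
    case base
    then show ?case by simp
  next
    case (step1 i)
    have "of_int i *\<^sub>R t \<in> \<Lambda>" using lattice_of_mem[of i u 0 v] lattice_of_mem[of 0 u i v] t unfolding L by auto
    then have "a (shift t (shift (of_int i *\<^sub>R t) k)) = a (shift (of_int i *\<^sub>R t) k)" using au av K k t by blast
    then show ?case using step1 by (simp add: scaleR_add_left add.commute)
  next
    case (step2 i)
    have "of_int (i - 1) *\<^sub>R t \<in> \<Lambda>"
      using lattice_of_mem[of "i - 1" u 0 v] lattice_of_mem[of 0 u "i - 1" v] t unfolding L by auto
    then have "a (shift t (shift (of_int (i - 1) *\<^sub>R t) k)) = a (shift (of_int (i - 1) *\<^sub>R t) k)" using au av K k t by blast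
    moreover have "t + of_int (i - 1) *\<^sub>R t = of_int i *\<^sub>R t" by (simp add: scaleR_diff_left)
    ultimately show ?case using step2 by simp
  qed
  obtain x y :: int where xy: "w = of_int x *\<^sub>R u + of_int y *\<^sub>R v" using w unfolding L lattice_of_def by blast
  have "of_int y *\<^sub>R v \<in> \<Lambda>" using lattice_of_mem[of 0 u y v] unfolding L by simp
  then have "a (shift w k) = a k" unfolding xy
    using iter[of u "shift (of_int y *\<^sub>R v) k" x] iter[of v k y] K k by simp
  then show ?thesis unfolding a_def by simp
qed

lemma raise_shift_cases:
  assumes "DP_tangle_over \<Lambda> (raise f K)" "w \<in> \<Lambda>" "k \<in> K"
  obtains k' where "k' \<in> K" "fst k' = fst k + w" "f k' = f k"
proof -
  have "(fst k, f k) \<in> raise f K" using assms(3) unfolding raise_def by blast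
  then have "shift w (fst k, f k) \<in> raise f K" using assms(1,2) unfolding DP_tangle_over_def by blast
  then obtain k' where "k' \<in> K" "(fst k', f k') = shift w (fst k, f k)" unfolding raise_def by auto
  then show ?thesis using that[of k'] unfolding shift_def by simp
qed

text \<open>The given tangle is periodic over some lattice \<open>M\<close>, while its diagram is
  periodic over \<Lambda>. The heights are replaced by \<Lambda>-periodic ones by means of a
  vertical isotopy that is periodic over a common sublattice.\<close>

lemma periodic_heights_exist:
  assumes R: "classical_motif \<Lambda> R" and T: "spatial_lift R T"
  obtains f where "heights R f" "\<And>w k. w \<in> \<Lambda> \<Longrightarrow> k \<in> strands R \<Longrightarrow> f (shift w k) = f k"
    "DP_tangle_over \<Lambda> (raise f (strands R))" "DP_isotopic T (raise f (strands R))"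
proof -
  note found = that
  define K where "K = strands R"
  have lat: "is_lattice \<Lambda>" and tame: "tame_strands K"
    and sh: "\<And>w k. w \<in> \<Lambda> \<Longrightarrow> k \<in> K \<Longrightarrow> shift w k \<in> K"
    and sho: "\<And>w k. w \<in> \<Lambda> \<Longrightarrow> k \<in> K \<Longrightarrow> shift w k \<in> overs R \<longleftrightarrow> k \<in> overs R"
    and fin: "\<exists>F. finite F \<and> crossings R \<subseteq> {x + w | x w. x \<in> F \<and> w \<in> \<Lambda>}"
    and one: "\<And>k l. k \<in> K \<Longrightarrow> l \<in> K \<Longrightarrow> k \<noteq> l \<Longrightarrow> fst k = fst l \<Longrightarrow> k \<in> overs R \<longleftrightarrow> l \<notin> overs R"
    using R unfolding classical_motif_def K_def by blast+
  obtain f M where f: "continuous_on K f"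
    and less: "\<And>k l. k \<in> K \<Longrightarrow> l \<in> K \<Longrightarrow> k \<noteq> l \<Longrightarrow> fst k = fst l \<Longrightarrow> k \<in> overs R \<Longrightarrow> f l < f k"
    and Tf: "T = raise f K" and TM: "DP_tangle_over M T"
    using T unfolding spatial_lift_def K_def raise_def DP_tangle_def by blast
  have M: "is_lattice M" using TM unfolding DP_tangle_over_def by blast
  have "T \<subseteq> UNIV \<times> {0<..<1}" using TM unfolding DP_tangle_over_def by blast
  then have range: "0 < f k \<and> f k < 1" if "k \<in> K" for k using that unfolding Tf raise_def by auto
  have ne: "f k \<noteq> f l" if "k \<in> K" "l \<in> K" "k \<noteq> l" "fst k = fst l" for k l
    using less[of k l] less[of l k] one[of k l] that by force
  note shiftM = raise_shift_cases[OF TM[unfolded Tf]]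
  \<comment> \<open>Shared by both cases: the lattice \<open>P\<close> inside \<open>M\<close>
    preserves both height functions and is used only for the vertical isotopy; afterwards \<Lambda>
    is reinstated as lattice of the new tangle.\<close>
  have conclude: ?thesis
    if f': "heights R f'" and per: "\<And>w k. w \<in> \<Lambda> \<Longrightarrow> k \<in> K \<Longrightarrow> f' (shift w k) = f' k"
      and P: "is_lattice P" "\<And>w. w \<in> P \<Longrightarrow> w \<in> M"
      and cov: "\<And>w k. w \<in> P \<Longrightarrow> k \<in> K \<Longrightarrow> \<exists>k'\<in>K. fst k' = fst k + w \<and> f k' = f k \<and> f' k' = f' k" for f' P
  proof -
    note f'D = heightsD[OF f', folded K_def]
    interpret periodic_heights K f f' P
    proof
      fix k l assume kl: "k \<in> K" "l \<in> K" "k \<noteq> l" "fst k = fst l"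
      show "f k < f l \<and> f' k < f' l \<or> f l < f k \<and> f' l < f' k"
      proof (cases "k \<in> overs R")
        case True
        then show ?thesis using less[OF kl] f'D(3)[OF kl] by blast
      next
        case False
        then have "l \<in> overs R" using one[OF kl] by blast
        then show ?thesis using less[OF kl(2,1)] f'D(3)[OF kl(2,1)] kl(3,4) by simp
      qed
    qed (use tame f f'D range P cov in blast)+
    have "DP_tangle_over P (raise f K)"
    proof (rule DP_tangle_over_relattice[OF TM[unfolded Tf] P(1)])
      fix w p assume "w \<in> P" "p \<in> raise f K"
      then show "shift w p \<in> raise f K" using TM P(2) unfolding Tf DP_tangle_over_def by blast
    qed
    note v = vertical_isotopy[OF this]
    have "DP_tangle_over \<Lambda> (raise f' K)"
    proof (rule DP_tangle_over_relattice[OF v(2) lat])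
      fix w p assume w: "w \<in> \<Lambda>" "p \<in> raise f' K"
      then obtain k where k: "k \<in> K" "p = (fst k, f' k)" unfolding raise_def by blast
      have "shift w p = (fst (shift w k), f' (shift w k))" using per[OF w(1) k(1)] k(2) by (simp add: shift_def)
      then show "shift w p \<in> raise f' K" unfolding raise_def using sh[OF w(1) k(1)] by blast
    qed
    from found[OF f' per[unfolded K_def] this[unfolded K_def] v(1)[folded Tf, unfolded K_def]]
    show ?thesis by simp
  qed
  show ?thesis
  proof (cases "crossings R = {}")
    case True
    then have inj: "k = l" if "k \<in> K" "l \<in> K" "fst k = fst l" for k l
      using that unfolding crossings_def K_def by blast
    show ?thesis
    \<comment> \<open>Without crossings the two lattices may be unrelated, but any heights are
      admissible; constant ones are periodic over every lattice that preserves the diagram.\<close>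
    proof (rule conclude[of "\<lambda>_. 1/2" M])
      show "heights R (\<lambda>_. 1/2)" unfolding heights_def using inj unfolding K_def by auto
      show "\<exists>k'\<in>K. fst k' = fst k + w \<and> f k' = f k \<and> (1/2::real) = 1/2" if "w \<in> M" "k \<in> K" for w k
        using shiftM[OF that] by metis
    qed (use M in auto)
  next
    case False
    then obtain x0 where x0: "x0 \<in> crossings R" by blast
    obtain u v where uv: "u \<noteq> v" "independent {u, v}" and L: "\<Lambda> = lattice_of u v"
      using lat by (rule lattice_basis)
    have invL: "x + w \<in> crossings R" if x: "x \<in> crossings R" and w: "w \<in> \<Lambda>" for x w
    proof -
      obtain k l where kl: "k \<in> K" "l \<in> K" "k \<noteq> l" "fst k = x" "fst l = x"
        using x unfolding crossings_def K_def by blast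
      have "shift w k \<noteq> shift w l" using kl(3) inj_shift by (metis injD)
      moreover have "fst (shift w k) = x + w" "fst (shift w l) = x + w" using kl by auto
      ultimately show ?thesis unfolding crossings_def K_def[symmetric]
        using sh[OF w kl(1)] sh[OF w kl(2)] by blast
    qed
    have invM: "x + w \<in> crossings R" if x: "x \<in> crossings R" and w: "w \<in> M" for x w
    proof -
      obtain k l where kl: "k \<in> K" "l \<in> K" "k \<noteq> l" "fst k = x" "fst l = x"
        using x unfolding crossings_def K_def by blast
      obtain k' where k': "k' \<in> K" "fst k' = fst k + w" "f k' = f k" using shiftM[OF w kl(1)] .
      obtain l' where l': "l' \<in> K" "fst l' = fst l + w" "f l' = f l" using shiftM[OF w kl(2)] .
      have "k' \<noteq> l'" using ne[OF kl(1,2,3)] k' l' kl by auto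
      then show ?thesis unfolding crossings_def K_def[symmetric] using k' l' kl by auto
    qed
    have com: "\<exists>n>0. real n *\<^sub>R w \<in> M" if "w \<in> \<Lambda>" for w
      using fin commensurable[OF lat M _ _ invL invM x0 that] by blast
    have "u \<in> \<Lambda>" "v \<in> \<Lambda>" using lattice_of_mem[of 1 u 0 v] lattice_of_mem[of 0 u 1 v] unfolding L by auto
    then obtain n1 n2 where n: "n1 > 0" "n2 > 0" "real n1 *\<^sub>R u \<in> M" "real n2 *\<^sub>R v \<in> M" using com by metis
    define N where "N = n1 * n2"
    have N: "N > 0" "real N *\<^sub>R u \<in> M" "real N *\<^sub>R v \<in> M"
      using n lattice_scale_nat[OF M n(3), of n2] lattice_scale_nat[OF M n(4), of n1] unfolding N_def
      by (auto simp: mult.commute)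
    \<comment> \<open>\<open>N\<close> is a common multiple for both basis vectors, so the lattice
      scaled by \<open>N\<close> lies in \<Lambda> and in \<open>M\<close>.\<close>
    define P where "P = (\<lambda>w. real N *\<^sub>R w) ` \<Lambda>"
    have P: "is_lattice P" unfolding P_def
      by (rule lattice_linear_image[OF lat]) (use N in \<open>auto simp: linear_iff inj_on_def algebra_simps\<close>)
    have PL: "w \<in> \<Lambda>" if "w \<in> P" for w using that lattice_scale_nat[OF lat] unfolding P_def by auto
    have PM: "w \<in> M" if w: "w \<in> P" for w
    proof -
      obtain a where a: "a \<in> \<Lambda>" "w = real N *\<^sub>R a" using w unfolding P_def by blast
      obtain x y :: int where xy: "a = of_int x *\<^sub>R u + of_int y *\<^sub>R v" using a(1) unfolding L lattice_of_def by blast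
      have "w = of_int x *\<^sub>R (real N *\<^sub>R u) + of_int y *\<^sub>R (real N *\<^sub>R v)" unfolding a(2) xy by (simp add: algebra_simps)
      then show ?thesis using lattice_add[OF M lattice_scale_int[OF M N(2)] lattice_scale_int[OF M N(3)]] by simp
    qed
    \<comment> \<open>Invariance of the tangle under \<open>M\<close> only provides some strand
      point over the shifted position with the same height. If it were on the other strand, the
      shift would exchange the heights of the two strands at a crossing, against the
      \<Lambda>-invariance of \<open>overs\<close>.\<close>
    have fP: "f (shift w k) = f k" if w: "w \<in> P" and k: "k \<in> K" for w k
    proof -
      note w' = PL[OF w] PM[OF w]
      have nw: "- w \<in> \<Lambda>" using lattice_uminus[OF lat w'(1)] .
      obtain k' where k': "k' \<in> K" "fst k' = fst k + w" "f k' = f k" using shiftM[OF w'(2) k] .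
      define l where "l = shift (- w) k'"
      have l: "l \<in> K" "fst l = fst k" "shift w l = k'" using sh[OF nw k'(1)] k'(2) unfolding l_def by auto
      show ?thesis
      proof (cases "k = l")
        case True
        then show ?thesis using l k' by simp
      next
        case False
        obtain l' where l': "l' \<in> K" "fst l' = fst l + w" "f l' = f l" using shiftM[OF w'(2) l(1)] .
        have skl: "shift w k \<noteq> shift w l" using False inj_shift by (metis injD)
        have "l' \<noteq> shift w l" using ne[OF k l(1) False] l l' k' by auto
        then have "l' = shift w k"
          using tame_two_strands[OF tame sh[OF w'(1) l(1)] l'(1) sh[OF w'(1) k]] skl l l' by auto
        then have e: "f (shift w k) = f l" "f (shift w l) = f k" using l' l k' by auto
        show ?thesis
        proof (cases "k \<in> overs R")
          case True
          then have "f l < f k" using less[OF k l(1) False] l(2) by simp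
          moreover have "f (shift w l) < f (shift w k)"
            using less[OF sh[OF w'(1) k] sh[OF w'(1) l(1)] skl] sho[OF w'(1) k] True l(2) by simp
          ultimately show ?thesis using e by simp
        next
          case ko: False
          then have lo: "l \<in> overs R" using one[OF k l(1) False] l(2) by simp
          then have "f k < f l" using less[OF l(1) k] False l(2) by simp
          moreover have "f (shift w k) < f (shift w l)"
            using less[OF sh[OF w'(1) l(1)] sh[OF w'(1) k]] skl sho[OF w'(1) l(1)] lo l(2) by simp
          ultimately show ?thesis using e by simp
        qed
      qed
    qed
    have uvP: "real N *\<^sub>R u \<in> P" "real N *\<^sub>R v \<in> P" unfolding P_def using \<open>u \<in> \<Lambda>\<close> \<open>v \<in> \<Lambda>\<close> by auto
    have mem: "real i *\<^sub>R u + real j *\<^sub>R v \<in> \<Lambda>" for i j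
      using lattice_of_mem[of "int i" u "int j" v] unfolding L by simp
    \<comment> \<open>The mean of \<open>f\<close> over \<Lambda> modulo \<open>P\<close>. The
      over/under relation is the same at every translate, so it survives averaging.\<close>
    define f' where "f' k = (\<Sum>i<N. \<Sum>j<N. f (shift (real i *\<^sub>R u + real j *\<^sub>R v) k)) / (real N * real N)" for k
    have per: "f' (shift w k) = f' k" if "w \<in> \<Lambda>" "k \<in> K" for w k
      using average_periodic[OF L N(1) fP[OF uvP(1)] fP[OF uvP(2)] sh that] unfolding f'_def by simp
    have NN: "real N * real N > 0" using N(1) by simp
    have mono: "f' k < f' l" if "\<And>w. w \<in> \<Lambda> \<Longrightarrow> f (shift w k) < f (shift w l)" for k l
      unfolding f'_def using N(1) that[OF mem]
      by (intro divide_strict_right_mono[OF _ NN] sum_strict_mono) auto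
    have "heights R f'" unfolding heights_def K_def[symmetric]
    proof (intro conjI ballI impI)
      show "continuous_on K f'" unfolding f'_def
        by (intro continuous_intros continuous_on_compose2[OF f]) (use N(1) sh[OF mem] in auto)
      fix k assume k: "k \<in> K"
      have "0 < (\<Sum>i<N. \<Sum>j<N. f (shift (real i *\<^sub>R u + real j *\<^sub>R v) k))"
        using N(1) range[OF sh[OF mem k]] by (intro sum_pos) auto
      then show "0 < f' k" unfolding f'_def using NN by simp
      have "(\<Sum>i<N. \<Sum>j<N. f (shift (real i *\<^sub>R u + real j *\<^sub>R v) k)) < (\<Sum>i<N. \<Sum>j<N. 1)"
        using N(1) range[OF sh[OF mem k]] by (intro sum_strict_mono) auto
      then show "f' k < 1" unfolding f'_def using NN by simp
      fix l assume l: "l \<in> K" and kl: "k \<noteq> l \<and> fst k = fst l \<and> k \<in> overs R"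
      show "f' l < f' k"
      proof (rule mono)
        fix w assume w: "w \<in> \<Lambda>"
        have "shift w k \<noteq> shift w l" using kl inj_shift by (metis injD)
        then show "f (shift w l) < f (shift w k)"
          using less[OF sh[OF w k] sh[OF w l]] kl sho[OF w k] by simp
      qed
    qed
    then show ?thesis
    proof (rule conclude[OF _ per P PM])
      show "\<exists>k'\<in>K. fst k' = fst k + w \<and> f k' = f k \<and> f' k' = f' k" if "w \<in> P" "k \<in> K" for w k
        using sh[OF PL that(2)] fP per PL that by (intro bexI[of _ "shift w k"]) auto
    qed
  qed
qed

section \<open>Carrying heights along\<close>

lemma spatial_lift_iff:
  "spatial_lift R T \<longleftrightarrow> DP_tangle T \<and> (\<exists>f. heights R f \<and> T = raise f (strands R))"
proof -
  have "0 < f k \<and> f k < 1" if T: "DP_tangle (raise f (strands R))" and k: "k \<in> strands R" for f k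
  proof -
    have "raise f (strands R) \<subseteq> UNIV \<times> {0<..<1}" using T unfolding DP_tangle_def DP_tangle_over_def by blast
    then show ?thesis using k unfolding raise_def by auto
  qed
  then show ?thesis unfolding spatial_lift_def heights_def raise_def[symmetric] by blast
qed

text \<open>Differs from \<open>carries\<close> in naming the homeomorphism and its inverse and in
  ignoring markings, so that one pair can serve the resolutions for all assignments.\<close>

definition carry :: "(plane \<Rightarrow> plane) \<Rightarrow> (space \<Rightarrow> space) \<Rightarrow> (space \<Rightarrow> space) \<Rightarrow> pseudo_diagram \<Rightarrow> pseudo_diagram \<Rightarrow> bool" where
  "carry g \<theta> \<theta>' R R' \<longleftrightarrow> homeomorphism (strands R) (strands R') \<theta> \<theta>' \<and>
     (\<forall>k\<in>strands R. fst (\<theta> k) = g (fst k) \<and> (\<theta> k \<in> overs R' \<longleftrightarrow> k \<in> overs R))"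

lemma carryD:
  assumes "carry g \<theta> \<theta>' R R'"
  shows "continuous_on (strands R) \<theta>" "continuous_on (strands R') \<theta>'"
    "k \<in> strands R \<Longrightarrow> \<theta> k \<in> strands R'" "k' \<in> strands R' \<Longrightarrow> \<theta>' k' \<in> strands R"
    "k \<in> strands R \<Longrightarrow> \<theta>' (\<theta> k) = k" "k' \<in> strands R' \<Longrightarrow> \<theta> (\<theta>' k') = k'"
    "k \<in> strands R \<Longrightarrow> fst (\<theta> k) = g (fst k)" "k \<in> strands R \<Longrightarrow> \<theta> k \<in> overs R' \<longleftrightarrow> k \<in> overs R"
  using assms unfolding carry_def homeomorphism_def by blast+

text \<open>As \<open>g\<close> is injective on the drawn curve, double points correspond to double
  points and hence prepoints to prepoints; since markings are carried along, every assignment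
  selects corresponding over points.\<close>

lemma carries_carry_resolve:
  assumes c: "carries g D D'" and inj: "inj_on g (fst ` strands D)"
  obtains \<theta> \<theta>' where "\<And>\<epsilon>. carry g \<theta> \<theta>' (resolve \<epsilon> D) (resolve \<epsilon> D')"
proof -
  obtain \<theta> \<theta>' where hom: "homeomorphism (strands D) (strands D') \<theta> \<theta>'"
    and f: "\<And>k. k \<in> strands D \<Longrightarrow> fst (\<theta> k) = g (fst k)"
    and o: "\<And>k. k \<in> strands D \<Longrightarrow> \<theta> k \<in> overs D' \<longleftrightarrow> k \<in> overs D"
    and m: "\<And>k. k \<in> prepoints D \<Longrightarrow> marking D' (\<theta> k) = marking D k"
    using c unfolding carries_def by blast
  have im: "\<theta> ` strands D = strands D'" and inv: "\<And>k. k \<in> strands D \<Longrightarrow> \<theta>' (\<theta> k) = k"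
    using hom unfolding homeomorphism_def by blast+
  have f': "fst k = fst l \<longleftrightarrow> fst (\<theta> k) = fst (\<theta> l)" if "k \<in> strands D" "l \<in> strands D" for k l
    using inj f that by (auto dest: inj_onD)
  have p: "\<theta> k \<in> prepoints D' \<longleftrightarrow> k \<in> prepoints D" if k: "k \<in> strands D" for k
  proof
    assume "\<theta> k \<in> prepoints D'"
    then obtain l' where l': "l' \<in> strands D'" "\<theta> k \<noteq> l'" "fst (\<theta> k) = fst l'" "\<theta> k \<notin> overs D'" "l' \<notin> overs D'"
      unfolding prepoints_def by blast
    then obtain l where "l \<in> strands D" "l' = \<theta> l" using im by blast
    then have "k \<noteq> l \<and> fst k = fst l \<and> k \<notin> overs D \<and> l \<notin> overs D" using l' o f' k by auto
    then show "k \<in> prepoints D" unfolding prepoints_def using k \<open>l \<in> strands D\<close> by blast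
  next
    assume "k \<in> prepoints D"
    then obtain l where l: "l \<in> strands D" "k \<noteq> l" "fst k = fst l" "k \<notin> overs D" "l \<notin> overs D"
      unfolding prepoints_def by blast
    have "\<theta> k \<noteq> \<theta> l" using inv k l by metis
    moreover have "fst (\<theta> k) = fst (\<theta> l)" using f' k l by blast
    moreover have "\<theta> k \<in> strands D'" "\<theta> l \<in> strands D'" using im k l by auto
    ultimately show "\<theta> k \<in> prepoints D'" unfolding prepoints_def using o k l by blast
  qed
  have "carry g \<theta> \<theta>' (resolve \<epsilon> D) (resolve \<epsilon> D')" for \<epsilon>
    unfolding carry_def resolve_simps using hom f o p m by auto
  then show ?thesis using that by blast
qed

lemma heights_carry:
  assumes c: "carry g \<theta> \<theta>' R R'" and inj: "inj_on g (fst ` strands R)" and h: "heights R f"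
  shows "heights R' (\<lambda>k. f (\<theta>' k))"
    and "raise (\<lambda>k. f (\<theta>' k)) (strands R') = (\<lambda>p. (g (fst p), snd p)) ` raise f (strands R)"
proof -
  note C = carryD[OF c]
  show "heights R' (\<lambda>k. f (\<theta>' k))" unfolding heights_def
  proof (intro conjI ballI impI)
    show "continuous_on (strands R') (\<lambda>k. f (\<theta>' k))"
      by (rule continuous_on_compose2[OF heightsD(1)[OF h] C(2)]) (use C(4) in blast)
    fix k assume k: "k \<in> strands R'"
    show "0 < f (\<theta>' k)" "f (\<theta>' k) < 1" using heightsD(2)[OF h C(4)[OF k]] by auto
    fix l assume l: "l \<in> strands R'" and kl: "k \<noteq> l \<and> fst k = fst l \<and> k \<in> overs R'"
    have "\<theta>' k \<noteq> \<theta>' l" using kl C(6) k l by metis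
    moreover have "g (fst (\<theta>' k)) = g (fst (\<theta>' l))" using kl C(4,6,7) k l by metis
    then have "fst (\<theta>' k) = fst (\<theta>' l)" using inj C(4) k l by (meson imageI inj_onD)
    moreover have "\<theta>' k \<in> overs R" using kl C(4,6,8) k by metis
    ultimately show "f (\<theta>' l) < f (\<theta>' k)" using heightsD(3)[OF h] C(4) k l by blast
  qed
  show "raise (\<lambda>k. f (\<theta>' k)) (strands R') = (\<lambda>p. (g (fst p), snd p)) ` raise f (strands R)"
    unfolding raise_def image_image
  proof (intro equalityI subsetI)
    fix p assume "p \<in> (\<lambda>k. (fst k, f (\<theta>' k))) ` strands R'"
    then obtain k where k: "k \<in> strands R'" "p = (fst k, f (\<theta>' k))" by blast
    have "fst k = g (fst (\<theta>' k))" using C(4,6,7) k(1) by metis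
    then show "p \<in> (\<lambda>k. (g (fst (fst k, f k)), snd (fst k, f k))) ` strands R"
      using k C(4)[OF k(1)] by (intro image_eqI[of _ _ "\<theta>' k"]) auto
  next
    fix p assume "p \<in> (\<lambda>k. (g (fst (fst k, f k)), snd (fst k, f k))) ` strands R"
    then obtain k where k: "k \<in> strands R" "p = (g (fst k), f k)" by auto
    then show "p \<in> (\<lambda>k. (fst k, f (\<theta>' k))) ` strands R'"
      using C(3,5,7)[OF k(1)] by (intro image_eqI[of _ _ "\<theta> k"]) auto
  qed
qed

lemma carry_inverse:
  assumes c: "carry g \<theta> \<theta>' R R'" and inv: "\<And>x. g' (g x) = x"
  shows "carry g' \<theta>' \<theta> R' R"
proof -
  note C = carryD[OF c]
  have "fst (\<theta>' k) = g' (fst k) \<and> (\<theta>' k \<in> overs R \<longleftrightarrow> k \<in> overs R')" if k: "k \<in> strands R'" for k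
    using C(7)[OF C(4)[OF k]] C(8)[OF C(4)[OF k]] C(6)[OF k] inv[of "fst (\<theta>' k)"] by simp
  then show ?thesis using c unfolding carry_def by (simp add: homeomorphism_symD)
qed

section \<open>Surface isotopies and affine maps\<close>

text \<open>The assignment is kept the same on both sides, which is what makes the events for the
  two diagrams equal and not merely equally likely.\<close>

definition transfers :: "pseudo_diagram \<Rightarrow> pseudo_diagram \<Rightarrow> bool" where
  "transfers D D' \<longleftrightarrow> (\<forall>\<epsilon> T. resolution D \<epsilon> T \<longrightarrow> (\<exists>T'. resolution D' \<epsilon> T' \<and> DP_isotopic T T'))"

lemma planar_homeomorphism:
  assumes "homeomorphism UNIV UNIV g g'"
  shows "homeomorphism thickened_plane thickened_plane (\<lambda>p. (g (fst p), snd p)) (\<lambda>p. (g' (fst p), snd p))"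
proof -
  have g: "continuous_on UNIV g" "continuous_on UNIV g'" "\<And>x. g' (g x) = x" "\<And>x. g (g' x) = x"
    using assms unfolding homeomorphism_def by auto
  have "continuous_on thickened_plane (\<lambda>p. g (fst p))" "continuous_on thickened_plane (\<lambda>p. g' (fst p))"
    using continuous_on_compose2[OF g(1), of thickened_plane fst] continuous_on_compose2[OF g(2), of thickened_plane fst]
    by (simp_all add: continuous_on_fst continuous_on_id)
  then show ?thesis by (intro homeomorphismI continuous_intros) (auto simp: g)
qed

lemma DP_tangleI: "DP_tangle_over \<Lambda> T \<Longrightarrow> DP_tangle T"
  unfolding DP_tangle_def by blast

lemma raise_subset: "heights R f \<Longrightarrow> raise f (strands R) \<subseteq> UNIV \<times> {0<..<1}"
  using heightsD(2) unfolding raise_def by fastforce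

text \<open>The planar isotopy is multiplied by the identity in the vertical direction. For the
  converse the isotopy is not reversed: the tangle is pulled back by the inverse of its final map,
  and the same isotopy starts from there.\<close>

lemma transfers_surface_isotopy:
  assumes D: "motif \<Lambda> D" and D': "motif \<Lambda> D'" and H: "torus_isotopy \<Lambda> H" and c: "carries (H 1) D D'"
  shows "transfers D D'" and "transfers D' D"
proof -
  have Hc: "continuous_on ({0..1} \<times> UNIV) (\<lambda>(t, x). H t x)"
    and Hh: "\<And>t. t \<in> {0..1} \<Longrightarrow> \<exists>G. homeomorphism UNIV UNIV (H t) G"
    and H0: "\<And>x. H 0 x = x" and Hw: "\<And>t w x. t \<in> {0..1} \<Longrightarrow> w \<in> \<Lambda> \<Longrightarrow> H t (x + w) = H t x + w"
    using H unfolding torus_isotopy_def by blast+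
  define h where "h t p = (H t (fst p), snd p)" for t and p :: space
  have iso: "DP_preserving_isotopy \<Lambda> h"
    unfolding DP_preserving_isotopy_def
  proof (intro conjI ballI)
    have "continuous_on ({0..1} \<times> thickened_plane) (\<lambda>s. (\<lambda>(t, x). H t x) (fst s, fst (snd s)))"
      by (rule continuous_on_compose2[OF Hc]) (auto intro!: continuous_intros)
    then show "continuous_on ({0..1} \<times> thickened_plane) (\<lambda>(t, p). h t p)"
      unfolding h_def case_prod_beta by (auto intro!: continuous_intros)
    show "\<exists>G. homeomorphism thickened_plane thickened_plane (h t) G" if "t \<in> {0..1}" for t
      using Hh[OF that] planar_homeomorphism unfolding h_def by blast
    show "h 0 p = p" for p unfolding h_def by (simp add: H0)
    show "\<exists>A. linear A \<and> inj A \<and> (\<forall>w\<in>\<Lambda>. \<forall>p\<in>thickened_plane. h t (shift w p) = shift (A w) (h t p))"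
      if "t \<in> {0..1}" for t
      by (rule exI[of _ "\<lambda>w. w"]) (simp add: linear_ident h_def shift_def Hw[OF that])
  qed
  have one: "(1::real) \<in> {0..1}" by simp
  obtain G where G: "homeomorphism UNIV UNIV (H 1) G" using Hh[OF one] by blast
  have GH: "G (H 1 x) = x" "H 1 (G x) = x" for x using G unfolding homeomorphism_def by auto
  have inj: "inj (H 1)" "inj G" using GH by (metis injI)+
  obtain \<theta> \<theta>' where cy: "\<And>\<epsilon>. carry (H 1) \<theta> \<theta>' (resolve \<epsilon> D) (resolve \<epsilon> D')"
    using carries_carry_resolve[OF c inj_on_subset[OF inj(1) subset_UNIV]] by blast
  have cy': "\<And>\<epsilon>. carry G \<theta>' \<theta> (resolve \<epsilon> D') (resolve \<epsilon> D)" by (rule carry_inverse[OF cy GH(1)])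
  show "transfers D D'" unfolding transfers_def resolution_def
  proof (intro allI impI)
    fix \<epsilon> T assume "spatial_lift (resolve \<epsilon> D) T"
    then obtain f where f: "heights (resolve \<epsilon> D) f" and T: "DP_tangle_over \<Lambda> (raise f (strands (resolve \<epsilon> D)))"
      "DP_isotopic T (raise f (strands (resolve \<epsilon> D)))"
      using periodic_heights_exist[OF classical_motif_resolve[OF D]] by metis
    note h = heights_carry[OF cy inj_on_subset[OF inj(1) subset_UNIV] f]
    have h1: "h 1 ` raise f (strands (resolve \<epsilon> D)) = raise (\<lambda>k. f (\<theta>' k)) (strands (resolve \<epsilon> D'))"
      unfolding h(2) h_def ..
    note i = DP_isotopic_isotopy[OF T(1) iso, unfolded h1, OF raise_subset[OF h(1)]]
    have "spatial_lift (resolve \<epsilon> D') (raise (\<lambda>k. f (\<theta>' k)) (strands (resolve \<epsilon> D')))"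
      unfolding spatial_lift_iff using h(1) i(2) DP_tangleI by blast
    then show "\<exists>T'. spatial_lift (resolve \<epsilon> D') T' \<and> DP_isotopic T T'"
      using DP_isotopic_trans[OF T(2) i(1)] by blast
  qed
  show "transfers D' D" unfolding transfers_def resolution_def
  proof (intro allI impI)
    fix \<epsilon> T assume "spatial_lift (resolve \<epsilon> D') T"
    then obtain f where f: "heights (resolve \<epsilon> D') f" and T: "DP_tangle_over \<Lambda> (raise f (strands (resolve \<epsilon> D')))"
      "DP_isotopic T (raise f (strands (resolve \<epsilon> D')))"
      using periodic_heights_exist[OF classical_motif_resolve[OF D']] by metis
    define S where "S = raise (\<lambda>k. f (\<theta> k)) (strands (resolve \<epsilon> D))"
    note h = heights_carry[OF cy' inj_on_subset[OF inj(2) subset_UNIV] f, folded S_def]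
    have Gw: "G (x + w) = G x + w" if "w \<in> \<Lambda>" for x w
      using GH Hw[OF one that, of "G x"] by metis
    have "DP_homeo \<Lambda> (\<lambda>w. w) (\<lambda>p. (G (fst p), snd p)) (h 1)"
      unfolding DP_homeo_def h_def
      using planar_homeomorphism[OF homeomorphism_symD[OF G]] by (simp add: linear_ident shift_def Gw)
    from DP_tangle_over_image[OF T(1) this] have S: "DP_tangle_over \<Lambda> S"
      using raise_subset[OF h(1)] h(2) unfolding S_def by simp
    have h1: "h 1 ` S = raise f (strands (resolve \<epsilon> D'))"
      unfolding h(2) h_def image_image by (simp add: GH)
    have "DP_isotopic S (raise f (strands (resolve \<epsilon> D')))"
      using DP_isotopic_isotopy(1)[OF S iso] raise_subset[OF f] unfolding h1 by blast
    moreover have "spatial_lift (resolve \<epsilon> D) S"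
      unfolding spatial_lift_iff S_def using h(1) DP_tangleI[OF S] unfolding S_def by blast
    ultimately show "\<exists>T'. spatial_lift (resolve \<epsilon> D) T' \<and> DP_isotopic T T'"
      using DP_isotopic_trans[OF T(2) DP_isotopic_sym] by blast
  qed
qed

text \<open>An affine move of tangles is not tied to a particular lattice, so the given heights are
  carried over directly, without making them periodic over the motif lattice.\<close>

lemma transfers_affine:
  assumes L: "orientation_preserving_affine L w" and c: "carries (\<lambda>x. L x + w) D D'"
  shows "transfers D D'" and "transfers D' D"
proof -
  obtain a b c d where det: "a * d - b * c > 0" and L': "L = (\<lambda>p. (a * fst p + b * snd p, c * fst p + d * snd p))"
    using L unfolding orientation_preserving_affine_def by blast
  define e where "e = a * d - b * c"
  \<comment> \<open>The inverse of the matrix, as adjugate divided by the determinant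
    \<open>e\<close>.\<close>
  define M where "M p = ((d * fst p - b * snd p) / e, (a * snd p - c * fst p) / e)" for p :: plane
  have e: "e \<noteq> 0" using det unfolding e_def by simp
  have "d * (a * x + b * y) - b * (c * x + d * y) = e * x" "a * (c * x + d * y) - c * (a * x + b * y) = e * y"
    "a * (d * x - b * y) + b * (a * y - c * x) = e * x" "c * (d * x - b * y) + d * (a * y - c * x) = e * y" for x y
    unfolding e_def by (simp_all add: algebra_simps)
  note id = this
  have inv1: "M (L p) = p" for p
    unfolding M_def L' fst_conv snd_conv id using e by simp
  have inv2: "L (M p) = p" for p
    unfolding M_def L' fst_conv snd_conv times_divide_eq_right add_divide_distrib[symmetric] id using e by simp
  have lin: "linear L" "linear M"
    unfolding L' M_def by (auto simp: linear_iff algebra_simps add_divide_distrib diff_divide_distrib)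
  have inj: "inj L" "inj M" using inv1 inv2 by (metis injI)+
  define g where "g x = L x + w" for x
  define g' where "g' x = M (x - w)" for x
  have gg: "g' (g x) = x" "g (g' x) = x" for x unfolding g_def g'_def by (simp_all add: inv1 inv2)
  have cont: "continuous_on UNIV g" "continuous_on UNIV g'"
    unfolding g_def g'_def L' M_def by (intro continuous_intros; simp add: e)+
  have hom: "homeomorphism UNIV UNIV g g'" using cont gg by (intro homeomorphismI) auto
  have ginj: "inj g" "inj g'" using gg by (metis injI)+
  obtain \<theta> \<theta>' where cy: "\<And>\<epsilon>. carry g \<theta> \<theta>' (resolve \<epsilon> D) (resolve \<epsilon> D')"
    using carries_carry_resolve[OF c[folded g_def] inj_on_subset[OF ginj(1) subset_UNIV]] by blast
  have cy': "\<And>\<epsilon>. carry g' \<theta>' \<theta> (resolve \<epsilon> D') (resolve \<epsilon> D)" by (rule carry_inverse[OF cy gg(1)])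
  have DPg: "DP_homeo \<Lambda> L (\<lambda>p. (g (fst p), snd p)) (\<lambda>p. (g' (fst p), snd p))" for \<Lambda>
    unfolding DP_homeo_def using planar_homeomorphism[OF hom] lin inj
    by (simp add: shift_def g_def linear_add[OF lin(1)] algebra_simps)
  have DPg': "DP_homeo \<Lambda> M (\<lambda>p. (g' (fst p), snd p)) (\<lambda>p. (g (fst p), snd p))" for \<Lambda>
    unfolding DP_homeo_def using planar_homeomorphism[OF homeomorphism_symD[OF hom]] lin inj
    by (simp add: shift_def g'_def linear_add[OF lin(2), symmetric] algebra_simps)
  have move: "DP_isotopic S ((\<lambda>p. (g (fst p), snd p)) ` S)"
    if "DP_tangle S" "DP_tangle ((\<lambda>p. (g (fst p), snd p)) ` S)" for S
  proof -
    have "DP_move S ((\<lambda>p. (g (fst p), snd p)) ` S)"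
      unfolding DP_move_def g_def using L that[unfolded g_def] by blast
    then show ?thesis unfolding DP_isotopic_def by (rule r_into_equivclp)
  qed
  show "transfers D D'" unfolding transfers_def resolution_def
  proof (intro allI impI)
    fix \<epsilon> T assume "spatial_lift (resolve \<epsilon> D) T"
    then obtain f where T: "DP_tangle T" and f: "heights (resolve \<epsilon> D) f" and Tf: "T = raise f (strands (resolve \<epsilon> D))"
      unfolding spatial_lift_iff by blast
    note h = heights_carry[OF cy inj_on_subset[OF ginj(1) subset_UNIV] f]
    have "DP_tangle ((\<lambda>p. (g (fst p), snd p)) ` T)"
      using T DP_tangle_over_image[OF _ DPg] raise_subset[OF h(1)] unfolding DP_tangle_def h(2) Tf by blast
    then show "\<exists>T'. spatial_lift (resolve \<epsilon> D') T' \<and> DP_isotopic T T'"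
      using move[OF T] h unfolding spatial_lift_iff Tf by metis
  qed
  show "transfers D' D" unfolding transfers_def resolution_def
  proof (intro allI impI)
    fix \<epsilon> T assume "spatial_lift (resolve \<epsilon> D') T"
    then obtain f where T: "DP_tangle T" and f: "heights (resolve \<epsilon> D') f" and Tf: "T = raise f (strands (resolve \<epsilon> D'))"
      unfolding spatial_lift_iff by blast
    note h = heights_carry[OF cy' inj_on_subset[OF ginj(2) subset_UNIV] f]
    define S where "S = (\<lambda>p. (g' (fst p), snd p)) ` T"
    have S: "DP_tangle S"
      using T DP_tangle_over_image[OF _ DPg'] raise_subset[OF h(1)] unfolding DP_tangle_def h(2) Tf S_def by blast
    have "(\<lambda>p. (g (fst p), snd p)) ` S = T" unfolding S_def image_image by (simp add: gg)
    then have "DP_isotopic S T" using move[OF S] T by simp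
    moreover have "spatial_lift (resolve \<epsilon> D) S"
      unfolding spatial_lift_iff using S h unfolding S_def Tf by metis
    ultimately show "\<exists>T'. spatial_lift (resolve \<epsilon> D) T' \<and> DP_isotopic T T'"
      using DP_isotopic_sym by blast
  qed
qed

section \<open>Replacing a model in a box\<close>

definition linear_move :: "space set \<Rightarrow> space set \<Rightarrow> bool" where
  "linear_move P Q \<longleftrightarrow> (\<exists>(S :: space set) p q. linear_motion S p q \<and> P = p ` S \<and> Q = q ` S)"

lemma linear_moves_sym: "linear_move\<^sup>*\<^sup>* P Q \<Longrightarrow> linear_move\<^sup>*\<^sup>* Q P"
proof (rule sympD[OF symp_rtranclp])
  show "symp linear_move"
  proof (rule sympI)
    fix P Q assume "linear_move P Q"
    then obtain S :: "space set" and p q where pq: "linear_motion S p q" "P = p ` S" "Q = q ` S"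
      unfolding linear_move_def by (elim exE conjE) (rule that)
    show "linear_move Q P" unfolding linear_move_def
    proof (intro exI conjI)
      show "linear_motion S q p" by (rule linear_motion_sym[OF pq(1)])
    qed (rule pq(3,2))+
  qed
qed

lemma linear_moves_cell_moves: "linear_move\<^sup>*\<^sup>* P Q \<Longrightarrow> cell_move\<^sup>*\<^sup>* P Q"
proof (induction rule: rtranclp_induct)
  case (step Q Q')
  obtain S :: "space set" and p q where pq: "linear_motion S p q" "Q = p ` S" "Q' = q ` S"
    using step(2) unfolding linear_move_def by (elim exE conjE) (rule that)
  have "cell_move\<^sup>*\<^sup>* Q Q'" using linear_motion_cell_moves[OF pq(1)] unfolding pq(2,3) .
  with step.IH show ?case by (rule rtranclp_trans)
qed simp

text \<open>Over each point of the edge there is at most one strand point. Hence the heights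
  prescribed on the edge can be given as a function of the point in the plane.\<close>

definition box_model :: "pseudo_diagram \<Rightarrow> bool" where
  "box_model N \<longleftrightarrow> fst ` strands N \<subseteq> box \<and> inj_on fst {k \<in> strands N. fst k \<notin> open_box}"

definition model_heights :: "(plane \<Rightarrow> real) \<Rightarrow> pseudo_diagram \<Rightarrow> (space \<Rightarrow> real) \<Rightarrow> bool" where
  "model_heights e N g \<longleftrightarrow> heights N g \<and> (\<forall>k\<in>strands N. fst k \<notin> open_box \<longrightarrow> g k = e (fst k))"

text \<open>The edge heights \<open>e\<close> are arbitrary because they come from the diagram
  outside the box; the interior heights \<open>g\<close> and \<open>g'\<close> may be chosen, since
  a vertical isotopy adapts the given lift to any choice.\<close>

definition model_isotopic :: "pseudo_diagram \<Rightarrow> pseudo_diagram \<Rightarrow> bool" where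
  "model_isotopic N N' \<longleftrightarrow> (\<forall>e. (\<forall>x. 0 < e x \<and> e x < 1) \<longrightarrow>
     (\<exists>g g'. model_heights e N g \<and> model_heights e N' g' \<and>
        linear_move\<^sup>*\<^sup>* (raise g (strands N)) (raise g' (strands N'))))"

lemma model_isotopic_sym: "model_isotopic N N' \<Longrightarrow> model_isotopic N' N"
  unfolding model_isotopic_def using linear_moves_sym by blast

lemma over_part_mem [simp]: "k \<in> over_part K W \<longleftrightarrow> k \<in> K \<and> fst k \<in> W"
  by (simp add: over_part_def)

lemma restrict_diagram_simps [simp]:
  "strands (restrict_diagram R W) = over_part (strands R) W"
  "overs (restrict_diagram R W) = over_part (overs R) W"
  by (simp_all add: restrict_diagram_def)

text \<open>Restriction keeps or discards both strand points over a point together, so it neither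
  creates nor destroys prepoints.\<close>

lemma resolve_restrict: "resolve \<epsilon> (restrict_diagram D W) = restrict_diagram (resolve \<epsilon> D) W"
proof -
  have "prepoints (restrict_diagram D W) = over_part (prepoints D) W"
  proof (intro equalityI subsetI)
    fix k assume "k \<in> over_part (prepoints D) W"
    then obtain l where l: "k \<in> strands D" "l \<in> strands D" "k \<noteq> l" "fst k = fst l" "k \<notin> overs D" "l \<notin> overs D"
      and W: "fst k \<in> W"
      unfolding over_part_mem prepoints_def by blast
    then have "l \<in> over_part (strands D) W" by simp
    then show "k \<in> prepoints (restrict_diagram D W)"
      unfolding prepoints_def restrict_diagram_simps using l W by fastforce
  next
    fix k assume "k \<in> prepoints (restrict_diagram D W)"
    then obtain l where l: "k \<in> over_part (strands D) W" "l \<in> over_part (strands D) W" "k \<noteq> l" "fst k = fst l"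
        "k \<notin> over_part (overs D) W" "l \<notin> over_part (overs D) W"
      unfolding prepoints_def restrict_diagram_simps by blast
    then show "k \<in> over_part (prepoints D) W" unfolding over_part_mem prepoints_def by blast
  qed
  then have "overs (resolve \<epsilon> (restrict_diagram D W)) = over_part (overs (resolve \<epsilon> D)) W"
    unfolding resolve_simps restrict_diagram_simps by (auto simp: restrict_diagram_def)
  then show ?thesis by (intro pseudo_diagram.equality) (simp_all add: resolve_def restrict_diagram_def)
qed

context embedded_box
begin

text \<open>Assembles periodic heights from \<open>f0\<close> on the outer part and a copy of
  \<open>g\<close> in every translated box. The hypothesis \<open>match\<close> makes them agree
  along the edges, and the gluing lemma gives continuity.\<close>

lemma fill:
  assumes R: "classical_motif \<Lambda> R" and N: "box_model N"
    and c: "carry \<phi> \<theta> \<theta>' N (restrict_diagram R (\<phi> ` box))"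
    and f0: "continuous_on (over_part (strands R) outer) f0"
      "\<And>k. k \<in> over_part (strands R) outer \<Longrightarrow> 0 < f0 k \<and> f0 k < 1"
      "\<And>k l. k \<in> over_part (strands R) outer \<Longrightarrow> l \<in> over_part (strands R) outer \<Longrightarrow>
        k \<noteq> l \<Longrightarrow> fst k = fst l \<Longrightarrow> k \<in> overs R \<Longrightarrow> f0 l < f0 k"
      "\<And>w k. w \<in> \<Lambda> \<Longrightarrow> k \<in> over_part (strands R) outer \<Longrightarrow> f0 (shift w k) = f0 k"
    and g: "heights N g" and match: "\<And>k. k \<in> strands N \<Longrightarrow> fst k \<notin> open_box \<Longrightarrow> g k = f0 (\<theta> k)"
  obtains f where "heights R f" "\<And>w k. w \<in> \<Lambda> \<Longrightarrow> k \<in> strands R \<Longrightarrow> f (shift w k) = f k"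
    "raise f (strands R) = insert_cells (raise f0 (over_part (strands R) outer)) (raise g (strands N))"
proof -
  define K where "K = strands R"
  note C = carryD[OF c, unfolded restrict_diagram_simps]
  have lat: "\<And>w k. w \<in> \<Lambda> \<Longrightarrow> k \<in> K \<Longrightarrow> shift w k \<in> K"
    and sho: "\<And>w k. w \<in> \<Lambda> \<Longrightarrow> k \<in> K \<Longrightarrow> shift w k \<in> overs R \<longleftrightarrow> k \<in> overs R"
    using R unfolding classical_motif_def K_def by blast+
  have Nbox: "fst \<kappa> \<in> box" if "\<kappa> \<in> strands N" for \<kappa> using N that unfolding box_model_def by blast
  have \<theta>K: "\<theta> \<kappa> \<in> K" "fst (\<theta> \<kappa>) = \<phi> (fst \<kappa>)" if "\<kappa> \<in> strands N" for \<kappa>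
    using C(3)[OF that] C(7)[OF that] unfolding K_def by auto
  \<comment> \<open>The translate is determined by the position in the plane alone; 0 is a dummy
    height.\<close>
  define wo where "wo k = snd (unplace (fst k, 0))" for k :: space
  have wo: "wo k = w" if "q \<in> box" "w \<in> \<Lambda>" "fst k = \<phi> q + w" for k q w
  proof -
    have "(fst k, 0) = place w (q, 0)" using that(3) by (simp add: place_def)
    then show ?thesis using unplace_place[of "(q, 0)" w] that unfolding wo_def by simp
  qed
  define f where "f k = (if fst k \<in> outer then f0 k else g (\<theta>' (shift (- wo k) k)))" for k
  have f_place: "f (shift w (\<theta> \<kappa>)) = g \<kappa>" if \<kappa>: "\<kappa> \<in> strands N" and w: "w \<in> \<Lambda>" for \<kappa> w
  proof (cases "fst \<kappa> \<in> open_box")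
    case True
    have "fst (shift w (\<theta> \<kappa>)) \<notin> outer" using outer_boundary[OF Nbox[OF \<kappa>] w] True \<theta>K[OF \<kappa>] by simp
    moreover have "wo (shift w (\<theta> \<kappa>)) = w" using wo[OF Nbox[OF \<kappa>] w] \<theta>K(2)[OF \<kappa>] by simp
    ultimately show ?thesis unfolding f_def using C(5)[OF \<kappa>] by simp
  next
    case False
    have o: "fst (shift w (\<theta> \<kappa>)) \<in> outer" using outer_boundary[OF Nbox[OF \<kappa>] w] False \<theta>K[OF \<kappa>] by simp
    then have "\<theta> \<kappa> \<in> over_part (strands R) outer" using outer_shift[OF w] \<theta>K(1)[OF \<kappa>] unfolding K_def by simp
    then show ?thesis unfolding f_def using o f0(4)[OF w] match[OF \<kappa> False] by simp
  qed
  have in_place: "\<exists>\<kappa>\<in>strands N. k = shift w (\<theta> \<kappa>) \<and> fst \<kappa> = q"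
    if k: "k \<in> K" and q: "q \<in> box" and w: "w \<in> \<Lambda>" and kq: "fst k = \<phi> q + w" for k q w
  proof -
    define k' where "k' = shift (- w) k"
    have "k' \<in> K" using lat[OF lattice_uminus[OF lattice w] k] unfolding k'_def .
    moreover have fk': "fst k' = \<phi> q" using kq unfolding k'_def by simp
    ultimately have k': "k' \<in> over_part (strands R) (\<phi> ` box)" using q unfolding K_def by simp
    have "fst (\<theta>' k') = q"
      using inj_onD[OF inj _ Nbox[OF C(4)[OF k']] q] \<theta>K(2)[OF C(4)[OF k']] C(6)[OF k'] fk' by simp
    moreover have "k = shift w (\<theta> (\<theta>' k'))" using C(6)[OF k'] unfolding k'_def by simp
    ultimately show ?thesis using C(4)[OF k'] by blast
  qed
  have cases: "fst k \<in> outer \<or> (\<exists>w\<in>\<Lambda>. \<exists>\<kappa>\<in>strands N. k = shift w (\<theta> \<kappa>) \<and> fst \<kappa> \<in> open_box)" if k: "k \<in> K" for k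
  proof (cases "fst k \<in> outer")
    case False
    then obtain q w where qw: "q \<in> open_box" "w \<in> \<Lambda>" "fst k = \<phi> q + w" unfolding outer_def by blast
    then obtain \<kappa> where "\<kappa> \<in> strands N" "k = shift w (\<theta> \<kappa>)" "fst \<kappa> = q"
      using in_place[OF k _ qw(2,3)] open_box_subset_box by blast
    then show ?thesis using qw by blast
  qed simp
  have f_outer: "f k = f0 k" if "fst k \<in> outer" for k using that unfolding f_def by simp
  have contf: "continuous_on K f"
  proof (rule continuous_on_glue[where \<pi> = fst])
    show "continuous_on K fst" by (intro continuous_intros)
    have "{s \<in> K. fst s \<in> outer} = over_part (strands R) outer" unfolding K_def over_part_def ..
    then show "continuous_on {s \<in> K. fst s \<in> outer} f"
      using f0(1) by (intro continuous_on_eq[of _ f0 f]) (auto simp: f_outer)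
    fix w assume w: "w \<in> \<Lambda>"
    have sub: "shift (- w) k \<in> over_part (strands R) (\<phi> ` box)" if "k \<in> K" "fst k - w \<in> \<phi> ` box" for k
      using that lat[OF lattice_uminus[OF lattice w] that(1)] unfolding K_def by simp
    show "continuous_on {s \<in> K. fst s - w \<in> \<phi> ` box} f"
    proof (rule continuous_on_eq[of _ "\<lambda>k. g (\<theta>' (shift (- w) k))"])
      have "continuous_on {s \<in> K. fst s - w \<in> \<phi> ` box} (\<lambda>k. \<theta>' (shift (- w) k))"
      proof (rule continuous_on_compose2[OF C(2)])
        show "continuous_on {s \<in> K. fst s - w \<in> \<phi> ` box} (shift (- w))"
          using continuous_on_shift[OF continuous_on_const continuous_on_id] .
      qed (use sub in blast)
      then show "continuous_on {s \<in> K. fst s - w \<in> \<phi> ` box} (\<lambda>k. g (\<theta>' (shift (- w) k)))"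
        by (rule continuous_on_compose2[OF heightsD(1)[OF g]]) (use sub C(4) in blast)
      fix k assume "k \<in> {s \<in> K. fst s - w \<in> \<phi> ` box}"
      then have k: "k \<in> K" "fst k - w \<in> \<phi> ` box" by auto
      note s = sub[OF this]
      have "f (shift w (\<theta> (\<theta>' (shift (- w) k)))) = g (\<theta>' (shift (- w) k))" by (rule f_place[OF C(4)[OF s] w])
      then show "g (\<theta>' (shift (- w) k)) = f k" using C(6)[OF s] by simp
    qed
  qed
  have hf: "heights R f" unfolding heights_def K_def[symmetric]
  proof (intro conjI ballI impI)
    show "continuous_on K f" by (rule contf)
    fix k assume k: "k \<in> K"
    have "0 < f k \<and> f k < 1"
      using cases[OF k]
    proof (elim disjE bexE conjE)
      assume "fst k \<in> outer"
      then show ?thesis using f0(2)[of k] k f_outer unfolding K_def by simp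
    next
      fix w \<kappa> assume "w \<in> \<Lambda>" "\<kappa> \<in> strands N" "k = shift w (\<theta> \<kappa>)"
      then show ?thesis using f_place heightsD(2)[OF g] by simp
    qed
    then show "0 < f k" "f k < 1" by auto
    fix l assume l: "l \<in> K" and kl: "k \<noteq> l \<and> fst k = fst l \<and> k \<in> overs R"
    show "f l < f k"
      using cases[OF k]
    proof (elim disjE bexE conjE)
      assume o: "fst k \<in> outer"
      then show ?thesis using f0(3)[of k l] k l kl f_outer[OF o] f_outer[of l] unfolding K_def by simp
    next
      fix w \<kappa> assume w: "w \<in> \<Lambda>" and \<kappa>: "\<kappa> \<in> strands N" "k = shift w (\<theta> \<kappa>)"
      have "fst l = \<phi> (fst \<kappa>) + w" using kl \<kappa> \<theta>K(2)[OF \<kappa>(1)] by simp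
      from in_place[OF l Nbox[OF \<kappa>(1)] w this] obtain \<mu>
        where l': "\<mu> \<in> strands N" "l = shift w (\<theta> \<mu>)" "fst \<mu> = fst \<kappa>" by blast
      have "\<kappa> \<noteq> \<mu>" using kl l' \<kappa> by blast
      moreover have "\<kappa> \<in> overs N"
      proof -
        have "\<theta> \<kappa> \<in> overs R" using kl sho[OF w \<theta>K(1)[OF \<kappa>(1)]] \<kappa>(2) by simp
        then show ?thesis using C(8)[OF \<kappa>(1)] \<theta>K(2)[OF \<kappa>(1)] Nbox[OF \<kappa>(1)] by simp
      qed
      ultimately have "g \<mu> < g \<kappa>" using heightsD(3)[OF g \<kappa>(1) l'(1)] l'(3) by simp
      then show ?thesis using f_place[OF \<kappa>(1) w] f_place[OF l'(1) w] \<kappa>(2) l'(2) by simp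
    qed
  qed
  have per: "f (shift v k) = f k" if v: "v \<in> \<Lambda>" and k: "k \<in> K" for v k
    using cases[OF k]
  proof (elim disjE bexE conjE)
    assume o: "fst k \<in> outer"
    then show ?thesis using f0(4)[OF v, of k] f_outer outer_shift[OF v] k unfolding K_def by simp
  next
    fix w \<kappa> assume w: "w \<in> \<Lambda>" and \<kappa>: "\<kappa> \<in> strands N" "k = shift w (\<theta> \<kappa>)"
    show ?thesis using f_place[OF \<kappa>(1) w] f_place[OF \<kappa>(1) lattice_add[OF lattice v w]] \<kappa>(2) by simp
  qed
  have pl: "(fst (shift w (\<theta> \<kappa>)), f (shift w (\<theta> \<kappa>))) = place w (fst \<kappa>, g \<kappa>)" if "w \<in> \<Lambda>" "\<kappa> \<in> strands N" for w \<kappa>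
    using f_place[OF that(2,1)] \<theta>K(2)[OF that(2)] by (simp add: place_def)
  have "raise f K = insert_cells (raise f0 (over_part (strands R) outer)) (raise g (strands N))"
    unfolding insert_cells_def
  proof (intro equalityI subsetI)
    fix p assume "p \<in> raise f K"
    then obtain k where k: "k \<in> K" "p = (fst k, f k)" unfolding raise_def by blast
    show "p \<in> raise f0 (over_part (strands R) outer) \<union> {place w r | w r. w \<in> \<Lambda> \<and> r \<in> raise g (strands N)}"
      using cases[OF k(1)]
    proof (elim disjE bexE conjE)
      assume "fst k \<in> outer"
      then have "p \<in> raise f0 (over_part (strands R) outer)"
        using k f_outer unfolding raise_def K_def by (intro image_eqI[of _ _ k]) simp_all
      then show ?thesis by blast
    next
      fix w \<kappa> assume w: "w \<in> \<Lambda>" and \<kappa>: "\<kappa> \<in> strands N" "k = shift w (\<theta> \<kappa>)"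
      have "p = place w (fst \<kappa>, g \<kappa>)" using pl[OF w \<kappa>(1)] k(2) \<kappa>(2) by simp
      moreover have "(fst \<kappa>, g \<kappa>) \<in> raise g (strands N)" unfolding raise_def using \<kappa>(1) by blast
      ultimately show ?thesis using w by blast
    qed
  next
    fix p assume "p \<in> raise f0 (over_part (strands R) outer) \<union> {place w r | w r. w \<in> \<Lambda> \<and> r \<in> raise g (strands N)}"
    then consider k where "k \<in> over_part (strands R) outer" "p = (fst k, f0 k)"
      | w \<kappa> where "w \<in> \<Lambda>" "\<kappa> \<in> strands N" "p = place w (fst \<kappa>, g \<kappa>)"
      unfolding raise_def by blast
    then show "p \<in> raise f K"
    proof cases
      case (1 k)
      then show ?thesis using f_outer unfolding raise_def K_def by (intro image_eqI[of _ _ k]) simp_all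
    next
      case (2 w \<kappa>)
      then show ?thesis using pl[OF 2(1,2)] lat[OF 2(1) \<theta>K(1)[OF 2(2)]]
        unfolding raise_def by (intro image_eqI[of _ _ "shift w (\<theta> \<kappa>)"]) simp_all
    qed
  qed
  then show ?thesis using that[OF hf] per unfolding K_def by blast
qed

text \<open>The outer heights of a periodic lift are kept throughout. A vertical isotopy installs
  the heights \<open>g\<close> inside the boxes, cell isotopies carry the contents to the other
  model, and the outcome is a lift of \<open>R'\<close> with the same outer heights.\<close>

lemma replace_model:
  assumes R: "classical_motif \<Lambda> R" and R': "classical_motif \<Lambda> R'" and N: "box_model N" and N': "box_model N'"
    and c: "carry \<phi> \<theta> \<theta>' N (restrict_diagram R (\<phi> ` box))"
    and c': "carry \<phi> \<eta> \<eta>' N' (restrict_diagram R' (\<phi> ` box))"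
    and strands: "over_part (strands R) outer = over_part (strands R') outer"
    and overs: "over_part (overs R) outer = over_part (overs R') outer"
    and iso: "model_isotopic N N'" and T: "spatial_lift R T"
  shows "\<exists>T'. spatial_lift R' T' \<and> DP_isotopic T T'"
proof -
  define K where "K = strands R"
  obtain f where f: "heights R f" and per: "\<And>w k. w \<in> \<Lambda> \<Longrightarrow> k \<in> strands R \<Longrightarrow> f (shift w k) = f k"
    and Tf: "DP_tangle_over \<Lambda> (raise f (strands R))" "DP_isotopic T (raise f (strands R))"
    by (rule periodic_heights_exist[OF R T]) (rule that)
  note C = carryD[OF c, unfolded restrict_diagram_simps] and C' = carryD[OF c', unfolded restrict_diagram_simps]
  have uniq: "k = l" if "q \<in> box" "q \<notin> open_box" "k \<in> K" "l \<in> K" "fst k = \<phi> q" "fst l = \<phi> q" for k l q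
  proof -
    have kl: "k \<in> over_part (strands R) (\<phi> ` box)" "l \<in> over_part (strands R) (\<phi> ` box)"
      using that unfolding K_def by auto
    have fst_q: "fst (\<theta>' i) = q" if i: "i \<in> over_part (strands R) (\<phi> ` box)" "fst i = \<phi> q" for i
    proof -
      have "\<phi> (fst (\<theta>' i)) = \<phi> q" using C(7)[OF C(4)[OF i(1)]] C(6)[OF i(1)] i(2) by simp
      moreover have "fst (\<theta>' i) \<in> box" using C(4)[OF i(1)] N unfolding box_model_def by blast
      ultimately show ?thesis by (rule inj_onD[OF inj _ _ \<open>q \<in> box\<close>])
    qed
    note q = fst_q[OF kl(1) that(5)] fst_q[OF kl(2) that(6)]
    have "inj_on fst {k \<in> strands N. fst k \<notin> open_box}" using N unfolding box_model_def by blast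
    then have "\<theta>' k = \<theta>' l"
      by (rule inj_onD) (use q C(4)[OF kl(1)] C(4)[OF kl(2)] that(2) in simp_all)
    then have "\<theta> (\<theta>' k) = \<theta> (\<theta>' l)" by (rule arg_cong)
    then show ?thesis unfolding C(6)[OF kl(1)] C(6)[OF kl(2)] .
  qed
  \<comment> \<open>The given heights read off along the edge of the box. The default 1/2 at points
    without strands only keeps \<open>e\<close> inside the unit interval.\<close>
  define e where "e q = (if \<exists>k\<in>K. fst k = \<phi> q then f (SOME k. k \<in> K \<and> fst k = \<phi> q) else 1/2)" for q
  have some: "(SOME k. k \<in> K \<and> fst k = \<phi> q) \<in> K \<and> fst (SOME k. k \<in> K \<and> fst k = \<phi> q) = \<phi> q"
    if "\<exists>k\<in>K. fst k = \<phi> q" for q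
    using someI_ex[of "\<lambda>k. k \<in> K \<and> fst k = \<phi> q"] that by blast
  have e01: "0 < e q \<and> e q < 1" for q
    using heightsD(2)[OF f] some unfolding e_def K_def by simp
  have e_eq: "e q = f k" if "q \<in> box" "q \<notin> open_box" "k \<in> K" "fst k = \<phi> q" for q k
  proof -
    have ex: "\<exists>k\<in>K. fst k = \<phi> q" using that by blast
    have "(SOME k. k \<in> K \<and> fst k = \<phi> q) = k" using uniq[OF that(1,2) _ that(3) _ that(4)] some[OF ex] by blast
    then show ?thesis using ex unfolding e_def by simp
  qed
  obtain g g' where g: "model_heights e N g" and g': "model_heights e N' g'"
    and moves: "linear_move\<^sup>*\<^sup>* (raise g (strands N)) (raise g' (strands N'))"
    using iso e01 unfolding model_isotopic_def by blast
  have gN: "heights N g" "\<And>k. k \<in> strands N \<Longrightarrow> fst k \<notin> open_box \<Longrightarrow> g k = e (fst k)"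
    using g unfolding model_heights_def by auto
  have gN': "heights N' g'" "\<And>k. k \<in> strands N' \<Longrightarrow> fst k \<notin> open_box \<Longrightarrow> g' k = e (fst k)"
    using g' unfolding model_heights_def by auto
  have sub: "over_part K outer \<subseteq> K" by (auto simp: over_part_def)
  have f0: "continuous_on (over_part K outer) f"
    "\<And>k. k \<in> over_part K outer \<Longrightarrow> 0 < f k \<and> f k < 1"
    "\<And>k l. k \<in> over_part K outer \<Longrightarrow> l \<in> over_part K outer \<Longrightarrow> k \<noteq> l \<Longrightarrow> fst k = fst l \<Longrightarrow> k \<in> overs R \<Longrightarrow> f l < f k"
    "\<And>w k. w \<in> \<Lambda> \<Longrightarrow> k \<in> over_part K outer \<Longrightarrow> f (shift w k) = f k"
    using continuous_on_subset[OF heightsD(1)[OF f]] heightsD(2,3)[OF f] per sub unfolding K_def by blast+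
  have match: "g k = f (\<theta> k)" if k: "k \<in> strands N" "fst k \<notin> open_box" for k
  proof -
    have "fst k \<in> box" using k(1) N unfolding box_model_def by blast
    then show ?thesis using gN(2)[OF k] e_eq[OF _ k(2), of "\<theta> k"] C(3,7)[OF k(1)] unfolding K_def by simp
  qed
  \<comment> \<open>Edge points of the second model lie over \<open>outer\<close>, where both
    diagrams have the same strands, so \<open>e\<close> records the right heights for them,
    too.\<close>
  have match': "g' k = f (\<eta> k)" if k: "k \<in> strands N'" "fst k \<notin> open_box" for k
  proof -
    have b: "fst k \<in> box" using k(1) N' unfolding box_model_def by blast
    have "fst (\<eta> k) = \<phi> (fst k) + 0" using C'(7)[OF k(1)] by simp
    then have "fst (\<eta> k) \<in> outer" using outer_boundary[OF b lattice_zero[OF lattice]] k(2) by metis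
    then have "\<eta> k \<in> over_part (strands R') outer" using C'(3)[OF k(1)] by simp
    then have "\<eta> k \<in> K" using strands sub unfolding K_def by blast
    then show ?thesis using gN'(2)[OF k] e_eq[OF b k(2), of "\<eta> k"] C'(7)[OF k(1)] by simp
  qed
  obtain f1 where f1: "heights R f1" "\<And>w k. w \<in> \<Lambda> \<Longrightarrow> k \<in> strands R \<Longrightarrow> f1 (shift w k) = f1 k"
    "raise f1 (strands R) = insert_cells (raise f (over_part K outer)) (raise g (strands N))"
    by (rule fill[OF R N c f0[unfolded K_def] gN(1) match]) (simp_all add: K_def that)
  have o: "k \<in> overs R' \<longleftrightarrow> k \<in> overs R" if "k \<in> over_part K outer" for k
    using overs that over_part_mem by blast
  have f0': "k \<in> over_part K outer \<Longrightarrow> l \<in> over_part K outer \<Longrightarrow> k \<noteq> l \<Longrightarrow> fst k = fst l \<Longrightarrow> k \<in> overs R' \<Longrightarrow> f l < f k" for k l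
    using f0(3) o by blast
  have KR': "over_part K outer = over_part (strands R') outer" using strands unfolding K_def .
  obtain f1' where f1': "heights R' f1'"
    "raise f1' (strands R') = insert_cells (raise f (over_part K outer)) (raise g' (strands N'))"
    by (rule fill[OF R' N' c' f0(1,2)[unfolded KR'] f0'[unfolded KR'] f0(4)[unfolded KR'] gN'(1) match'])
      (simp_all add: KR' that)
  have one: "k \<in> overs R \<longleftrightarrow> l \<notin> overs R" if "k \<in> strands R" "l \<in> strands R" "k \<noteq> l" "fst k = fst l" for k l
    using R that unfolding classical_motif_def by blast
  have shK: "shift w k \<in> strands R" if "w \<in> \<Lambda>" "k \<in> strands R" for w k
    using R that unfolding classical_motif_def by blast
  interpret periodic_heights "strands R" f f1 \<Lambda>
  proof
    show "tame_strands (strands R)" using R unfolding classical_motif_def by blast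
    fix k l assume kl: "k \<in> strands R" "l \<in> strands R" "k \<noteq> l" "fst k = fst l"
    show "f k < f l \<and> f1 k < f1 l \<or> f l < f k \<and> f1 l < f1 k"
    proof (cases "k \<in> overs R")
      case True
      then show ?thesis using heightsD(3)[OF f kl] heightsD(3)[OF f1(1) kl] by blast
    next
      case False
      then have "l \<in> overs R" using one[OF kl] by blast
      then show ?thesis using heightsD(3)[OF f kl(2,1)] heightsD(3)[OF f1(1) kl(2,1)] kl(3,4) by simp
    qed
  next
    fix w k assume wk: "w \<in> \<Lambda>" "k \<in> strands R"
    then show "\<exists>k'\<in>strands R. fst k' = fst k + w \<and> f k' = f k \<and> f1 k' = f1 k"
      using shK[OF wk] per[OF wk] f1(2)[OF wk] by (intro bexI[of _ "shift w k"]) simp_all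
  qed (use heightsD[OF f] heightsD[OF f1(1)] lattice in blast)+
  note v = vertical_isotopy[OF Tf(1)]
  have Q: "fst ` raise f (over_part K outer) \<subseteq> outer" unfolding raise_def by (auto simp: over_part_def)
  have P: "fst ` raise g (strands N) \<subseteq> box" using N unfolding raise_def box_model_def by auto
  have "DP_isotopic (raise f1 (strands R)) (raise f1' (strands R')) \<and> DP_tangle_over \<Lambda> (raise f1' (strands R'))"
    using insert_cells_moves[OF linear_moves_cell_moves[OF moves] v(2)[unfolded f1(3)] Q P] f1(3) f1'(2) by simp
  then have "DP_isotopic T (raise f1' (strands R'))" "DP_tangle (raise f1' (strands R'))"
    using DP_isotopic_trans[OF Tf(2) DP_isotopic_trans[OF v(1)]] DP_tangleI by blast+
  then show ?thesis unfolding spatial_lift_iff using f1'(1) by blast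
qed

end

lemma prepoints_over_part:
  assumes "over_part (strands D) C = over_part (strands D') C" "over_part (overs D) C = over_part (overs D') C"
  shows "over_part (prepoints D) C = over_part (prepoints D') C"
proof -
  have *: "over_part (prepoints D) C \<subseteq> over_part (prepoints D') C"
    if "over_part (strands D) C = over_part (strands D') C" "over_part (overs D) C = over_part (overs D') C" for D D'
  proof
    fix k assume "k \<in> over_part (prepoints D) C"
    then obtain l where l: "k \<in> strands D" "l \<in> strands D" "k \<noteq> l" "fst k = fst l" "k \<notin> overs D" "l \<notin> overs D"
      and kC: "fst k \<in> C"
      unfolding over_part_mem prepoints_def by blast
    have "j \<in> strands D' \<and> j \<notin> overs D'" if "j \<in> {k, l}" for j
    proof -
      have "fst j \<in> C" "j \<in> strands D" "j \<notin> overs D" using that l kC by auto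
      then show ?thesis using \<open>over_part (strands D) C = _\<close> \<open>over_part (overs D) C = _\<close> over_part_mem by metis
    qed
    then show "k \<in> over_part (prepoints D') C" unfolding over_part_mem prepoints_def using l kC by blast
  qed
  show ?thesis using *[OF assms] *[OF assms[symmetric]] by blast
qed

text \<open>One embedded box serves both directions, because being isotopic is symmetric for models.
  Outside the box, equal markings yield equal resolutions.\<close>

lemma transfers_local_move:
  assumes D: "motif \<Lambda> D" and D': "motif \<Lambda> D'" and move: "local_move \<Lambda> M M' D D'"
    and M: "box_model M" and M': "box_model M'"
    and iso: "\<And>\<epsilon>. model_isotopic (resolve \<epsilon> M) (resolve \<epsilon> M')"
  shows "transfers D D'" and "transfers D' D"
proof -
  obtain \<phi> where \<phi>: "continuous_on box \<phi>" "inj_on \<phi> box"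
      "\<forall>w\<in>\<Lambda> - {0}. \<phi> ` box \<inter> (\<lambda>x. x + w) ` \<phi> ` box = {}"
    and c: "carries \<phi> M (restrict_diagram D (\<phi> ` box))" and c': "carries \<phi> M' (restrict_diagram D' (\<phi> ` box))"
    and out: "let C = - {\<phi> q + w | q w. q \<in> open_box \<and> w \<in> \<Lambda>} in
           over_part (strands D) C = over_part (strands D') C \<and>
           over_part (overs D) C = over_part (overs D') C \<and>
           (\<forall>k\<in>over_part (prepoints D) C. marking D k = marking D' k)"
    using move unfolding local_move_def by (elim exE conjE) (rule that)
  interpret embedded_box \<Lambda> \<phi> using \<phi> motifD(1)[OF D] by unfold_locales blast+
  have so: "over_part (strands D) outer = over_part (strands D') outer"
    and oo: "over_part (overs D) outer = over_part (overs D') outer"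
    and mo: "\<And>k. k \<in> over_part (prepoints D) outer \<Longrightarrow> marking D k = marking D' k"
    using out unfolding outer_def[symmetric] Let_def by blast+
  have po: "over_part (prepoints D) outer = over_part (prepoints D') outer" by (rule prepoints_over_part[OF so oo])
  have ro: "over_part (overs (resolve \<epsilon> D)) outer = over_part (overs (resolve \<epsilon> D')) outer" for \<epsilon>
  proof (rule set_eqI)
    fix k
    have "fst k \<in> outer \<Longrightarrow> k \<in> overs D \<longleftrightarrow> k \<in> overs D'" "fst k \<in> outer \<Longrightarrow> k \<in> prepoints D \<longleftrightarrow> k \<in> prepoints D'"
      using oo po over_part_mem by blast+
    then show "k \<in> over_part (overs (resolve \<epsilon> D)) outer \<longleftrightarrow> k \<in> over_part (overs (resolve \<epsilon> D')) outer"
      using mo[of k] by auto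
  qed
  have i: "inj_on \<phi> (fst ` strands M)" "inj_on \<phi> (fst ` strands M')"
    using M M' \<phi>(2) inj_on_subset unfolding box_model_def by blast+
  obtain \<theta> \<theta>' where cy: "\<And>\<epsilon>. carry \<phi> \<theta> \<theta>' (resolve \<epsilon> M) (resolve \<epsilon> (restrict_diagram D (\<phi> ` box)))"
    using carries_carry_resolve[OF c i(1)] by blast
  obtain \<eta> \<eta>' where cy': "\<And>\<epsilon>. carry \<phi> \<eta> \<eta>' (resolve \<epsilon> M') (resolve \<epsilon> (restrict_diagram D' (\<phi> ` box)))"
    using carries_carry_resolve[OF c' i(2)] by blast
  have m: "box_model (resolve \<epsilon> M)" "box_model (resolve \<epsilon> M')" for \<epsilon>
    using M M' unfolding box_model_def by simp_all
  note cm = classical_motif_resolve[OF D] and cm' = classical_motif_resolve[OF D']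
  note cy = cy[unfolded resolve_restrict] and cy' = cy'[unfolded resolve_restrict]
  show "transfers D D'" unfolding transfers_def resolution_def
    using replace_model[OF cm cm' m cy cy' _ ro iso] so unfolding resolve_simps(1) by blast
  show "transfers D' D" unfolding transfers_def resolution_def
    using replace_model[OF cm' cm m(2,1) cy' cy _ ro[symmetric] model_isotopic_sym[OF iso]] so
    unfolding resolve_simps(1) by metis
qed

section \<open>The Reidemeister models\<close>

text \<open>By compactness the heights keep a definite distance from the floor and the roof of the
  cell, as the displacement bound near the boundary requires.\<close>

lemma unit_margin:
  fixes g :: "'a :: topological_space \<Rightarrow> real"
  assumes "compact K" "continuous_on K g" "\<forall>k\<in>K. 0 < g k \<and> g k < 1"
  shows "\<exists>m>0. \<forall>k\<in>K. m \<le> g k \<and> g k \<le> 1 - m"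
proof (cases "K = {}")
  case True
  then show ?thesis by (intro exI[of _ 1]) simp
next
  case False
  have "continuous_on K (\<lambda>k. min (g k) (1 - g k))" using assms(2) by (intro continuous_intros)
  then obtain k where k: "k \<in> K" "\<And>l. l \<in> K \<Longrightarrow> min (g k) (1 - g k) \<le> min (g l) (1 - g l)"
    using continuous_attains_inf[OF assms(1) False] by blast
  show ?thesis
  proof (intro exI[of _ "min (g k) (1 - g k)"] conjI[OF _ ballI])
    show "0 < min (g k) (1 - g k)" using assms(3) k(1) by simp
    fix l assume "l \<in> K"
    from k(2)[OF this] show "min (g k) (1 - g k) \<le> g l \<and> g l \<le> 1 - min (g k) (1 - g k)" by linarith
  qed
qed

text \<open>A point off the cell lies beyond an end, a side, or the floor or roof, and the three
  summands of the constant answer these cases: the displacement decays like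
  \<open>A * (1 - \<xi>)\<close> at the ends, the sides are at distance at least 1/2, and floor and
  roof at distance at least \<open>m\<close>.\<close>

lemma cell_boundary_distance:
  fixes v :: space
  assumes X: "X \<notin> cell" and p: "\<bar>x\<bar> \<le> \<xi>" "\<bar>y\<bar> \<le> 1/2" "m \<le> z" "z \<le> 1 - m" "0 < m"
    and v: "norm v \<le> A * (1 - \<xi>)" "norm v \<le> B" and "0 \<le> A"
  shows "norm v \<le> (A + 2 * B + B / m) * dist ((x, y), z) X"
proof -
  define d where "d = dist ((x, y), z) X"
  have B: "0 \<le> B" using v(2) norm_ge_zero[of v] by linarith
  have d: "0 \<le> d" unfolding d_def by simp
  have c: "\<bar>x - fst (fst X)\<bar> \<le> d" "\<bar>y - snd (fst X)\<bar> \<le> d" "\<bar>z - snd X\<bar> \<le> d"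
    using abs_components_le_norm(1-3)[of "((x, y), z) - X"] unfolding d_def dist_norm by simp_all
  have t: "0 \<le> A * d" "0 \<le> 2 * B * d" "0 \<le> B / m * d" using \<open>0 \<le> A\<close> B d p by simp_all
  have sum: "(A + 2 * B + B / m) * d = A * d + 2 * B * d + B / m * d" by (simp add: algebra_simps)
  have "\<not> (\<bar>fst (fst X)\<bar> < 1 \<and> \<bar>snd (fst X)\<bar> < 1 \<and> 0 < snd X \<and> snd X < 1)"
    using X unfolding cell_def open_box_def by (auto simp: mem_Times_iff)
  then consider "1 \<le> \<bar>fst (fst X)\<bar>" | "1 \<le> \<bar>snd (fst X)\<bar>" | "snd X \<le> 0 \<or> 1 \<le> snd X" by linarith
  then have "norm v \<le> A * d + 2 * B * d + B / m * d"
  proof cases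
    case 1
    then have "1 - \<xi> \<le> d" using c(1) p(1) by linarith
    then have "A * (1 - \<xi>) \<le> A * d" using \<open>0 \<le> A\<close> by (rule mult_left_mono)
    then show ?thesis using v t by linarith
  next
    case 2
    then have "1 \<le> 2 * d" using c(2) p(2) by linarith
    then have "B * 1 \<le> B * (2 * d)" using B by (rule mult_left_mono)
    then show ?thesis using v t by simp
  next
    case 3
    then have "m \<le> d" using c(3) p(3,4) by linarith
    then have "B * 1 \<le> B * (d / m)" using B p(5) by (intro mult_left_mono) simp_all
    then show ?thesis using v t by simp
  qed
  then show ?thesis unfolding d_def[symmetric] sum .
qed

text \<open>Heights prescribed by \<open>c\<close> on the middle part of a strand and by \<open>e\<close> at its ends.\<close>

definition level :: "(plane \<Rightarrow> real) \<Rightarrow> (real \<Rightarrow> real) \<Rightarrow> real \<Rightarrow> real \<Rightarrow> real \<Rightarrow> real" where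
  "level e c l r x = c x + max 0 (4 * x - 3) * (e (1, r) - c x) + max 0 (- 4 * x - 3) * (e (- 1, l) - c x)"

lemma level_ends: "level e c l r 1 = e (1, r)" "level e c l r (- 1) = e (- 1, l)"
  by (simp_all add: level_def)

text \<open>The ramps start at 3/4 and reach 1 at the ends. The double points of the twist and
  triangle models have abscissa 0 or 1/2 in absolute value, so the chosen heights are in force
  there.\<close>

lemma level_middle: "\<bar>x\<bar> \<le> 3/4 \<Longrightarrow> level e c l r x = c x"
  unfolding level_def by (subst (1 2) max_absorb1) (auto simp: abs_le_iff)

lemma convex_unit:
  fixes a b s :: real
  assumes "0 < a" "a < 1" "0 < b" "b < 1" "0 \<le> s" "s \<le> 1"
  shows "0 < a + s * (b - a) \<and> a + s * (b - a) < 1"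
proof -
  have "a + s * (b - a) = (1 - s) * a + s * b" by (simp add: algebra_simps)
  moreover have "0 < (1 - s) * a + s * b"
    using assms by (cases "s = 1") (auto intro!: add_pos_nonneg)
  moreover have "(1 - s) * a + s * b < 1"
    using assms convex_bound_lt[of a 1 b "1 - s" s] by simp
  ultimately show ?thesis by simp
qed

lemma level_unit:
  assumes "\<And>x. 0 < e x \<and> e x < 1" "0 < c x" "c x < 1" "x \<in> {-1..1}"
  shows "0 < level e c l r x \<and> level e c l r x < 1"
proof (cases "0 \<le> x")
  case True
  then have "level e c l r x = c x + max 0 (4 * x - 3) * (e (1, r) - c x)" unfolding level_def by simp
  then show ?thesis using convex_unit[of "c x" "e (1, r)" "max 0 (4 * x - 3)"] assms by simp
next
  case False
  then have "level e c l r x = c x + max 0 (- 4 * x - 3) * (e (- 1, l) - c x)" unfolding level_def by simp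
  then show ?thesis using convex_unit[of "c x" "e (- 1, l)" "max 0 (- 4 * x - 3)"] assms by simp
qed

lemma continuous_on_level [continuous_intros]:
  "continuous_on S c \<Longrightarrow> continuous_on S (level e c l r)"
  unfolding level_def by (intro continuous_intros)

section \<open>Models whose strands are graphs\<close>

definition graphs :: "real set \<Rightarrow> (real \<Rightarrow> real \<Rightarrow> real) \<Rightarrow> space set" where
  "graphs I y = (\<Union>i\<in>I. strand_graph i (y i))"

lemma mem_graphs: "k \<in> graphs I y \<longleftrightarrow> snd k \<in> I \<and> \<bar>fst (fst k)\<bar> \<le> 1 \<and> snd (fst k) = y (snd k) (fst (fst k))"
proof -
  obtain a b c where k: "k = ((a, b), c)" by (cases k) auto
  show ?thesis unfolding graphs_def strand_graph_def k by auto
qed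

definition graph_height :: "(plane \<Rightarrow> real) \<Rightarrow> (real \<Rightarrow> real \<Rightarrow> real) \<Rightarrow> (real \<Rightarrow> real) \<Rightarrow> (real \<Rightarrow> real) \<Rightarrow> space \<Rightarrow> real" where
  "graph_height e c l r k = level e (c (snd k)) (l (snd k)) (r (snd k)) (fst (fst k))"

text \<open>The bound 1/2 keeps the strands away from the upper and lower sides, so they leave the
  box only on the left and on the right, at distinct points.\<close>

locale graph_model =
  fixes I :: "real set" and y :: "real \<Rightarrow> real \<Rightarrow> real" and l r :: "real \<Rightarrow> real"
  assumes fin: "finite I" and cont: "\<And>i. i \<in> I \<Longrightarrow> continuous_on {-1..1} (y i)"
    and small: "\<And>i x. i \<in> I \<Longrightarrow> \<bar>x\<bar> \<le> 1 \<Longrightarrow> \<bar>y i x\<bar> \<le> 1/2"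
    and ends: "\<And>i. i \<in> I \<Longrightarrow> y i (- 1) = l i" "\<And>i. i \<in> I \<Longrightarrow> y i 1 = r i"
    and inj_ends: "inj_on l I" "inj_on r I"
begin

lemma compact_strand:
  assumes "i \<in> I"
  shows "compact (strand_graph i (y i))"
proof -
  have "strand_graph i (y i) = (\<lambda>x. ((x, y i x), i)) ` {-1..1}" unfolding strand_graph_def by auto
  moreover have "continuous_on {-1..1} (\<lambda>x. ((x, y i x), i))" using cont[OF assms] by (intro continuous_intros)
  ultimately show ?thesis by (metis compact_continuous_image compact_Icc)
qed

lemma compact_graphs: "compact (graphs I y)"
  unfolding graphs_def using fin compact_strand by (rule compact_UN)

lemma continuous_on_graph_height:
  assumes "\<And>i. i \<in> I \<Longrightarrow> continuous_on {-1..1} (c i)"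
  shows "continuous_on (graphs I y) (graph_height e c l r)"
  unfolding graphs_def
proof (rule continuous_on_closed_Union[OF fin])
  fix i assume i: "i \<in> I"
  show "closed (strand_graph i (y i))" using compact_strand[OF i] by (rule compact_imp_closed)
  have "continuous_on (strand_graph i (y i)) (\<lambda>k. level e (c i) (l i) (r i) (fst (fst k)))"
  proof (rule continuous_on_compose2[of "{-1..1}" "level e (c i) (l i) (r i)"])
    show "continuous_on {-1..1} (level e (c i) (l i) (r i))" by (intro continuous_intros assms[OF i])
    show "continuous_on (strand_graph i (y i)) (\<lambda>k. fst (fst k))" by (intro continuous_intros)
  qed (auto simp: strand_graph_def)
  then show "continuous_on (strand_graph i (y i)) (graph_height e c l r)"
    by (rule continuous_on_eq) (auto simp: strand_graph_def graph_height_def)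
qed

lemma graph_height_unit:
  assumes "\<And>x. 0 < e x \<and> e x < 1" "\<And>i x. i \<in> I \<Longrightarrow> \<bar>x\<bar> \<le> 1 \<Longrightarrow> 0 < c i x \<and> c i x < 1" "k \<in> graphs I y"
  shows "0 < graph_height e c l r k \<and> graph_height e c l r k < 1"
  unfolding graph_height_def
  using assms(2)[of "snd k" "fst (fst k)"] assms(3) unfolding mem_graphs
  by (intro level_unit assms(1)) auto

lemma boundary_cases:
  assumes "k \<in> graphs I y" "fst k \<notin> open_box"
  shows "fst k = (1, r (snd k)) \<or> fst k = (- 1, l (snd k))"
proof -
  have k: "snd k \<in> I" "\<bar>fst (fst k)\<bar> \<le> 1" "snd (fst k) = y (snd k) (fst (fst k))"
    using assms(1) unfolding mem_graphs by auto
  have "\<bar>snd (fst k)\<bar> \<le> 1/2" using small[OF k(1,2)] k(3) by simp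
  then have "\<not> \<bar>fst (fst k)\<bar> < 1" using assms(2) unfolding open_box_def by (auto simp: mem_Times_iff)
  then have "fst (fst k) = 1 \<or> fst (fst k) = - 1" using k(2) by linarith
  then show ?thesis using k ends[OF k(1)] by (auto simp: prod_eq_iff)
qed

lemma box_model_graphs:
  assumes "strands N = graphs I y"
  shows "box_model N"
  unfolding box_model_def assms
proof
  show "fst ` graphs I y \<subseteq> box"
  proof (rule image_subsetI)
    fix k assume "k \<in> graphs I y"
    then have k: "snd k \<in> I" "\<bar>fst (fst k)\<bar> \<le> 1" "snd (fst k) = y (snd k) (fst (fst k))"
      unfolding mem_graphs by auto
    then show "fst k \<in> box" using small[OF k(1,2)] unfolding box_def by (auto simp: mem_Times_iff abs_le_iff)
  qed
  show "inj_on fst {k \<in> graphs I y. fst k \<notin> open_box}"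
  proof (rule inj_onI)
    fix k k' assume "k \<in> {k \<in> graphs I y. fst k \<notin> open_box}" "k' \<in> {k \<in> graphs I y. fst k \<notin> open_box}"
      and eq: "fst k = fst k'"
    then have k: "k \<in> graphs I y" "fst k \<notin> open_box" and k': "k' \<in> graphs I y" "fst k' \<notin> open_box" by auto
    have "snd k \<in> I" "snd k' \<in> I" using k(1) k'(1) unfolding mem_graphs by auto
    then have "snd k = snd k'"
      using boundary_cases[OF k] boundary_cases[OF k'] eq inj_ends by (auto simp: inj_on_eq_iff)
    then show "k = k'" using eq by (rule prod_eqI[rotated])
  qed
qed

lemma model_heights_graphs:
  assumes N: "strands N = graphs I y" and e: "\<And>x. 0 < e x \<and> e x < 1"
    and c: "\<And>i. i \<in> I \<Longrightarrow> continuous_on {-1..1} (c i)" "\<And>i x. i \<in> I \<Longrightarrow> \<bar>x\<bar> \<le> 1 \<Longrightarrow> 0 < c i x \<and> c i x < 1"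
    and order: "\<And>i j x. i \<in> I \<Longrightarrow> j \<in> I \<Longrightarrow> i \<noteq> j \<Longrightarrow> \<bar>x\<bar> \<le> 1 \<Longrightarrow> y i x = y j x \<Longrightarrow> ((x, y i x), i) \<in> overs N \<Longrightarrow>
      \<bar>x\<bar> \<le> 3/4 \<and> c j x < c i x"
  shows "model_heights e N (graph_height e c l r)"
  unfolding model_heights_def heights_def N
proof (intro conjI ballI impI)
  show "continuous_on (graphs I y) (graph_height e c l r)" by (rule continuous_on_graph_height[OF c(1)])
  fix k assume k: "k \<in> graphs I y"
  show "0 < graph_height e c l r k" "graph_height e c l r k < 1"
    using graph_height_unit[OF e c(2) k] by auto
  show "graph_height e c l r k = e (fst k)" if "fst k \<notin> open_box"
    using boundary_cases[OF k that] unfolding graph_height_def by (auto simp: level_ends)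
  fix k' assume k': "k' \<in> graphs I y" and kk: "k \<noteq> k' \<and> fst k = fst k' \<and> k \<in> overs N"
  have m: "snd k \<in> I" "snd k' \<in> I" "\<bar>fst (fst k)\<bar> \<le> 1" "snd (fst k) = y (snd k) (fst (fst k))"
    "snd (fst k') = y (snd k') (fst (fst k'))"
    using k k' unfolding mem_graphs by auto
  have "snd k \<noteq> snd k'" using kk prod_eqI[of k k'] by blast
  moreover have "y (snd k) (fst (fst k)) = y (snd k') (fst (fst k))" using m kk by simp
  moreover have "((fst (fst k), y (snd k) (fst (fst k))), snd k) \<in> overs N" using kk m(4) by (metis prod.collapse)
  ultimately have "\<bar>fst (fst k)\<bar> \<le> 3/4 \<and> c (snd k') (fst (fst k)) < c (snd k) (fst (fst k))"
    using order m(1,2,3) by blast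
  then show "graph_height e c l r k' < graph_height e c l r k"
    using kk unfolding graph_height_def by (simp add: level_middle)
qed

text \<open>Strands move vertically in the picture with profile \<open>1 - \<bar>x\<bar>\<close>,
  which is Lipschitz and vanishes at the ends. Equal speeds need no separation; different speeds
  require a distance of 1/8 in position or in height at every time. Heights count only in the
  middle, since \<open>e\<close> rules near the ends.\<close>

lemma graph_motion:
  assumes y': "\<And>i x. i \<in> I \<Longrightarrow> \<bar>x\<bar> \<le> 1 \<Longrightarrow> y' i x = y i x + a i * (1 - \<bar>x\<bar>)" and a: "\<And>i. i \<in> I \<Longrightarrow> \<bar>a i\<bar> \<le> 1"
    and small': "\<And>i x. i \<in> I \<Longrightarrow> \<bar>x\<bar> \<le> 1 \<Longrightarrow> \<bar>y' i x\<bar> \<le> 1/2"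
    and e: "\<And>x. 0 < e x \<and> e x < 1"
    and c: "\<And>i. i \<in> I \<Longrightarrow> continuous_on {-1..1} (c i)" "\<And>i x. i \<in> I \<Longrightarrow> \<bar>x\<bar> \<le> 1 \<Longrightarrow> 0 < c i x \<and> c i x < 1"
    and sep: "\<And>t i j x x'. 0 \<le> t \<Longrightarrow> t \<le> 1 \<Longrightarrow> i \<in> I \<Longrightarrow> j \<in> I \<Longrightarrow> a i \<noteq> a j \<Longrightarrow> \<bar>x\<bar> \<le> 1 \<Longrightarrow> \<bar>x'\<bar> \<le> 1 \<Longrightarrow>
      1/8 \<le> \<bar>x - x'\<bar> \<or> 1/8 \<le> \<bar>(y i x + t * (a i * (1 - \<bar>x\<bar>))) - (y j x' + t * (a j * (1 - \<bar>x'\<bar>)))\<bar> \<or>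
      \<bar>x\<bar> \<le> 3/4 \<and> \<bar>x'\<bar> \<le> 3/4 \<and> 1/8 \<le> \<bar>c i x - c j x'\<bar>"
  shows "linear_move (raise (graph_height e c l r) (graphs I y)) (raise (graph_height e c l r) (graphs I y'))"
proof -
  define g where "g = graph_height e c l r"
  define p where "p k = (fst k, g k)" for k
  define q where "q k = ((fst (fst k), y' (snd k) (fst (fst k))), g k)" for k
  have gc: "continuous_on (graphs I y) g" unfolding g_def by (rule continuous_on_graph_height) (rule c(1))
  have "0 < g k \<and> g k < 1" if "k \<in> graphs I y" for k
    unfolding g_def by (rule graph_height_unit[OF e c(2) that])
  then have gu: "\<forall>k\<in>graphs I y. 0 < g k \<and> g k < 1" by blast
  obtain m where m: "0 < m" "\<And>k. k \<in> graphs I y \<Longrightarrow> m \<le> g k \<and> g k \<le> 1 - m"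
    using unit_margin[OF compact_graphs gc gu] by blast
  have K: "snd k \<in> I" "\<bar>fst (fst k)\<bar> \<le> 1" "snd (fst k) = y (snd k) (fst (fst k))" if "k \<in> graphs I y" for k
    using that unfolding mem_graphs by auto
  have v: "q k - p k = ((0, a (snd k) * (1 - \<bar>fst (fst k)\<bar>)), 0)" if "k \<in> graphs I y" for k
    using K[OF that] y'[OF K(1,2)[OF that]] unfolding p_def q_def by (simp add: prod_eq_iff)
  have pt: "p k + t *\<^sub>R (q k - p k) =
      ((fst (fst k), y (snd k) (fst (fst k)) + t * (a (snd k) * (1 - \<bar>fst (fst k)\<bar>))), g k)" if "k \<in> graphs I y" for k t
    unfolding v[OF that] using K(3)[OF that] unfolding p_def by (simp add: prod_eq_iff)
  \<comment> \<open>An intermediate position is a convex combination of the initial and the final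
    one, which both obey the bound.\<close>
  have yt: "\<bar>y i x + t * (a i * (1 - \<bar>x\<bar>))\<bar> \<le> 1/2" if "i \<in> I" "\<bar>x\<bar> \<le> 1" "0 \<le> t" "t \<le> 1" for i x t
  proof -
    have "y i x + t * (a i * (1 - \<bar>x\<bar>)) = (1 - t) * y i x + t * y' i x"
      unfolding y'[OF that(1,2)] by (simp add: algebra_simps)
    also have "\<bar>\<dots>\<bar> \<le> (1 - t) * \<bar>y i x\<bar> + t * \<bar>y' i x\<bar>"
      using that(3,4) abs_triangle_ineq[of "(1 - t) * y i x" "t * y' i x"] by (simp add: abs_mult)
    also have "\<dots> \<le> (1 - t) * (1/2) + t * (1/2)"
      using small[OF that(1,2)] small'[OF that(1,2)] that(3,4) by (intro add_mono mult_left_mono) auto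
    also have "\<dots> = 1/2" by (simp add: field_simps)
    finally show ?thesis .
  qed
  have nv: "norm (((0 :: real, s :: real), 0 :: real)) = \<bar>s\<bar>" for s by (simp add: norm_Pair)
  have "linear_motion (graphs I y) p q" unfolding linear_motion_def
  \<comment> \<open>Two displacements of size at most 1 differ by at most 2, which is 16 times the
    separation 1/8. The rest is the boundary estimate with both bounds equal to 1.\<close>
  proof (rule exI[of _ "16 + (1 + 2 * 1 + 1 / m)"], intro ballI conjI allI impI)
    fix t :: real and k assume t: "t \<in> {0..1}" and k: "k \<in> graphs I y"
    have t01: "0 \<le> t" "t \<le> 1" using t by auto
    define x where "x = fst (fst k)"
    define i where "i = snd k"
    note Kk = K[OF k, folded x_def i_def]
    have C: "0 \<le> 1 + 2 * 1 + 1 / m" using m(1) by simp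
    {
      fix k' assume k': "k' \<in> graphs I y"
      define x' where "x' = fst (fst k')"
      define j where "j = snd k'"
      note Kk' = K[OF k', folded x'_def j_def]
      define D where "D = dist (p k + t *\<^sub>R (q k - p k)) (p k' + t *\<^sub>R (q k' - p k'))"
      have D: "\<bar>x - x'\<bar> \<le> D" "\<bar>(y i x + t * (a i * (1 - \<bar>x\<bar>))) - (y j x' + t * (a j * (1 - \<bar>x'\<bar>)))\<bar> \<le> D" "\<bar>g k - g k'\<bar> \<le> D"
        using abs_components_le_norm(1-3)[of "(p k + t *\<^sub>R (q k - p k)) - (p k' + t *\<^sub>R (q k' - p k'))"]
        unfolding D_def dist_norm pt[OF k] pt[OF k'] x_def x'_def i_def j_def by simp_all
      have "\<bar>a i * (1 - \<bar>x\<bar>) - a j * (1 - \<bar>x'\<bar>)\<bar> \<le> 16 * D"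
      proof (cases "a i = a j")
        case True
        have "\<bar>a i * (1 - \<bar>x\<bar>) - a j * (1 - \<bar>x'\<bar>)\<bar> = \<bar>a i\<bar> * \<bar>\<bar>x'\<bar> - \<bar>x\<bar>\<bar>"
          unfolding True[symmetric] abs_mult[symmetric] by (simp add: algebra_simps)
        also have "\<dots> \<le> 1 * \<bar>x - x'\<bar>" using a[OF Kk(1)] by (intro mult_mono) auto
        also have "\<dots> \<le> 16 * D" using D(1) abs_ge_zero[of "x - x'"] by simp
        finally show ?thesis .
      next
        case False
        have "1/8 \<le> D"
          using sep[OF t01 Kk(1) Kk'(1) False Kk(2) Kk'(2)]
        proof (elim disjE conjE)
          assume "\<bar>x\<bar> \<le> 3/4" "\<bar>x'\<bar> \<le> 3/4" "1/8 \<le> \<bar>c i x - c j x'\<bar>"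
          then have "1/8 \<le> \<bar>g k - g k'\<bar>" unfolding g_def graph_height_def x_def x'_def i_def j_def by (simp add: level_middle)
          then show ?thesis using D(3) by linarith
        qed (use D in linarith)+
        moreover have "\<bar>a i * (1 - \<bar>x\<bar>)\<bar> \<le> 1" "\<bar>a j * (1 - \<bar>x'\<bar>)\<bar> \<le> 1"
          using a[OF Kk(1)] a[OF Kk'(1)] Kk(2) Kk'(2) by (auto simp: abs_mult intro!: mult_le_one)
        ultimately show ?thesis by linarith
      qed
      also have "16 * D \<le> (16 + (1 + 2 * 1 + 1 / m)) * D"
        using C by (intro mult_right_mono) (auto simp: D_def)
      finally show "norm ((q k - p k) - (q k' - p k')) \<le>
          (16 + (1 + 2 * 1 + 1 / m)) * dist (p k + t *\<^sub>R (q k - p k)) (p k' + t *\<^sub>R (q k' - p k'))"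
        unfolding D_def[symmetric] unfolding v[OF k] v[OF k'] x_def x'_def i_def j_def by (simp add: nv)
    next
      fix X assume X: "X \<notin> cell"
      have nvk: "norm (q k - p k) \<le> 1 * (1 - \<bar>x\<bar>)"
        unfolding v[OF k] nv using a[OF Kk(1)] Kk(2)
        by (simp add: abs_mult x_def[symmetric] i_def[symmetric] mult_left_le_one_le)
      have "norm (q k - p k) \<le> (1 + 2 * 1 + 1 / m) * dist (p k + t *\<^sub>R (q k - p k)) X"
        unfolding pt[OF k] x_def[symmetric] i_def[symmetric]
        by (rule cell_boundary_distance[OF X order_refl yt[OF Kk(1,2) t01]])
          (use m(1) m(2)[OF k] nvk in auto)
      also have "\<dots> \<le> (16 + (1 + 2 * 1 + 1 / m)) * dist (p k + t *\<^sub>R (q k - p k)) X"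
        by (intro mult_right_mono) auto
      finally show "norm (q k - p k) \<le> (16 + (1 + 2 * 1 + 1 / m)) * dist (p k + t *\<^sub>R (q k - p k)) X" .
    }
  qed
  moreover have "raise g (graphs I y) = p ` graphs I y" unfolding raise_def p_def ..
  moreover have "raise g (graphs I y') = q ` graphs I y"
  proof (intro equalityI subsetI)
    fix z assume "z \<in> raise g (graphs I y')"
    then obtain k where k: "k \<in> graphs I y'" "z = (fst k, g k)" unfolding raise_def by blast
    define k0 where "k0 = ((fst (fst k), y (snd k) (fst (fst k))), snd k)"
    have "k0 \<in> graphs I y" "z = q k0"
      using k unfolding k0_def q_def mem_graphs g_def graph_height_def by (auto simp: prod_eq_iff)
    then show "z \<in> q ` graphs I y" by blast
  next
    fix z assume "z \<in> q ` graphs I y"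
    then obtain k where k: "k \<in> graphs I y" "z = q k" by blast
    define k1 where "k1 = ((fst (fst k), y' (snd k) (fst (fst k))), snd k)"
    have "k1 \<in> graphs I y'" "z = (fst k1, g k1)"
      using k unfolding k1_def q_def mem_graphs g_def graph_height_def by auto
    then show "z \<in> raise g (graphs I y')" unfolding raise_def by blast
  qed
  ultimately show ?thesis unfolding linear_move_def g_def[symmetric] by blast
qed

end

subsection \<open>Twists\<close>

definition two_levels :: "'a \<Rightarrow> 'a \<Rightarrow> real \<Rightarrow> 'a" where
  "two_levels a b i = (if i = 0 then a else b)"

definition twist_graph :: "real \<Rightarrow> real \<Rightarrow> real" where
  "twist_graph = two_levels (\<lambda>x. \<bar>x\<bar> - 1/2) (\<lambda>x. 1/2 - \<bar>x\<bar>)"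

definition parallel_graph :: "real \<Rightarrow> real \<Rightarrow> real" where
  "parallel_graph = two_levels (\<lambda>x. 1/2) (\<lambda>x. - 1/2)"

definition end_positions :: "real \<Rightarrow> real" where
  "end_positions = two_levels (1/2) (- 1/2)"

lemma twist_strands_graphs: "twist_strands = graphs {0, 1} twist_graph"
  by (simp add: twist_strands_def graphs_def twist_graph_def two_levels_def Un_commute)

lemma parallel_strands_graphs: "strands parallel_strands = graphs {0, 1} parallel_graph"
  by (simp add: parallel_strands_def graphs_def parallel_graph_def two_levels_def Un_commute)

interpretation twist: graph_model "{0, 1}" twist_graph end_positions end_positions
proof
  show "\<bar>twist_graph i x\<bar> \<le> 1/2" if "\<bar>x\<bar> \<le> 1" for i x
    using that unfolding twist_graph_def two_levels_def by (auto simp: abs_if)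
qed (auto simp: twist_graph_def end_positions_def two_levels_def inj_on_def intro!: continuous_intros)

interpretation parallel: graph_model "{0, 1}" parallel_graph end_positions end_positions
  by unfold_locales
    (auto simp: parallel_graph_def end_positions_def two_levels_def inj_on_def intro!: continuous_intros)

definition twist_height :: "(plane \<Rightarrow> real) \<Rightarrow> (real \<Rightarrow> real) \<Rightarrow> (real \<Rightarrow> real) \<Rightarrow> space \<Rightarrow> real" where
  "twist_height e c c' = graph_height e (two_levels c c') end_positions end_positions"

text \<open>With constant heights at least 1/8 apart, the strands can be pulled past each other in
  the picture until they are parallel. Near the ends, where the heights are not under control, they
  are apart in the picture already.\<close>

lemma untwist:
  assumes e: "\<And>x. 0 < e x \<and> e x < 1" and ab: "0 < a" "a < 1" "0 < b" "b < 1" "1/8 \<le> \<bar>a - b\<bar>"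
  shows "linear_move (raise (twist_height e (\<lambda>_. a) (\<lambda>_. b)) (graphs {0, 1} twist_graph))
    (raise (twist_height e (\<lambda>_. a) (\<lambda>_. b)) (graphs {0, 1} parallel_graph))"
  unfolding twist_height_def
proof (rule twist.graph_motion[where a = "two_levels 1 (- 1)"])
  fix t i j x x' :: real
  assume t: "0 \<le> t" "t \<le> 1" and ij: "i \<in> {0, 1}" "j \<in> {0, 1}"
    "two_levels 1 (- 1 :: real) i \<noteq> two_levels 1 (- 1) j" and x: "\<bar>x\<bar> \<le> 1" "\<bar>x'\<bar> \<le> 1"
  \<comment> \<open>The position of strand 0 at time \<open>t\<close>; strand 1 is its mirror
    image.\<close>
  define h where "h x = \<bar>x\<bar> - 1/2 + t * (1 - \<bar>x\<bar>)" for x :: real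
  have h: "(twist_graph i x + t * (two_levels 1 (- 1) i * (1 - \<bar>x\<bar>))) - (twist_graph j x' + t * (two_levels 1 (- 1) j * (1 - \<bar>x'\<bar>)))
      = (if i = 0 then h x + h x' else - (h x + h x'))"
    using ij unfolding twist_graph_def two_levels_def h_def by (auto simp: algebra_simps)
  have pos: "\<bar>x\<bar> - 1/2 \<le> h x" if "\<bar>x\<bar> \<le> 1" for x unfolding h_def using t that by simp
  have levels: "\<bar>two_levels (\<lambda>_. a) (\<lambda>_. b) i x - two_levels (\<lambda>_. a) (\<lambda>_. b) j x'\<bar> = \<bar>a - b\<bar>"
    using ij unfolding two_levels_def by (auto simp: abs_minus_commute)
  show "1/8 \<le> \<bar>x - x'\<bar> \<or> 1/8 \<le> \<bar>(twist_graph i x + t * (two_levels 1 (- 1) i * (1 - \<bar>x\<bar>))) -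
      (twist_graph j x' + t * (two_levels 1 (- 1) j * (1 - \<bar>x'\<bar>)))\<bar> \<or>
      \<bar>x\<bar> \<le> 3/4 \<and> \<bar>x'\<bar> \<le> 3/4 \<and> 1/8 \<le> \<bar>two_levels (\<lambda>_. a) (\<lambda>_. b) i x - two_levels (\<lambda>_. a) (\<lambda>_. b) j x'\<bar>"
  proof (cases "\<bar>x\<bar> \<le> 3/4 \<and> \<bar>x'\<bar> \<le> 3/4 \<or> 1/8 \<le> \<bar>x - x'\<bar>")
    case True
    then show ?thesis using ab(5) unfolding levels by blast
  next
    case False
    \<comment> \<open>One abscissa exceeds 3/4 in absolute value and the other is within 1/8 of it,
      hence above 5/8.\<close>
    then have "5/4 \<le> \<bar>x\<bar> + \<bar>x'\<bar>" using x by linarith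
    then have "1/8 \<le> h x + h x'" using pos[OF x(1)] pos[OF x(2)] by linarith
    then show ?thesis unfolding h by auto
  qed
qed (use ab in \<open>auto simp: twist_graph_def parallel_graph_def two_levels_def abs_le_iff e intro!: continuous_intros\<close>)

text \<open>Parallel strands are at distance 1 in the picture, so their heights may change freely,
  and in particular pass each other.\<close>

lemma swap_levels:
  assumes e: "\<And>x. 0 < e x \<and> e x < 1" and ab: "0 < a" "a < 1" "0 < b" "b < 1" "0 < a'" "a' < 1" "0 < b'" "b' < 1"
  shows "linear_move (raise (twist_height e (\<lambda>_. a) (\<lambda>_. b)) (graphs {0, 1} parallel_graph))
    (raise (twist_height e (\<lambda>_. a') (\<lambda>_. b')) (graphs {0, 1} parallel_graph))"
proof -
  let ?K = "graphs {0, 1} parallel_graph"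
  define g where "g = twist_height e (\<lambda>_. a) (\<lambda>_. b)"
  define g' where "g' = twist_height e (\<lambda>_. a') (\<lambda>_. b')"
  have gc: "continuous_on ?K g" "continuous_on ?K g'"
    unfolding g_def g'_def twist_height_def
    by (rule parallel.continuous_on_graph_height; auto simp: two_levels_def intro!: continuous_intros)+
  have "0 < g k \<and> g k < 1" "0 < g' k \<and> g' k < 1" if "k \<in> ?K" for k
    unfolding g_def g'_def twist_height_def
    by (rule parallel.graph_height_unit[OF e _ that]; use ab in \<open>auto simp: two_levels_def\<close>)+
  then have gu: "\<forall>k\<in>?K. 0 < g k \<and> g k < 1" "\<forall>k\<in>?K. 0 < g' k \<and> g' k < 1" by blast+
  obtain m where m: "0 < m" "\<And>k. k \<in> ?K \<Longrightarrow> m \<le> g k \<and> g k \<le> 1 - m"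
    using unit_margin[OF parallel.compact_graphs gc(1) gu(1)] by blast
  obtain m' where m': "0 < m'" "\<And>k. k \<in> ?K \<Longrightarrow> m' \<le> g' k \<and> g' k \<le> 1 - m'"
    using unit_margin[OF parallel.compact_graphs gc(2) gu(2)] by blast
  define n where "n = min m m'"
  have n: "0 < n" "\<And>k. k \<in> ?K \<Longrightarrow> n \<le> g k \<and> g k \<le> 1 - n" "\<And>k. k \<in> ?K \<Longrightarrow> n \<le> g' k \<and> g' k \<le> 1 - n"
    using m m' unfolding n_def by fastforce+
  \<comment> \<open>The share of the chosen level in the height: 1 in the middle and 0 at the ends.
    The difference of the two height functions is a constant times this cutoff, which supplies the
    decay and the Lipschitz bound.\<close>
  define \<beta> where "\<beta> x = 1 - max 0 (4 * x - 3) - max 0 (- 4 * x - 3)" for x :: real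
  define d where "d i = two_levels (a' - a) (b' - b) i" for i
  have diff: "g' k - g k = d (snd k) * \<beta> (fst (fst k))" for k
    unfolding g_def g'_def twist_height_def graph_height_def level_def \<beta>_def d_def two_levels_def
    by (simp add: algebra_simps)
  have d: "\<bar>d i\<bar> \<le> 1" for i using ab unfolding d_def two_levels_def by auto
  have \<beta>: "0 \<le> \<beta> x" "\<beta> x \<le> 4 * (1 - \<bar>x\<bar>)" "\<beta> x \<le> 1" if "\<bar>x\<bar> \<le> 1" for x
    using that unfolding \<beta>_def by (auto simp: max_def abs_if)
  have \<beta>L: "\<bar>\<beta> x - \<beta> x'\<bar> \<le> 8 * \<bar>x - x'\<bar>" for x x' unfolding \<beta>_def by (auto simp: max_def abs_if)
  have K: "snd k \<in> {0, 1}" "\<bar>fst (fst k)\<bar> \<le> 1" "snd (fst k) = end_positions (snd k)" if "k \<in> ?K" for k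
    using that unfolding mem_graphs parallel_graph_def end_positions_def two_levels_def by (auto split: if_splits)
  define p where "p k = (fst k, g k)" for k
  define q where "q k = (fst k, g' k)" for k
  have v: "q k - p k = (0, d (snd k) * \<beta> (fst (fst k)))" for k
    unfolding p_def q_def by (simp add: diff)
  have pt: "p k + t *\<^sub>R (q k - p k) = ((fst (fst k), snd (fst k)), (1 - t) * g k + t * g' k)" for k t
    unfolding p_def q_def by (simp add: algebra_simps)
  have nv: "norm (((0 :: plane), s :: real)) = \<bar>s\<bar>" for s by (simp add: norm_Pair)
  have "linear_motion ?K p q" unfolding linear_motion_def
  \<comment> \<open>8 bounds the slope of the cutoff; the boundary estimate is used with decay rate
    4 and size 1.\<close>
  proof (rule exI[of _ "8 + (4 + 2 * 1 + 1 / n)"], intro ballI conjI allI impI)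
    fix t :: real and k assume t: "t \<in> {0..1}" and k: "k \<in> ?K"
    have C: "0 \<le> 1 / n" using n(1) by simp
    {
      fix k' assume k': "k' \<in> ?K"
      define D where "D = dist (p k + t *\<^sub>R (q k - p k)) (p k' + t *\<^sub>R (q k' - p k'))"
      have D: "\<bar>fst (fst k) - fst (fst k')\<bar> \<le> D" "\<bar>snd (fst k) - snd (fst k')\<bar> \<le> D"
        using abs_components_le_norm(1,2)[of "(p k + t *\<^sub>R (q k - p k)) - (p k' + t *\<^sub>R (q k' - p k'))"]
        unfolding D_def dist_norm pt by simp_all
      have "\<bar>d (snd k) * \<beta> (fst (fst k)) - d (snd k') * \<beta> (fst (fst k'))\<bar> \<le> 8 * D"
      proof (cases "snd k = snd k'")
        case True
        have "\<bar>d (snd k) * \<beta> (fst (fst k)) - d (snd k') * \<beta> (fst (fst k'))\<bar> = \<bar>d (snd k)\<bar> * \<bar>\<beta> (fst (fst k)) - \<beta> (fst (fst k'))\<bar>"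
          unfolding True abs_mult[symmetric] by (simp add: algebra_simps)
        also have "\<dots> \<le> 1 * (8 * \<bar>fst (fst k) - fst (fst k')\<bar>)" using d \<beta>L by (intro mult_mono) auto
        finally show ?thesis using D(1) by simp
      next
        case False
        have "1 \<le> D" using D(2) K(1,3)[OF k] K(1,3)[OF k'] False unfolding end_positions_def two_levels_def by auto
        moreover have "\<bar>d (snd k) * \<beta> (fst (fst k))\<bar> \<le> 1" "\<bar>d (snd k') * \<beta> (fst (fst k'))\<bar> \<le> 1"
          using d \<beta>[OF K(2)[OF k]] \<beta>[OF K(2)[OF k']] by (auto simp: abs_mult intro!: mult_le_one)
        ultimately show ?thesis by linarith
      qed
      also have "8 * D \<le> (8 + (4 + 2 * 1 + 1 / n)) * D"
        using C by (intro mult_right_mono) (auto simp: D_def)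
      finally show "norm ((q k - p k) - (q k' - p k')) \<le>
          (8 + (4 + 2 * 1 + 1 / n)) * dist (p k + t *\<^sub>R (q k - p k)) (p k' + t *\<^sub>R (q k' - p k'))"
        unfolding D_def[symmetric] unfolding v by (simp add: nv)
    next
      fix X assume X: "X \<notin> cell"
      have "norm (q k - p k) \<le> 1 * \<beta> (fst (fst k))"
        unfolding v nv abs_mult using d \<beta>[OF K(2)[OF k]] by (intro mult_mono) auto
      then have nvk: "norm (q k - p k) \<le> 4 * (1 - \<bar>fst (fst k)\<bar>)" "norm (q k - p k) \<le> 1"
        using \<beta>[OF K(2)[OF k]] by linarith+
      have "n \<le> (1 - t) * g k + t * g' k \<and> (1 - t) * g k + t * g' k \<le> 1 - n"
        using t n(2,3)[OF k] convex_bound_le[of "g k" "1 - n" "g' k" "1 - t" t]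
          convex_bound_le[of "- g k" "- n" "- g' k" "1 - t" t] by auto
      moreover have "\<bar>snd (fst k)\<bar> \<le> 1/2" using K(3)[OF k] unfolding end_positions_def two_levels_def by simp
      ultimately have "norm (q k - p k) \<le> (4 + 2 * 1 + 1 / n) * dist (p k + t *\<^sub>R (q k - p k)) X"
        unfolding pt by (intro cell_boundary_distance[OF X order_refl _ _ _ n(1) nvk]) auto
      also have "\<dots> \<le> (8 + (4 + 2 * 1 + 1 / n)) * dist (p k + t *\<^sub>R (q k - p k)) X"
        by (intro mult_right_mono) auto
      finally show "norm (q k - p k) \<le> (8 + (4 + 2 * 1 + 1 / n)) * dist (p k + t *\<^sub>R (q k - p k)) X" .
    }
  qed
  moreover have "raise g ?K = p ` ?K" "raise g' ?K = q ` ?K" unfolding raise_def p_def q_def by auto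
  ultimately show ?thesis unfolding linear_move_def g_def[symmetric] g'_def[symmetric] by blast
qed

lemma twist_heights:
  assumes N: "strands N = twist_strands" and e: "\<And>x. 0 < e x \<and> e x < 1"
    and c: "continuous_on {-1..1} c" "continuous_on {-1..1} c'"
      "\<And>x. \<bar>x\<bar> \<le> 1 \<Longrightarrow> 0 < c x \<and> c x < 1" "\<And>x. \<bar>x\<bar> \<le> 1 \<Longrightarrow> 0 < c' x \<and> c' x < 1"
    and order: "((-1/2, 0), 0) \<in> overs N \<longrightarrow> c' (-1/2) < c (-1/2)" "((1/2, 0), 0) \<in> overs N \<longrightarrow> c' (1/2) < c (1/2)"
      "((-1/2, 0), 1) \<in> overs N \<longrightarrow> c (-1/2) < c' (-1/2)" "((1/2, 0), 1) \<in> overs N \<longrightarrow> c (1/2) < c' (1/2)"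
  shows "model_heights e N (twist_height e c c')"
  unfolding twist_height_def
proof (rule twist.model_heights_graphs)
  show "strands N = graphs {0, 1} twist_graph" unfolding N by (rule twist_strands_graphs)
  fix i j x :: real
  assume ij: "i \<in> {0, 1}" "j \<in> {0, 1}" "i \<noteq> j" and eq: "twist_graph i x = twist_graph j x"
    and o: "((x, twist_graph i x), i) \<in> overs N"
  have "\<bar>x\<bar> = 1/2" using eq ij unfolding twist_graph_def two_levels_def by auto
  then have x: "x = -1/2 \<or> x = 1/2" and z: "twist_graph i x = 0" using ij unfolding twist_graph_def two_levels_def by auto
  show "\<bar>x\<bar> \<le> 3/4 \<and> two_levels c c' j x < two_levels c c' i x"
    using x
  proof
    assume x: "x = -1/2"
    show ?thesis using order(1,3) o ij unfolding z unfolding x two_levels_def by auto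
  next
    assume x: "x = 1/2"
    show ?thesis using order(2,4) o ij unfolding z unfolding x two_levels_def by auto
  qed
qed (use c e in \<open>auto simp: two_levels_def\<close>)

lemma parallel_heights:
  assumes e: "\<And>x. 0 < e x \<and> e x < 1" and ab: "0 < a" "a < 1" "0 < b" "b < 1" and N: "strands N = strands parallel_strands"
  shows "model_heights e N (twist_height e (\<lambda>_. a) (\<lambda>_. b))"
  unfolding twist_height_def
proof (rule parallel.model_heights_graphs)
  show "strands N = graphs {0, 1} parallel_graph" unfolding N by (rule parallel_strands_graphs)
qed (use e ab in \<open>auto simp: two_levels_def parallel_graph_def\<close>)

lemma resolved_over:
  assumes "k \<in> overs (resolve \<epsilon> D)" "k \<notin> overs D"
  shows "k \<in> prepoints D \<and> snd (marking D k) = \<epsilon> (fst (marking D k))"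
  using assms by simp

text \<open>Two strands only: if the other one is over at the point, the crossing is classical, and
  its strands are not prepoints.\<close>

lemma prepoint_twist:
  assumes "((x, 0), i) \<in> prepoints N" "strands N = twist_strands" "((x, 0), 1 - i) \<in> overs N"
  shows False
proof -
  obtain l where l: "l \<in> strands N" "((x, 0), i) \<noteq> l" "fst ((x, 0), i) = fst l" "l \<notin> overs N"
    and k: "((x, 0), i) \<in> strands N"
    using assms(1) unfolding prepoints_def by blast
  have "snd l \<in> {0, 1}" "i \<in> {0, 1}" using l(1) k unfolding assms(2) twist_strands_graphs mem_graphs by auto
  moreover have "snd l \<noteq> i" using l(2,3) by (auto simp: prod_eq_iff)
  ultimately have "l = ((x, 0), 1 - i)" using l(3) by (auto simp: prod_eq_iff)
  then show False using l(4) assms(3) by simp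
qed

text \<open>Strand 0 is over at both crossings, so it may be placed at the constant level 2/3 above
  strand 1 and the clasp pulled apart. Resolving adds nothing, as the model has no
  precrossing.\<close>

lemma R2_isotopic: "model_isotopic (resolve \<epsilon> clasp) (resolve \<epsilon> parallel_strands)"
  unfolding model_isotopic_def
proof (intro allI impI)
  fix e :: "plane \<Rightarrow> real" assume e: "\<forall>x. 0 < e x \<and> e x < 1"
  let ?g = "twist_height e (\<lambda>_. 2/3) (\<lambda>_. 1/3)"
  have no: "((x, 0), 1) \<notin> overs (resolve \<epsilon> clasp)" if "x \<in> {-1/2, 1/2}" for x
  proof
    assume "((x, 0), 1) \<in> overs (resolve \<epsilon> clasp)"
    moreover have "((x, 0), 1) \<notin> overs clasp" by (simp add: clasp_def)
    ultimately have "((x, 0), 1) \<in> prepoints clasp" using resolved_over by blast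
    then show False using prepoint_twist[of x 1 clasp] that by (auto simp: clasp_def)
  qed
  have "model_heights e (resolve \<epsilon> clasp) ?g"
    by (rule twist_heights) (use e no[of "-1/2"] no[of "1/2"] in \<open>auto simp: clasp_def\<close>)
  moreover have "model_heights e (resolve \<epsilon> parallel_strands) ?g"
    by (rule parallel_heights) (use e in auto)
  moreover have "linear_move (raise ?g (strands clasp)) (raise ?g (strands parallel_strands))"
    using untwist[of e "2/3" "1/3"] e unfolding parallel_strands_graphs by (simp add: clasp_def twist_strands_graphs)
  ultimately show "\<exists>g g'. model_heights e (resolve \<epsilon> clasp) g \<and> model_heights e (resolve \<epsilon> parallel_strands) g' \<and>
      linear_move\<^sup>*\<^sup>* (raise g (strands (resolve \<epsilon> clasp))) (raise g' (strands (resolve \<epsilon> parallel_strands)))"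
    unfolding resolve_simps(1) by blast
qed

text \<open>If the precrossing resolves with its descending strand over, both models become the same
  diagram and nothing moves. Otherwise strand 0 is over twice in one model and strand 1 twice in the
  other; both are clasps, joined by untwisting, exchanging levels and twisting again.\<close>

lemma PR2_isotopic: "model_isotopic (resolve \<epsilon> (twist_pre_right c b)) (resolve \<epsilon> (twist_pre_left c b))"
  (is "model_isotopic ?N ?N'")
  unfolding model_isotopic_def
proof (intro allI impI)
  fix e :: "plane \<Rightarrow> real" assume "\<forall>x. 0 < e x \<and> e x < 1"
  then have e: "\<And>x. 0 < e x \<and> e x < 1" by blast
  have S: "strands ?N = twist_strands" "strands ?N' = twist_strands"
    by (simp_all add: twist_pre_right_def twist_pre_left_def)
  have N: "((1/2, 0), i) \<in> overs ?N \<longrightarrow> (i = 1) = (b = \<epsilon> c)" "((-1/2, 0), i) \<in> overs ?N \<longrightarrow> i = 0"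
    if "i \<in> {0, 1}" for i
    using that prepoint_twist[of "-1/2" 1 "twist_pre_right c b"]
    by (auto simp: twist_pre_right_def mark_strand_def)
  have N': "((1/2, 0), i) \<in> overs ?N' \<longrightarrow> i = 1" "((-1/2, 0), i) \<in> overs ?N' \<longrightarrow> (i = 0) = (b = \<epsilon> c)"
    if "i \<in> {0, 1}" for i
    using that prepoint_twist[of "1/2" 0 "twist_pre_left c b"]
    by (auto simp: twist_pre_left_def mark_strand_def)
  show "\<exists>g g'. model_heights e ?N g \<and> model_heights e ?N' g' \<and> linear_move\<^sup>*\<^sup>* (raise g (strands ?N)) (raise g' (strands ?N'))"
  proof (cases "b = \<epsilon> c")
    case True
    \<comment> \<open>Strand 0 is over on the left and under on the right, so the heights are tilted
      and change order at the middle.\<close>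
    let ?g = "twist_height e (\<lambda>x. 1/2 - x/3) (\<lambda>x. 1/2 + x/3)"
    have "model_heights e ?N ?g"
      by (rule twist_heights[OF S(1) e])
        (use N[of 0] N[of 1] True in \<open>auto intro!: continuous_intros simp: abs_le_iff simp del: resolve_simps\<close>)
    moreover have "model_heights e ?N' ?g"
      by (rule twist_heights[OF S(2) e])
        (use N'[of 0] N'[of 1] True in \<open>auto intro!: continuous_intros simp: abs_le_iff simp del: resolve_simps\<close>)
    ultimately show ?thesis unfolding S by blast
  next
    case False
    let ?g = "twist_height e (\<lambda>x. 2/3) (\<lambda>x. 1/3)" and ?g' = "twist_height e (\<lambda>x. 1/3) (\<lambda>x. 2/3)"
    have "model_heights e ?N ?g"
      by (rule twist_heights[OF S(1) e]) (use N[of 0] N[of 1] False in \<open>auto simp del: resolve_simps\<close>)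
    moreover have "model_heights e ?N' ?g'"
      by (rule twist_heights[OF S(2) e]) (use N'[of 0] N'[of 1] False in \<open>auto simp del: resolve_simps\<close>)
    moreover have "linear_move\<^sup>*\<^sup>* (raise ?g twist_strands) (raise ?g' twist_strands)"
    proof -
      have u: "linear_move (raise ?g twist_strands) (raise ?g (strands parallel_strands))"
        "linear_move (raise ?g' twist_strands) (raise ?g' (strands parallel_strands))"
        "linear_move (raise ?g (strands parallel_strands)) (raise ?g' (strands parallel_strands))"
        unfolding twist_strands_graphs parallel_strands_graphs
        by (rule untwist swap_levels; simp add: e)+
      have "linear_move\<^sup>*\<^sup>* (raise ?g twist_strands) (raise ?g' (strands parallel_strands))"
        using u(1,3) by (rule converse_rtranclp_into_rtranclp[OF _ r_into_rtranclp])
      also have "linear_move\<^sup>*\<^sup>* (raise ?g' (strands parallel_strands)) (raise ?g' twist_strands)"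
        by (rule linear_moves_sym[OF r_into_rtranclp[of linear_move, OF u(2)]])
      finally show ?thesis .
    qed
    ultimately show ?thesis unfolding S by blast
  qed
qed

lemma box_model_twists:
  "box_model clasp" "box_model parallel_strands" "box_model (twist_pre_right c b)" "box_model (twist_pre_left c b)"
proof -
  show "box_model clasp" by (rule twist.box_model_graphs) (simp add: clasp_def twist_strands_graphs)
  show "box_model parallel_strands" by (rule parallel.box_model_graphs) (rule parallel_strands_graphs)
  show "box_model (twist_pre_right c b)" by (rule twist.box_model_graphs) (simp add: twist_pre_right_def twist_strands_graphs)
  show "box_model (twist_pre_left c b)" by (rule twist.box_model_graphs) (simp add: twist_pre_left_def twist_strands_graphs)
qed

subsection \<open>Triangles\<close>

definition three_levels :: "'a \<Rightarrow> 'a \<Rightarrow> 'a \<Rightarrow> real \<Rightarrow> 'a" where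
  "three_levels a b c i = (if i = 0 then a else if i = 1 then b else c)"

definition triangle_graph :: "real \<Rightarrow> real \<Rightarrow> real \<Rightarrow> real" where
  "triangle_graph \<sigma> = three_levels (\<lambda>x. x / 2) (\<lambda>x. - x / 2) (\<lambda>x. \<sigma> * (1 - \<bar>x\<bar>) / 2)"

lemma triangle_strands_graphs: "triangle_strands \<sigma> = graphs {0, 1, 2} (triangle_graph \<sigma>)"
  by (auto simp: triangle_strands_def graphs_def triangle_graph_def three_levels_def)

abbreviation triangle_left :: "real \<Rightarrow> real" where
  "triangle_left \<equiv> three_levels (- 1/2) (1/2) 0"

abbreviation triangle_right :: "real \<Rightarrow> real" where
  "triangle_right \<equiv> three_levels (1/2) (- 1/2) 0"

lemma triangle_graph_model:
  assumes "\<sigma> \<in> {1, - 1}"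
  shows "graph_model {0, 1, 2} (triangle_graph \<sigma>) triangle_left triangle_right"
proof
  show "\<bar>triangle_graph \<sigma> i x\<bar> \<le> 1/2" if "\<bar>x\<bar> \<le> 1" for i x
    using that assms unfolding triangle_graph_def three_levels_def by (auto simp: abs_if)
qed (auto simp: triangle_graph_def three_levels_def inj_on_def intro!: continuous_intros)

text \<open>Strand 2 lies above or below the other two, whose levels 2/5 and 3/5 are ordered by the
  crossing in the origin. Its gap to each of them is at least 1/5, more than the separation
  1/8.\<close>

definition triangle_levels :: "bool \<Rightarrow> real \<Rightarrow> real \<Rightarrow> real \<Rightarrow> real \<Rightarrow> real" where
  "triangle_levels upper a b = three_levels (\<lambda>_. a) (\<lambda>_. b) (\<lambda>_. if upper then 4/5 else 1/5)"

definition triangle_height :: "(plane \<Rightarrow> real) \<Rightarrow> bool \<Rightarrow> real \<Rightarrow> real \<Rightarrow> space \<Rightarrow> real" where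
  "triangle_height e upper a b = graph_height e (triangle_levels upper a b) triangle_left triangle_right"

text \<open>Only strand 2 moves, and it does so at a level of its own; the crossing of strands 0 and
  1 stays put. Near the ends strand 2 is close to the axis while the other strands are far from
  it.\<close>

lemma triangle_slide:
  assumes e: "\<And>x. 0 < e x \<and> e x < 1" and ab: "a \<in> {2/5, 3/5}" "b \<in> {2/5, 3/5}"
  shows "linear_move (raise (triangle_height e upper a b) (triangle_strands 1))
    (raise (triangle_height e upper a b) (triangle_strands (- 1)))"
  unfolding triangle_height_def triangle_strands_graphs
proof (rule graph_model.graph_motion[OF triangle_graph_model, where a = "three_levels 0 0 (- 1)"])
  fix t i j x x' :: real
  assume t: "0 \<le> t" "t \<le> 1" and ij: "i \<in> {0, 1, 2}" "j \<in> {0, 1, 2}"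
    "three_levels 0 0 (- 1 :: real) i \<noteq> three_levels 0 0 (- 1) j" and x: "\<bar>x\<bar> \<le> 1" "\<bar>x'\<bar> \<le> 1"
  define h where "h x = (1 - \<bar>x\<bar>) / 2 - t * (1 - \<bar>x\<bar>)" for x :: real
  have h: "\<bar>h x\<bar> \<le> (1 - \<bar>x\<bar>) / 2" if "\<bar>x\<bar> \<le> 1" for x
  proof -
    have "0 \<le> t * (1 - \<bar>x\<bar>)" "t * (1 - \<bar>x\<bar>) \<le> 1 - \<bar>x\<bar>"
      using t that by (simp_all add: mult_left_le_one_le)
    moreover have "\<bar>m / 2 - P\<bar> \<le> m / 2" if "0 \<le> P" "P \<le> m" for m P :: real using that by linarith
    ultimately show ?thesis unfolding h_def by blast
  qed
  have sep: "1/8 \<le> \<bar>u - u'\<bar> \<or> 1/8 \<le> \<bar>h u - y\<bar> \<or> \<bar>u\<bar> \<le> 3/4 \<and> \<bar>u'\<bar> \<le> 3/4"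
    if "\<bar>u\<bar> \<le> 1" "\<bar>u'\<bar> \<le> 1" "\<bar>y\<bar> = \<bar>u'\<bar> / 2" for u u' y
  proof (cases "1/8 \<le> \<bar>u - u'\<bar> \<or> \<bar>u\<bar> \<le> 3/4 \<and> \<bar>u'\<bar> \<le> 3/4")
    case False
    \<comment> \<open>Beyond 5/8 strand 2 has ordinate at most 3/16 and the others at least 5/16 in
      absolute value, so they differ by 1/8.\<close>
    then have "5/8 \<le> \<bar>u\<bar>" "5/8 \<le> \<bar>u'\<bar>" by linarith+
    moreover have "\<bar>y\<bar> - \<bar>h u\<bar> \<le> \<bar>h u - y\<bar>" by (rule abs_triangle_ineq2_sym)
    moreover have "\<bar>h u\<bar> \<le> 1/2 - \<bar>u\<bar> / 2" using h[OF that(1)] by (simp add: diff_divide_distrib)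
    ultimately have "1/8 \<le> \<bar>h u - y\<bar>" using that(3) by linarith
    then show ?thesis by blast
  qed blast
  have lev: "1/8 \<le> \<bar>(if upper then 4/5 else 1/5) - d\<bar>" "1/8 \<le> \<bar>d - (if upper then 4/5 else 1/5)\<bar>" if "d \<in> {a, b}" for d :: real
    using that ab by (auto simp: abs_if)
  consider "i = 2" "j \<in> {0, 1}" | "j = 2" "i \<in> {0, 1}" using ij unfolding three_levels_def by (auto split: if_splits)
  then show "1/8 \<le> \<bar>x - x'\<bar> \<or> 1/8 \<le> \<bar>(triangle_graph 1 i x + t * (three_levels 0 0 (- 1) i * (1 - \<bar>x\<bar>))) -
      (triangle_graph 1 j x' + t * (three_levels 0 0 (- 1) j * (1 - \<bar>x'\<bar>)))\<bar> \<or>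
      \<bar>x\<bar> \<le> 3/4 \<and> \<bar>x'\<bar> \<le> 3/4 \<and> 1/8 \<le> \<bar>triangle_levels upper a b i x - triangle_levels upper a b j x'\<bar>"
  proof cases
    case 1
    define y where "y = triangle_graph 1 j x'"
    have y: "\<bar>y\<bar> = \<bar>x'\<bar> / 2" using 1 unfolding y_def triangle_graph_def three_levels_def by auto
    have eq: "(triangle_graph 1 i x + t * (three_levels 0 0 (- 1) i * (1 - \<bar>x\<bar>))) -
      (triangle_graph 1 j x' + t * (three_levels 0 0 (- 1) j * (1 - \<bar>x'\<bar>))) = h x - y"
      using 1 unfolding y_def h_def triangle_graph_def three_levels_def by (auto simp: algebra_simps)
    have "1/8 \<le> \<bar>triangle_levels upper a b i x - triangle_levels upper a b j x'\<bar>"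
      using 1 lev(1)[of a] lev(1)[of b] unfolding triangle_levels_def three_levels_def by auto
    then show ?thesis using sep[OF x y] unfolding eq by blast
  next
    case 2
    define y where "y = triangle_graph 1 i x"
    have y: "\<bar>y\<bar> = \<bar>x\<bar> / 2" using 2 unfolding y_def triangle_graph_def three_levels_def by auto
    have eq: "(triangle_graph 1 i x + t * (three_levels 0 0 (- 1) i * (1 - \<bar>x\<bar>))) -
      (triangle_graph 1 j x' + t * (three_levels 0 0 (- 1) j * (1 - \<bar>x'\<bar>))) = - (h x' - y)"
      using 2 unfolding y_def h_def triangle_graph_def three_levels_def by (auto simp: algebra_simps)
    have "1/8 \<le> \<bar>triangle_levels upper a b i x - triangle_levels upper a b j x'\<bar>"
      using 2 lev(2)[of a] lev(2)[of b] unfolding triangle_levels_def three_levels_def by auto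
    then show ?thesis using sep[OF x(2,1) y] unfolding eq abs_minus_cancel abs_minus_commute[of x x'] by blast
  qed
next
  fix i x :: real assume "i \<in> {0, 1, 2}" "\<bar>x\<bar> \<le> 1"
  then show "triangle_graph (- 1) i x = triangle_graph 1 i x + three_levels 0 0 (- 1) i * (1 - \<bar>x\<bar>)"
    unfolding triangle_graph_def three_levels_def by (auto simp: field_simps)
  show "\<bar>triangle_graph (- 1) i x\<bar> \<le> 1/2"
    using \<open>\<bar>x\<bar> \<le> 1\<close> unfolding triangle_graph_def three_levels_def by (auto simp: abs_if split: if_splits)
  show "0 < triangle_levels upper a b i x \<and> triangle_levels upper a b i x < 1"
    using ab unfolding triangle_levels_def three_levels_def by auto
qed (auto simp: triangle_levels_def three_levels_def e intro!: continuous_intros)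

lemma triangle_heights:
  assumes \<sigma>: "\<sigma> \<in> {1, - 1}" and N: "strands N = triangle_strands \<sigma>" and e: "\<And>x. 0 < e x \<and> e x < 1"
    and ab: "a \<in> {2/5, 3/5}" "b \<in> {2/5, 3/5}"
    and order: "((\<sigma> / 2, \<sigma> / 4), 2) \<in> overs N \<longrightarrow> upper" "((- \<sigma> / 2, \<sigma> / 4), 2) \<in> overs N \<longrightarrow> upper"
      "((\<sigma> / 2, \<sigma> / 4), 0) \<in> overs N \<longrightarrow> \<not> upper" "((- \<sigma> / 2, \<sigma> / 4), 1) \<in> overs N \<longrightarrow> \<not> upper"
      "((0, 0), 0) \<in> overs N \<longrightarrow> b < a" "((0, 0), 1) \<in> overs N \<longrightarrow> a < b"
  shows "model_heights e N (triangle_height e upper a b)"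
  unfolding triangle_height_def
proof (rule graph_model.model_heights_graphs[OF triangle_graph_model[OF \<sigma>]])
  show "strands N = graphs {0, 1, 2} (triangle_graph \<sigma>)" unfolding N by (rule triangle_strands_graphs)
  show "0 < e x \<and> e x < 1" for x by (rule e)
  show "continuous_on {-1..1} (triangle_levels upper a b i)" for i
    unfolding triangle_levels_def three_levels_def by (auto intro!: continuous_intros)
  show "0 < triangle_levels upper a b i x \<and> triangle_levels upper a b i x < 1" for i x
    using ab unfolding triangle_levels_def three_levels_def by auto
  fix i j x :: real
  assume ij: "i \<in> {0, 1, 2}" "j \<in> {0, 1, 2}" "i \<noteq> j" and x: "\<bar>x\<bar> \<le> 1" and eq: "triangle_graph \<sigma> i x = triangle_graph \<sigma> j x"
    and o: "((x, triangle_graph \<sigma> i x), i) \<in> overs N"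
  have t0: "triangle_graph \<sigma> 0 x = x / 2" "triangle_graph \<sigma> 1 x = - x / 2" "triangle_graph \<sigma> 2 x = \<sigma> * (1 - \<bar>x\<bar>) / 2"
    unfolding triangle_graph_def three_levels_def by auto
  have x02: "x = \<sigma> / 2" if "x / 2 = \<sigma> * (1 - \<bar>x\<bar>) / 2" using that \<sigma> x by (auto simp: abs_if split: if_splits)
  have x12: "x = - \<sigma> / 2" if "- x / 2 = \<sigma> * (1 - \<bar>x\<bar>) / 2" using that \<sigma> x by (auto simp: abs_if split: if_splits)
  have s: "\<bar>\<sigma> / 2\<bar> \<le> 3/4" "\<bar>- \<sigma> / 2\<bar> \<le> 3/4" "\<sigma> * (1 - \<bar>\<sigma> / 2\<bar>) / 2 = \<sigma> / 4" "\<sigma> * (1 - \<bar>- \<sigma> / 2\<bar>) / 2 = \<sigma> / 4"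
    "\<sigma> / 2 / 2 = \<sigma> / 4" "- (- \<sigma> / 2) / 2 = \<sigma> / 4"
    using \<sigma> by auto
  have lev: "triangle_levels upper a b 0 x = a" "triangle_levels upper a b 1 x = b"
    "triangle_levels upper a b 2 x = (if upper then 4/5 else 1/5)"
    unfolding triangle_levels_def three_levels_def by auto
  have lt: "a < 4/5" "b < 4/5" "1/5 < a" "1/5 < b" using ab by auto
  consider "i = 0" "j = 1" | "i = 1" "j = 0" | "i = 0" "j = 2" | "i = 2" "j = 0" | "i = 1" "j = 2" | "i = 2" "j = 1"
    using ij by auto
  then show "\<bar>x\<bar> \<le> 3/4 \<and> triangle_levels upper a b j x < triangle_levels upper a b i x"
  proof cases
    case 1
    then have "x = 0" using eq t0 by simp
    then show ?thesis using o order(5) 1 t0 lev by simp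
  next
    case 2
    then have "x = 0" using eq t0 by simp
    then show ?thesis using o order(6) 2 t0 lev by simp
  next
    case 3
    then have x: "x = \<sigma> / 2" using eq t0 x02 by simp
    have "((\<sigma> / 2, \<sigma> / 4), 0) \<in> overs N" using o unfolding 3 t0 unfolding x s .
    then show ?thesis using order(3) lt s(1) unfolding 3 lev unfolding x by simp
  next
    case 4
    then have x: "x = \<sigma> / 2" using eq t0 x02 by simp
    have "((\<sigma> / 2, \<sigma> / 4), 2) \<in> overs N" using o unfolding 4 t0 unfolding x s .
    then show ?thesis using order(1) lt s(1) unfolding 4 lev unfolding x by simp
  next
    case 5
    then have x: "x = - \<sigma> / 2" using eq t0 x12 by simp
    have "((- \<sigma> / 2, \<sigma> / 4), 1) \<in> overs N" using o unfolding 5 t0 unfolding x s .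
    then show ?thesis using order(4) lt s(2) unfolding 5 lev unfolding x by simp
  next
    case 6
    then have x: "x = - \<sigma> / 2" using eq t0 x12 by simp
    have "((- \<sigma> / 2, \<sigma> / 4), 2) \<in> overs N" using o unfolding 6 t0 unfolding x s .
    then show ?thesis using order(2) lt s(2) unfolding 6 lev unfolding x by simp
  qed
qed

lemma prepoint_triangle:
  assumes N: "strands N = triangle_strands \<sigma>" and k: "((x, y), i) \<in> prepoints N"
  shows "\<exists>j\<in>{0, 1, 2}. j \<noteq> i \<and> triangle_graph \<sigma> j x = y \<and> ((x, y), j) \<notin> overs N"
proof -
  obtain l where l: "l \<in> strands N" "((x, y), i) \<noteq> l" "fst ((x, y), i) = fst l" "l \<notin> overs N"
    using k unfolding prepoints_def by blast
  have fl: "fst l = (x, y)" using l(3) by simp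
  have "snd l \<in> {0, 1, 2}" "triangle_graph \<sigma> (snd l) x = y"
    using l(1) unfolding N triangle_strands_graphs mem_graphs fl by auto
  moreover have "snd l \<noteq> i" using l(2) fl by (auto simp: prod_eq_iff)
  moreover have "((x, y), snd l) \<notin> overs N" using l(4) fl by (metis prod.collapse)
  ultimately show ?thesis by blast
qed

text \<open>At the two crossings of strand 2 an over strand is prescribed by
  \<open>slide_overs\<close>, so they are no precrossings and resolving puts no further strand on
  top there.\<close>

lemma triangle_resolved:
  assumes \<sigma>: "\<sigma> \<in> {1, - 1}" and M: "strands M = triangle_strands \<sigma>" "slide_overs upper \<sigma> \<subseteq> overs M"
    "overs M \<subseteq> insert ((0, 0), 0) (slide_overs upper \<sigma>)"
  shows "((\<sigma> / 2, \<sigma> / 4), 2) \<in> overs (resolve \<epsilon> M) \<longrightarrow> upper" "((- \<sigma> / 2, \<sigma> / 4), 2) \<in> overs (resolve \<epsilon> M) \<longrightarrow> upper"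
      "((\<sigma> / 2, \<sigma> / 4), 0) \<in> overs (resolve \<epsilon> M) \<longrightarrow> \<not> upper" "((- \<sigma> / 2, \<sigma> / 4), 1) \<in> overs (resolve \<epsilon> M) \<longrightarrow> \<not> upper"
proof -
  have o: "k \<in> overs (resolve \<epsilon> M) \<Longrightarrow> k \<notin> insert ((0, 0), 0) (slide_overs upper \<sigma>) \<Longrightarrow> k \<in> prepoints M" for k
    using M(3) resolved_over by blast
  have notin: "k \<notin> overs M \<Longrightarrow> k \<notin> slide_overs upper \<sigma>" for k using M(2) by blast
  note p = prepoint_triangle[OF M(1)]
  show "((\<sigma> / 2, \<sigma> / 4), 2) \<in> overs (resolve \<epsilon> M) \<longrightarrow> upper"
    using o[of "((\<sigma> / 2, \<sigma> / 4), 2)"] p[of "\<sigma> / 2" "\<sigma> / 4" 2] notin[of "((\<sigma> / 2, \<sigma> / 4), 0)"] \<sigma>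
    by (cases upper) (auto simp: slide_overs_def triangle_graph_def three_levels_def simp del: resolve_simps)
  show "((- \<sigma> / 2, \<sigma> / 4), 2) \<in> overs (resolve \<epsilon> M) \<longrightarrow> upper"
    using o[of "((- \<sigma> / 2, \<sigma> / 4), 2)"] p[of "- \<sigma> / 2" "\<sigma> / 4" 2] notin[of "((- \<sigma> / 2, \<sigma> / 4), 1)"] \<sigma>
    by (cases upper) (auto simp: slide_overs_def triangle_graph_def three_levels_def simp del: resolve_simps)
  show "((\<sigma> / 2, \<sigma> / 4), 0) \<in> overs (resolve \<epsilon> M) \<longrightarrow> \<not> upper"
    using o[of "((\<sigma> / 2, \<sigma> / 4), 0)"] p[of "\<sigma> / 2" "\<sigma> / 4" 0] notin[of "((\<sigma> / 2, \<sigma> / 4), 2)"] \<sigma>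
    by (cases upper) (auto simp: slide_overs_def triangle_graph_def three_levels_def simp del: resolve_simps)
  show "((- \<sigma> / 2, \<sigma> / 4), 1) \<in> overs (resolve \<epsilon> M) \<longrightarrow> \<not> upper"
    using o[of "((- \<sigma> / 2, \<sigma> / 4), 1)"] p[of "- \<sigma> / 2" "\<sigma> / 4" 1] notin[of "((- \<sigma> / 2, \<sigma> / 4), 2)"] \<sigma>
    by (cases upper) (auto simp: slide_overs_def triangle_graph_def three_levels_def simp del: resolve_simps)
qed

lemma triangle_isotopic:
  fixes a b :: real
  assumes M: "strands M = triangle_strands 1" "slide_overs upper 1 \<subseteq> overs M"
      "overs M \<subseteq> insert ((0, 0), 0) (slide_overs upper 1)"
    and M': "strands M' = triangle_strands (- 1)" "slide_overs upper (- 1) \<subseteq> overs M'"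
      "overs M' \<subseteq> insert ((0, 0), 0) (slide_overs upper (- 1))"
    and ab: "a \<in> {2/5, 3/5}" "b \<in> {2/5, 3/5}"
    and o: "((0, 0), 0) \<in> overs (resolve \<epsilon> M) \<longrightarrow> b < a" "((0, 0), 1) \<in> overs (resolve \<epsilon> M) \<longrightarrow> a < b"
    and o': "((0, 0), 0) \<in> overs (resolve \<epsilon> M') \<longrightarrow> b < a" "((0, 0), 1) \<in> overs (resolve \<epsilon> M') \<longrightarrow> a < b"
  shows "model_isotopic (resolve \<epsilon> M) (resolve \<epsilon> M')"
  unfolding model_isotopic_def
proof (intro allI impI)
  fix e :: "plane \<Rightarrow> real" assume "\<forall>x. 0 < e x \<and> e x < 1"
  then have e: "\<And>x. 0 < e x \<and> e x < 1" by blast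
  let ?g = "triangle_height e upper a b"
  have "1 \<in> {1, - 1 :: real}" "- 1 \<in> {1, - 1 :: real}" by auto
  note r = triangle_resolved[OF this(1) M, of \<epsilon>] and r' = triangle_resolved[OF this(2) M', of \<epsilon>]
  have "model_heights e (resolve \<epsilon> M) ?g"
    by (rule triangle_heights[OF _ _ e ab r o]) (simp_all add: M)
  moreover have "model_heights e (resolve \<epsilon> M') ?g"
    by (rule triangle_heights[OF _ _ e ab r' o']) (simp_all add: M')
  moreover have "linear_move (raise ?g (strands (resolve \<epsilon> M))) (raise ?g (strands (resolve \<epsilon> M')))"
    unfolding resolve_simps(1) M(1) M'(1) by (rule triangle_slide[OF e ab])
  ultimately show "\<exists>g g'. model_heights e (resolve \<epsilon> M) g \<and> model_heights e (resolve \<epsilon> M') g' \<and>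
      linear_move\<^sup>*\<^sup>* (raise g (strands (resolve \<epsilon> M))) (raise g' (strands (resolve \<epsilon> M')))"
    by blast
qed

lemma R3_isotopic: "model_isotopic (resolve \<epsilon> (classical_triangle upper 1)) (resolve \<epsilon> (classical_triangle upper (- 1)))"
\<comment> \<open>Strand 0 is over strand 1 in the origin on both sides of the move, hence it gets
  the higher level.\<close>
proof (rule triangle_isotopic[where upper = upper and a = "3/5" and b = "2/5"])
  have "((0, 0), 1) \<notin> overs (resolve \<epsilon> (classical_triangle upper \<sigma>))" if \<sigma>: "\<sigma> \<in> {1, - 1}" for \<sigma>
    using prepoint_triangle[of "classical_triangle upper \<sigma>" \<sigma> 0 0 1] \<sigma>
    by (auto simp: classical_triangle_def slide_overs_def triangle_graph_def three_levels_def)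
  then show "((0, 0), 1) \<in> overs (resolve \<epsilon> (classical_triangle upper 1)) \<longrightarrow> 3/5 < (2/5 :: real)"
    "((0, 0), 1) \<in> overs (resolve \<epsilon> (classical_triangle upper (- 1))) \<longrightarrow> 3/5 < (2/5 :: real)"
    by (simp_all del: resolve_simps)
qed (auto simp: classical_triangle_def)

text \<open>The type chosen for the precrossing puts the same strand on top before and after the
  slide, so one pair of levels serves both. The parameter \<open>upper\<close> covers both versions
  of the move.\<close>

lemma PR3_isotopic: "model_isotopic (resolve \<epsilon> (pre_triangle c b upper 1)) (resolve \<epsilon> (pre_triangle c b upper (- 1)))"
proof -
  let ?N = "\<lambda>\<sigma>. resolve \<epsilon> (pre_triangle c b upper \<sigma>)"
  have o: "((0, 0), 0) \<in> overs (?N \<sigma>) \<longrightarrow> b = \<epsilon> c" "((0, 0), 1) \<in> overs (?N \<sigma>) \<longrightarrow> b \<noteq> \<epsilon> c"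
    if "\<sigma> \<in> {1, - 1}" for \<sigma>
    using that by (auto simp: pre_triangle_def slide_overs_def mark_strand_def)
  have s: "strands (pre_triangle c b upper \<sigma>) = triangle_strands \<sigma>" "slide_overs upper \<sigma> \<subseteq> overs (pre_triangle c b upper \<sigma>)"
    "overs (pre_triangle c b upper \<sigma>) \<subseteq> insert ((0, 0), 0) (slide_overs upper \<sigma>)" for \<sigma>
    by (auto simp: pre_triangle_def)
  have 1: "1 \<in> {1, - 1 :: real}" "- 1 \<in> {1, - 1 :: real}" by auto
  show ?thesis
  proof (cases "b = \<epsilon> c")
    case True
    show ?thesis
      by (rule triangle_isotopic[where a = "3/5" and b = "2/5", OF s s])
        (use o[OF 1(1)] o[OF 1(2)] True in \<open>simp_all del: resolve_simps\<close>)
  next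
    case False
    show ?thesis
      by (rule triangle_isotopic[where a = "2/5" and b = "3/5", OF s s])
        (use o[OF 1(1)] o[OF 1(2)] False in \<open>simp_all del: resolve_simps\<close>)
  qed
qed

lemma box_model_triangles:
  assumes "\<sigma> \<in> {1, - 1}"
  shows "box_model (classical_triangle upper \<sigma>)" "box_model (pre_triangle c b upper \<sigma>)"
  using graph_model.box_model_graphs[OF triangle_graph_model[OF assms]]
  by (simp_all add: classical_triangle_def pre_triangle_def triangle_strands_graphs)

subsection \<open>Kinks\<close>

lemma mem_kink: "k \<in> kink \<longleftrightarrow> \<bar>snd k\<bar> \<le> 1 \<and> fst k = (2 * snd k ^ 3 - snd k, (1 - (snd k)\<^sup>2) / 2)"
proof -
  obtain a b c where k: "k = ((a, b), c)" by (cases k) auto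
  show ?thesis unfolding kink_def k by auto
qed

text \<open>Equal ordinates force opposite parameters. The abscissa is an odd function of the
  parameter, so it must vanish, and the nonzero roots of \<open>2 * s ^ 3 - s\<close> have square
  1/2.\<close>

lemma kink_double:
  assumes "k \<in> kink" "l \<in> kink" "k \<noteq> l" "fst k = fst l"
  shows "snd l = - snd k" "(snd k)\<^sup>2 = 1/2"
proof -
  have f: "2 * snd k ^ 3 - snd k = 2 * snd l ^ 3 - snd l" "(snd k)\<^sup>2 = (snd l)\<^sup>2"
    using assms unfolding mem_kink by auto
  have ne: "snd l \<noteq> snd k" using assms(3,4) by (auto simp: prod_eq_iff)
  show l: "snd l = - snd k" using f(2) ne by (auto simp: power2_eq_iff)
  have "snd k * (2 * (snd k)\<^sup>2 - 1) = 0" using f(1) unfolding l by (simp add: power2_eq_square power3_eq_cube algebra_simps)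
  moreover have "snd k \<noteq> 0" using l ne by simp
  ultimately show "(snd k)\<^sup>2 = 1/2" by simp
qed

text \<open>Keeps the straight path from the cubic arc to the segment within distance
  \<open>\<bar>s\<bar>\<close> of the centre line, so that the distance to the ends of the box is
  controlled by the parameter.\<close>

lemma kink_x_bound:
  fixes s :: real
  assumes "\<bar>s\<bar> \<le> 1"
  shows "\<bar>2 * s ^ 3 - s\<bar> \<le> \<bar>s\<bar>"
proof -
  have "s\<^sup>2 \<le> 1" using assms by (simp add: abs_square_le_1)
  then have "\<bar>2 * s\<^sup>2 - 1\<bar> \<le> 1" using zero_le_power2[of s] by (simp add: abs_le_iff)
  then have "\<bar>s\<bar> * \<bar>2 * s\<^sup>2 - 1\<bar> \<le> \<bar>s\<bar> * 1" by (intro mult_left_mono) auto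
  moreover have "2 * s ^ 3 - s = s * (2 * s\<^sup>2 - 1)" by (simp add: power2_eq_square power3_eq_cube algebra_simps)
  ultimately show ?thesis by (simp add: abs_mult)
qed

text \<open>The height is linear in the parameter, with \<delta> deciding which branch is over at
  the node. The ramps to the edge heights begin only at 9/10, because the node sits at the
  parameters with absolute value \<open>1 / sqrt 2\<close>, which exceeds 7/10.\<close>

definition kink_level :: "(plane \<Rightarrow> real) \<Rightarrow> real \<Rightarrow> real \<Rightarrow> real" where
  "kink_level e \<delta> s = (1/2 + \<delta> * s / 4) + max 0 (10 * s - 9) * (e (1, 0) - (1/2 + \<delta> * s / 4)) +
     max 0 (- 10 * s - 9) * (e (- 1, 0) - (1/2 + \<delta> * s / 4))"

lemma kink_level_middle: "\<bar>s\<bar> \<le> 9/10 \<Longrightarrow> kink_level e \<delta> s = 1/2 + \<delta> * s / 4"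
  unfolding kink_level_def by (subst (1 2) max_absorb1) (auto simp: abs_le_iff)

lemma kink_level_unit:
  assumes "\<And>x. 0 < e x \<and> e x < 1" "\<delta> \<in> {1, - 1}" "\<bar>s\<bar> \<le> 1"
  shows "0 < kink_level e \<delta> s \<and> kink_level e \<delta> s < 1"
proof -
  have b: "0 < 1/2 + \<delta> * s / 4" "1/2 + \<delta> * s / 4 < 1" using assms(2,3) by auto
  show ?thesis
  proof (cases "0 \<le> s")
    case True
    then have "kink_level e \<delta> s = (1/2 + \<delta> * s / 4) + max 0 (10 * s - 9) * (e (1, 0) - (1/2 + \<delta> * s / 4))"
      unfolding kink_level_def by simp
    then show ?thesis using convex_unit[OF b, of "e (1, 0)" "max 0 (10 * s - 9)"] assms by simp
  next
    case False
    then have "kink_level e \<delta> s = (1/2 + \<delta> * s / 4) + max 0 (- 10 * s - 9) * (e (- 1, 0) - (1/2 + \<delta> * s / 4))"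
      unfolding kink_level_def by simp
    then show ?thesis using convex_unit[OF b, of "e (- 1, 0)" "max 0 (- 10 * s - 9)"] assms by simp
  qed
qed

lemma kink_boundary:
  assumes "k \<in> kink" "fst k \<notin> open_box"
  shows "snd k = 1 \<and> fst k = (1, 0) \<or> snd k = - 1 \<and> fst k = (- 1, 0)"
proof -
  have k: "\<bar>snd k\<bar> \<le> 1" "fst k = (2 * snd k ^ 3 - snd k, (1 - (snd k)\<^sup>2) / 2)" using assms(1) unfolding mem_kink by auto
  define y where "y = (1 - (snd k)\<^sup>2) / 2"
  have "0 \<le> y" "y \<le> 1/2" using k(1) unfolding y_def by (simp_all add: abs_square_le_1)
  then have "- 1 < y" "y < 1" by simp_all
  then have "\<not> \<bar>2 * snd k ^ 3 - snd k\<bar> < 1" using assms(2) unfolding k(2) open_box_def y_def[symmetric] by (auto simp: abs_less_iff)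
  then have "snd k = 1 \<or> snd k = - 1" using kink_x_bound[OF k(1)] k(1) by linarith
  then show ?thesis using k(2) by auto
qed

lemma compact_kink: "compact kink"
proof -
  have eq: "kink = (\<lambda>s. ((2 * s ^ 3 - s, (1 - s\<^sup>2) / 2), s)) ` {-1..1}" unfolding kink_def by (rule Setcompr_eq_image)
  have c: "continuous_on {-1..1::real} (\<lambda>s. ((2 * s ^ 3 - s, (1 - s\<^sup>2) / 2), s))"
    by (intro continuous_intros; simp)
  show ?thesis unfolding eq by (rule compact_continuous_image[OF c compact_Icc])
qed

lemma box_model_kink:
  assumes "strands N = kink"
  shows "box_model N"
  unfolding box_model_def assms
proof
  show "fst ` kink \<subseteq> box"
  proof (rule image_subsetI)
    fix k assume "k \<in> kink"
    then have k: "\<bar>snd k\<bar> \<le> 1" "fst k = (2 * snd k ^ 3 - snd k, (1 - (snd k)\<^sup>2) / 2)" unfolding mem_kink by auto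
    define y where "y = (1 - (snd k)\<^sup>2) / 2"
    have "0 \<le> y" "y \<le> 1/2" using k(1) unfolding y_def by (simp_all add: abs_square_le_1)
    moreover have "\<bar>2 * snd k ^ 3 - snd k\<bar> \<le> 1" using kink_x_bound[OF k(1)] k(1) by linarith
    ultimately show "fst k \<in> box" unfolding k(2) box_def y_def[symmetric] by (simp add: abs_le_iff)
  qed
  show "inj_on fst {k \<in> kink. fst k \<notin> open_box}"
  proof (rule inj_onI)
    fix k l assume "k \<in> {k \<in> kink. fst k \<notin> open_box}" "l \<in> {k \<in> kink. fst k \<notin> open_box}" and eq: "fst k = fst l"
    then have "k \<in> kink" "fst k \<notin> open_box" "l \<in> kink" "fst l \<notin> open_box" by blast+
    then have "snd k = 1 \<and> fst k = (1, 0) \<or> snd k = - 1 \<and> fst k = (- 1, 0)"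
      "snd l = 1 \<and> fst l = (1, 0) \<or> snd l = - 1 \<and> fst l = (- 1, 0)" using kink_boundary by blast+
    then have "snd k = snd l" using eq by (elim disjE conjE) simp_all
    then show "k = l" using eq by (rule prod_eqI[rotated])
  qed
qed

lemma straight_graphs: "strands straight = graphs {0} (\<lambda>i x. 0)"
  by (simp add: straight_def graphs_def)

interpretation straight_line: graph_model "{0}" "\<lambda>i x. 0" "\<lambda>_. 0" "\<lambda>_. 0"
  by unfold_locales auto

lemma box_model_straight: "box_model straight"
  by (rule straight_line.box_model_graphs) (rule straight_graphs)

lemma kink_heights:
  assumes N: "strands N = kink" and e: "\<And>x. 0 < e x \<and> e x < 1" and \<delta>: "\<delta> \<in> {1, - 1}"
    and order: "\<And>k. k \<in> kink \<Longrightarrow> (snd k)\<^sup>2 = 1/2 \<Longrightarrow> k \<in> overs N \<Longrightarrow> 0 < \<delta> * snd k"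
  shows "model_heights e N (\<lambda>k. kink_level e \<delta> (snd k))"
  unfolding model_heights_def heights_def N
proof (intro conjI ballI impI)
  show "continuous_on kink (\<lambda>k. kink_level e \<delta> (snd k))" unfolding kink_level_def by (intro continuous_intros) auto
  fix k assume k: "k \<in> kink"
  have "\<bar>snd k\<bar> \<le> 1" using k unfolding mem_kink by simp
  from kink_level_unit[OF e \<delta> this] show "0 < kink_level e \<delta> (snd k)" "kink_level e \<delta> (snd k) < 1" by auto
  show "kink_level e \<delta> (snd k) = e (fst k)" if "fst k \<notin> open_box"
    using kink_boundary[OF k that] unfolding kink_level_def by auto
  fix l assume l: "l \<in> kink" and kl: "k \<noteq> l \<and> fst k = fst l \<and> k \<in> overs N"
  note d = kink_double[OF k l]
  have s: "snd l = - snd k" "(snd k)\<^sup>2 = 1/2" using d kl by auto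
  have "\<bar>snd k\<bar> \<le> 9/10"
    by (rule power2_le_imp_le) (simp_all add: s(2) power2_eq_square[of "9/10"])
  then have "kink_level e \<delta> (snd k) = 1/2 + \<delta> * snd k / 4" "kink_level e \<delta> (snd l) = 1/2 - \<delta> * snd k / 4"
    using kink_level_middle[of "snd k" e \<delta>] kink_level_middle[of "snd l" e \<delta>] s(1) by auto
  moreover have "0 < \<delta> * snd k" using order[OF k s(2)] kl by blast
  ultimately show "kink_level e \<delta> (snd l) < kink_level e \<delta> (snd k)" by simp
qed

lemma straight_heights:
  assumes N: "strands N = strands straight" and e: "\<And>x. 0 < e x \<and> e x < 1" and \<delta>: "\<delta> \<in> {1, - 1}"
  shows "model_heights e N (\<lambda>k. kink_level e \<delta> (fst (fst k)))"
  unfolding model_heights_def heights_def N straight_graphs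
proof (intro conjI ballI impI)
  show "continuous_on (graphs {0} (\<lambda>i x. 0)) (\<lambda>k. kink_level e \<delta> (fst (fst k)))"
    unfolding kink_level_def by (intro continuous_intros) auto
  fix k assume k: "k \<in> graphs {0} (\<lambda>i x. 0)"
  have "\<bar>fst (fst k)\<bar> \<le> 1" using k unfolding mem_graphs by simp
  from kink_level_unit[OF e \<delta> this] show "0 < kink_level e \<delta> (fst (fst k))" "kink_level e \<delta> (fst (fst k)) < 1" by auto
  show "kink_level e \<delta> (fst (fst k)) = e (fst k)" if "fst k \<notin> open_box"
    using straight_line.boundary_cases[OF k that] unfolding kink_level_def by auto
  fix l assume l: "l \<in> graphs {0} (\<lambda>i x. 0)" and kl: "k \<noteq> l \<and> fst k = fst l \<and> k \<in> overs N"
  have "snd k = snd l" using k l unfolding mem_graphs by simp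
  then have "k = l" using kl by (intro prod_eqI) auto
  then show "kink_level e \<delta> (fst (fst l)) < kink_level e \<delta> (fst (fst k))" using kl by blast
qed

text \<open>Near the ends the heights depend on \<open>e\<close> and separate nothing, so the
  abscissa has to. Its values along the straight path to the segment are estimated by a difference
  quotient if both parameters are large, and by crude bounds otherwise.\<close>

lemma kink_path_separation:
  fixes s s' t :: real
  assumes s: "\<bar>s\<bar> \<le> 1" "\<bar>s'\<bar> \<le> 1" and t: "0 \<le> t" "t \<le> 1" and far: "9/10 < s"
  shows "\<bar>s - s'\<bar> \<le> 8 * \<bar>((1 - t) * (2 * s ^ 3 - s) + t * s) - ((1 - t) * (2 * s' ^ 3 - s') + t * s')\<bar>"
proof (cases "3/5 \<le> s'")
  case True
  \<comment> \<open>The difference quotient of \<open>2 * s ^ 3 - s\<close>, which is at least 1 in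
    this range.\<close>
  define D where "D = 2 * (s\<^sup>2 + s * s' + s'\<^sup>2) - 1"
  have "(9/10)\<^sup>2 \<le> s\<^sup>2" "(3/5)\<^sup>2 \<le> s'\<^sup>2" using far True by (auto intro!: power_mono)
  moreover have "9/10 * (3/5) \<le> s * s'" by (rule mult_mono) (use far True in simp_all)
  ultimately have D: "1 \<le> D" unfolding D_def by (simp add: power2_eq_square)
  have eq: "((1 - t) * (2 * s ^ 3 - s) + t * s) - ((1 - t) * (2 * s' ^ 3 - s') + t * s') = (s - s') * ((1 - t) * D + t)"
    unfolding D_def by (simp add: power2_eq_square power3_eq_cube algebra_simps)
  have "(1 - t) * 1 \<le> (1 - t) * D" using t D by (intro mult_left_mono) auto
  then have "1 \<le> (1 - t) * D + t" by simp
  then have "\<bar>s - s'\<bar> * 1 \<le> \<bar>s - s'\<bar> * \<bar>(1 - t) * D + t\<bar>" by (intro mult_left_mono) auto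
  moreover have "P \<le> 8 * Q" if "P * 1 \<le> Q" "0 \<le> P" for P Q :: real using that by linarith
  ultimately show ?thesis unfolding eq abs_mult using abs_ge_zero by blast
next
  case False
  have u: "11/20 \<le> 2 * s ^ 3 - s"
  proof -
    have "(9/10)\<^sup>2 \<le> s\<^sup>2" using far by (auto intro!: power_mono)
    then have "31/50 \<le> 2 * s\<^sup>2 - 1" by (simp add: power2_eq_square)
    then have "9/10 * (31/50) \<le> s * (2 * s\<^sup>2 - 1)" using far by (intro mult_mono) auto
    then show ?thesis by (simp add: power2_eq_square power3_eq_cube algebra_simps)
  qed
  have u': "2 * s' ^ 3 - s' \<le> 3/10"
  proof (cases "0 \<le> s'")
    case True
    have "s'\<^sup>2 \<le> (3/5)\<^sup>2" using False True by (intro power_mono) auto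
    then have "2 * s'\<^sup>2 - 1 \<le> 0" by (simp add: power2_eq_square)
    then have "s' * (2 * s'\<^sup>2 - 1) \<le> 0" using True by (rule mult_nonneg_nonpos[rotated])
    then show ?thesis by (simp add: power2_eq_square power3_eq_cube algebra_simps)
  next
    case False
    define r where "r = - s'"
    have r: "0 \<le> r" "r \<le> 1" using False s(2) unfolding r_def by auto
    \<comment> \<open>The tangent line bound for the cube at 2/5, a point close to
      \<open>1 / sqrt 6\<close>, where \<open>r - 2 * r ^ 3\<close> has its maximum.\<close>
    have "0 \<le> (r - 2/5)\<^sup>2 * (r + 4/5)" using r by simp
    also have "\<dots> = r ^ 3 - 12/25 * r + 16/125" by (simp add: power2_eq_square power3_eq_cube field_simps)
    finally have "12/25 * r - 16/125 \<le> r ^ 3" by simp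
    then have "r - 2 * r ^ 3 \<le> 3/10" using r by linarith
    then show ?thesis unfolding r_def by simp
  qed
  define U where "U = (2 * s ^ 3 - s) - (2 * s' ^ 3 - s')"
  have le: "(1 - t) * (1/4) \<le> (1 - t) * U" "t * (1/4) \<le> t * (s - s')"
    by (rule mult_left_mono; use t u u' far False U_def in linarith)+
  have "1/4 = (1 - t) * (1/4) + t * (1/4)" by (simp add: field_simps)
  also have "\<dots> \<le> (1 - t) * U + t * (s - s')" using le by (rule add_mono)
  finally have d: "1/4 \<le> (1 - t) * U + t * (s - s')" .
  have eq: "((1 - t) * (2 * s ^ 3 - s) + t * s) - ((1 - t) * (2 * s' ^ 3 - s') + t * s') = (1 - t) * U + t * (s - s')"
    unfolding U_def by (simp add: algebra_simps)
  \<comment> \<open>The parameters differ by at most 2, which is 8 times the gap 1/4.\<close>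
  have "\<bar>s - s'\<bar> \<le> 8 * \<bar>Q\<bar>" if "1/4 \<le> Q" for Q using s that by linarith
  then show ?thesis unfolding eq using d by blast
qed

text \<open>The abscissa is odd in the parameter at every time, so negative parameters reduce to
  positive ones.\<close>

lemma kink_path_bilipschitz:
  fixes s s' t :: real
  assumes s: "\<bar>s\<bar> \<le> 1" "\<bar>s'\<bar> \<le> 1" and t: "0 \<le> t" "t \<le> 1" and far: "9/10 < \<bar>s\<bar> \<or> 9/10 < \<bar>s'\<bar>"
  shows "\<bar>s - s'\<bar> \<le> 8 * \<bar>((1 - t) * (2 * s ^ 3 - s) + t * s) - ((1 - t) * (2 * s' ^ 3 - s') + t * s')\<bar>"
proof -
  define x where "x s = (1 - t) * (2 * s ^ 3 - s) + t * s" for s :: real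
  have odd: "x (- s) = - x s" for s unfolding x_def by (simp add: algebra_simps)
  have *: "\<bar>s - s'\<bar> \<le> 8 * \<bar>x s - x s'\<bar>" if "\<bar>s\<bar> \<le> 1" "\<bar>s'\<bar> \<le> 1" "9/10 < s" for s s'
    unfolding x_def using kink_path_separation[OF that(1,2) t that(3)] .
  have **: "\<bar>s - s'\<bar> \<le> 8 * \<bar>x s - x s'\<bar>" if a: "\<bar>s\<bar> \<le> 1" "\<bar>s'\<bar> \<le> 1" "9/10 < \<bar>s\<bar>" for s s'
  proof (cases "0 \<le> s")
    case True
    then show ?thesis using *[of s s'] a by simp
  next
    case False
    then have "\<bar>- s - - s'\<bar> \<le> 8 * \<bar>x (- s) - x (- s')\<bar>" using a by (intro *) simp_all
    moreover have "- s - - s' = - (s - s')" "x (- s) - x (- s') = - (x s - x s')" by (simp_all add: odd)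
    ultimately show ?thesis by (simp only: abs_minus_cancel)
  qed
  have "\<bar>s - s'\<bar> \<le> 8 * \<bar>x s - x s'\<bar>"
    using far
  proof
    assume "9/10 < \<bar>s'\<bar>"
    from **[OF s(2,1) this] show ?thesis by (simp only: abs_minus_commute)
  qed (rule **[OF s])
  then show ?thesis unfolding x_def .
qed

text \<open>Each point of the cubic arc moves straight to the point of the segment with the same
  parameter, keeping its height. In the middle part the linear heights separate the points, and near
  the ends the abscissas do; either way the distance of parameters is at most 8 times the distance
  in space.\<close>

lemma unkink:
  assumes e: "\<And>x. 0 < e x \<and> e x < 1" and \<delta>: "\<delta> \<in> {1, - 1}"
  shows "linear_move (raise (\<lambda>k. kink_level e \<delta> (snd k)) kink)
    (raise (\<lambda>k. kink_level e \<delta> (fst (fst k))) (strands straight))"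
proof -
  define \<gamma> where "\<gamma> = kink_level e \<delta>"
  have gc: "continuous_on kink (\<lambda>k. \<gamma> (snd k))" unfolding \<gamma>_def kink_level_def by (intro continuous_intros; simp)
  have gu: "\<forall>k\<in>kink. 0 < \<gamma> (snd k) \<and> \<gamma> (snd k) < 1"
  proof
    fix k assume "k \<in> kink"
    then have "\<bar>snd k\<bar> \<le> 1" unfolding mem_kink by simp
    then show "0 < \<gamma> (snd k) \<and> \<gamma> (snd k) < 1" unfolding \<gamma>_def by (rule kink_level_unit[OF e \<delta>])
  qed
  from unit_margin[OF compact_kink gc gu]
  obtain m where m: "0 < m" "\<And>k. k \<in> kink \<Longrightarrow> m \<le> \<gamma> (snd k) \<and> \<gamma> (snd k) \<le> 1 - m" by blast
  define x where "x s = 2 * s ^ 3 - s" for s :: real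
  define y where "y s = (1 - s\<^sup>2) / 2" for s :: real
  define p where "p k = (fst k, \<gamma> (snd k))" for k :: space
  define q where "q k = ((snd k, 0 :: real), \<gamma> (snd k))" for k :: space
  have K: "\<bar>snd k\<bar> \<le> 1" "fst k = (x (snd k), y (snd k))" if "k \<in> kink" for k
    using that unfolding mem_kink x_def y_def by auto
  have v: "q k - p k = ((snd k - x (snd k), - y (snd k)), 0)" if "k \<in> kink" for k
    unfolding p_def q_def K(2)[OF that] by simp
  have pt: "p k + t *\<^sub>R (q k - p k) =
      (((1 - t) * x (snd k) + t * snd k, (1 - t) * y (snd k)), \<gamma> (snd k))" if "k \<in> kink" for k t
    unfolding p_def q_def K(2)[OF that] by (simp add: algebra_simps)
  have nv: "norm (((a, b), 0) :: space) \<le> \<bar>a\<bar> + \<bar>b\<bar>" for a b :: real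
    using abs_components_le_norm(4)[of "((a, b), 0)"] by simp
  \<comment> \<open>The horizontal displacement contributes 8 to the constant and the vertical one
    contributes 1.\<close>
  have lip: "\<bar>(s - x s) - (s' - x s')\<bar> + \<bar>y s - y s'\<bar> \<le> 9 * \<bar>s - s'\<bar>" if s: "\<bar>s\<bar> \<le> 1" "\<bar>s'\<bar> \<le> 1" for s s'
  proof -
    have 1: "(s - x s) - (s' - x s') = (s - s') * (2 - 2 * (s * s + s * s' + s' * s'))"
      unfolding x_def by (simp add: power3_eq_cube algebra_simps)
    have "\<bar>s * s\<bar> \<le> 1" "\<bar>s * s'\<bar> \<le> 1" "\<bar>s' * s'\<bar> \<le> 1" unfolding abs_mult by (rule mult_le_one; use s in simp)+
    moreover have "\<bar>2 - 2 * (a + b + c)\<bar> \<le> 8" if "\<bar>a\<bar> \<le> 1" "\<bar>b\<bar> \<le> 1" "\<bar>c\<bar> \<le> 1" for a b c :: real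
      using that by (auto simp: abs_le_iff)
    ultimately have "\<bar>2 - 2 * (s * s + s * s' + s' * s')\<bar> \<le> 8" by blast
    then have "\<bar>s - s'\<bar> * \<bar>2 - 2 * (s * s + s * s' + s' * s')\<bar> \<le> \<bar>s - s'\<bar> * 8" by (intro mult_left_mono) auto
    moreover have 2: "y s - y s' = (s - s') * (- (s + s') / 2)"
      unfolding y_def by (simp add: power2_eq_square field_simps)
    have "\<bar>- (s + s') / 2\<bar> \<le> 1" using s by simp
    then have "\<bar>s - s'\<bar> * \<bar>- (s + s') / 2\<bar> \<le> \<bar>s - s'\<bar> * 1" by (intro mult_left_mono) auto
    ultimately show ?thesis unfolding 1 2 abs_mult by linarith
  qed
  have "linear_motion kink p q" unfolding linear_motion_def
  \<comment> \<open>72 is the displacement constant 9 times the factor 8 between parameters and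
    positions.\<close>
  proof (rule exI[of _ "72 + (9 + 2 * 9 + 9 / m)"], intro ballI conjI allI impI)
    fix t :: real and k assume "t \<in> {0..1}" and k: "k \<in> kink"
    then have t: "0 \<le> t" "t \<le> 1" by auto
    define s where "s = snd k"
    note Kk = K[OF k, folded s_def]
    have C: "0 \<le> 9 / m" using m(1) by simp
    {
      fix k' assume k': "k' \<in> kink"
      define s' where "s' = snd k'"
      note Kk' = K[OF k', folded s'_def]
      define D where "D = dist (p k + t *\<^sub>R (q k - p k)) (p k' + t *\<^sub>R (q k' - p k'))"
      have D: "\<bar>((1 - t) * x s + t * s) - ((1 - t) * x s' + t * s')\<bar> \<le> D" "\<bar>\<gamma> s - \<gamma> s'\<bar> \<le> D"
        using abs_components_le_norm(1,3)[of "(p k + t *\<^sub>R (q k - p k)) - (p k' + t *\<^sub>R (q k' - p k'))"]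
        unfolding D_def dist_norm pt[OF k] pt[OF k'] s_def s'_def by simp_all
      have "\<bar>s - s'\<bar> \<le> 8 * D"
      proof (cases "9/10 < \<bar>s\<bar> \<or> 9/10 < \<bar>s'\<bar>")
        case True
        note kink_path_bilipschitz[OF Kk(1) Kk'(1) t this, folded x_def]
        also have "8 * \<bar>((1 - t) * x s + t * s) - ((1 - t) * x s' + t * s')\<bar> \<le> 8 * D"
          using D(1) by (rule mult_left_mono) simp
        finally show ?thesis .
      next
        case False
        then have "\<gamma> s - \<gamma> s' = \<delta> * (s - s') / 4"
          unfolding \<gamma>_def by (simp add: kink_level_middle algebra_simps diff_divide_distrib)
        then have "\<bar>\<gamma> s - \<gamma> s'\<bar> = \<bar>\<delta> * (s - s') / 4\<bar>" by (rule arg_cong)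
        also have "\<dots> = \<bar>\<delta>\<bar> * \<bar>s - s'\<bar> / 4" by (simp add: abs_mult)
        finally have "\<bar>\<gamma> s - \<gamma> s'\<bar> = \<bar>\<delta>\<bar> * \<bar>s - s'\<bar> / 4" .
        then have "\<bar>s - s'\<bar> = 4 * \<bar>\<gamma> s - \<gamma> s'\<bar>" using \<delta> by auto
        then show ?thesis using D(2) abs_ge_zero[of "\<gamma> s - \<gamma> s'"] by simp
      qed
      then have "\<bar>(s - x s) - (s' - x s')\<bar> + \<bar>y s - y s'\<bar> \<le> 72 * D" using lip[OF Kk(1) Kk'(1)] by simp
      also have "72 * D \<le> (72 + (9 + 2 * 9 + 9 / m)) * D"
        using C by (intro mult_right_mono) (auto simp: D_def)
      finally have "\<bar>(s - x s) - (s' - x s')\<bar> + \<bar>y s - y s'\<bar> \<le> (72 + (9 + 2 * 9 + 9 / m)) * D" .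
      moreover have "(q k - p k) - (q k' - p k') = (((s - x s) - (s' - x s'), - (y s - y s')), 0)"
        unfolding v[OF k] v[OF k'] s_def s'_def by simp
      ultimately show "norm ((q k - p k) - (q k' - p k')) \<le>
          (72 + (9 + 2 * 9 + 9 / m)) * dist (p k + t *\<^sub>R (q k - p k)) (p k' + t *\<^sub>R (q k' - p k'))"
        unfolding D_def[symmetric]
        using nv[of "(s - x s) - (s' - x s')" "- (y s - y s')"] by simp
    next
      fix X assume X: "X \<notin> cell"
      have "x 1 = 1" "x (- 1) = - 1" "y 1 = 0" "y (- 1) = 0" unfolding x_def y_def by auto
      \<comment> \<open>The displacement vanishes at the parameters 1 and -1, so its Lipschitz bound
        gives linear decay towards the ends.\<close>
      then have "\<bar>s - x s\<bar> + \<bar>y s\<bar> \<le> 9 * \<bar>s - 1\<bar>" "\<bar>s - x s\<bar> + \<bar>y s\<bar> \<le> 9 * \<bar>s - (- 1)\<bar>"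
        using lip[OF Kk(1), of 1] lip[OF Kk(1), of "- 1"] by simp_all
      then have n1: "\<bar>s - x s\<bar> + \<bar>y s\<bar> \<le> 9 * (1 - \<bar>s\<bar>)" using Kk(1) by (cases "0 \<le> s") simp_all
      have nvk: "norm (q k - p k) \<le> \<bar>s - x s\<bar> + \<bar>y s\<bar>" unfolding v[OF k] s_def using nv[of "snd k - x (snd k)" "- y (snd k)"] by simp
      have y: "0 \<le> y s" "y s \<le> 1/2" using Kk(1) unfolding y_def by (simp_all add: abs_square_le_1)
      have xb: "\<bar>x s\<bar> \<le> \<bar>s\<bar>" unfolding x_def by (rule kink_x_bound[OF Kk(1)])
      have "\<bar>(1 - t) * x s + t * s\<bar> \<le> (1 - t) * \<bar>x s\<bar> + t * \<bar>s\<bar>"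
        using t abs_triangle_ineq[of "(1 - t) * x s" "t * s"] by (simp add: abs_mult)
      also have "\<dots> \<le> (1 - t) * \<bar>s\<bar> + t * \<bar>s\<bar>" using t xb by (intro add_mono mult_left_mono) auto
      finally have xt: "\<bar>(1 - t) * x s + t * s\<bar> \<le> \<bar>s\<bar>" by (simp add: algebra_simps)
      have "(1 - t) * y s \<le> 1 * (1/2)" using t y by (intro mult_mono) auto
      then have yt: "\<bar>(1 - t) * y s\<bar> \<le> 1/2" using t y by simp
      have mk: "m \<le> \<gamma> s" "\<gamma> s \<le> 1 - m" using m(2)[OF k] unfolding s_def by auto
      have "norm (q k - p k) \<le> 9 * (1 - \<bar>s\<bar>)" using nvk n1 by (rule order_trans)
      moreover from this have "norm (q k - p k) \<le> 9" by simp
      ultimately have "norm (q k - p k) \<le> (9 + 2 * 9 + 9 / m) * dist (p k + t *\<^sub>R (q k - p k)) X"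
        unfolding pt[OF k] s_def[symmetric]
        by (intro cell_boundary_distance[OF X xt yt mk m(1)]) simp_all
      also have "\<dots> \<le> (72 + (9 + 2 * 9 + 9 / m)) * dist (p k + t *\<^sub>R (q k - p k)) X"
        by (intro mult_right_mono) auto
      finally show "norm (q k - p k) \<le> (72 + (9 + 2 * 9 + 9 / m)) * dist (p k + t *\<^sub>R (q k - p k)) X" .
    }
  qed
  moreover have "raise (\<lambda>k. \<gamma> (snd k)) kink = p ` kink" unfolding raise_def p_def ..
  moreover have "raise (\<lambda>k. \<gamma> (fst (fst k))) (strands straight) = q ` kink"
  proof (intro equalityI subsetI)
    fix z assume "z \<in> raise (\<lambda>k. \<gamma> (fst (fst k))) (strands straight)"
    then obtain k where k: "k \<in> strands straight" "z = (fst k, \<gamma> (fst (fst k)))" unfolding raise_def by blast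
    define k0 where "k0 = ((x (fst (fst k)), y (fst (fst k))), fst (fst k))"
    have "k0 \<in> kink" using k(1) unfolding k0_def mem_kink straight_graphs mem_graphs x_def y_def by simp
    moreover have "z = q k0" using k unfolding k0_def q_def straight_graphs mem_graphs by (simp add: prod_eq_iff)
    ultimately show "z \<in> q ` kink" by blast
  next
    fix z assume "z \<in> q ` kink"
    then obtain k where k: "k \<in> kink" "z = q k" by blast
    have "((snd k, 0), 0) \<in> strands straight" using K(1)[OF k(1)] unfolding straight_graphs mem_graphs by simp
    then show "z \<in> raise (\<lambda>k. \<gamma> (fst (fst k))) (strands straight)"
      unfolding raise_def k(2) q_def by (rule image_eqI[rotated]) simp
  qed
  ultimately show ?thesis unfolding linear_move_def \<gamma>_def by blast
qed

lemma kink_isotopic: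
  assumes M: "strands M = kink" and \<delta>: "\<delta> \<in> {1, - 1}"
    and order: "\<And>k. k \<in> kink \<Longrightarrow> (snd k)\<^sup>2 = 1/2 \<Longrightarrow> k \<in> overs (resolve \<epsilon> M) \<Longrightarrow> 0 < \<delta> * snd k"
  shows "model_isotopic (resolve \<epsilon> M) (resolve \<epsilon> straight)"
  unfolding model_isotopic_def
proof (intro allI impI)
  fix e :: "plane \<Rightarrow> real" assume "\<forall>x. 0 < e x \<and> e x < 1"
  then have e: "\<And>x. 0 < e x \<and> e x < 1" by blast
  have "model_heights e (resolve \<epsilon> M) (\<lambda>k. kink_level e \<delta> (snd k))"
    by (rule kink_heights[OF _ e \<delta> order]) (simp_all only: resolve_simps(1) M)
  moreover have "model_heights e (resolve \<epsilon> straight) (\<lambda>k. kink_level e \<delta> (fst (fst k)))"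
    by (rule straight_heights[OF _ e \<delta>]) (simp only: resolve_simps(1))
  ultimately show "\<exists>g g'. model_heights e (resolve \<epsilon> M) g \<and> model_heights e (resolve \<epsilon> straight) g' \<and>
      linear_move\<^sup>*\<^sup>* (raise g (strands (resolve \<epsilon> M))) (raise g' (strands (resolve \<epsilon> straight)))"
    unfolding resolve_simps(1) M using unkink[where e = e, OF e \<delta>] by blast
qed

lemma half_square_cases:
  fixes s :: real
  assumes "s\<^sup>2 = 1/2"
  shows "s = 1 / sqrt 2 \<or> s = - (1 / sqrt 2)"
proof -
  have "s\<^sup>2 = (1 / sqrt 2)\<^sup>2" using assms by (simp add: power_divide)
  then show ?thesis by (simp only: power2_eq_iff)
qed

text \<open>The branch with positive parameter is over. The other branch cannot be added by
  resolving, as the node already has an over point.\<close>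

lemma R1_isotopic: "model_isotopic (resolve \<epsilon> classical_kink) (resolve \<epsilon> straight)"
proof (rule kink_isotopic[of _ 1])
  show M: "strands classical_kink = kink" by (simp add: classical_kink_def)
  fix k assume k: "k \<in> kink" "(snd k)\<^sup>2 = 1/2" "k \<in> overs (resolve \<epsilon> classical_kink)"
  have pos: "0 < 1 / sqrt 2" by simp
  show "0 < 1 * snd k"
  proof (cases "k \<in> overs classical_kink")
    case True
    then show ?thesis by (simp add: classical_kink_def)
  next
    case False
    then have "k \<in> prepoints classical_kink" using k(3) resolved_over by blast
    then obtain l where l: "l \<in> kink" "k \<noteq> l" "fst k = fst l" "l \<notin> overs classical_kink"
      unfolding prepoints_def M by blast
    note d = kink_double[OF k(1) l(1-3)]
    have over: "j \<in> overs classical_kink" if "j \<in> kink" "snd j = 1 / sqrt 2" for j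
    proof -
      have "(1 / sqrt 2)\<^sup>2 = (1/2 :: real)" "(1 / sqrt 2) ^ 3 = (1 / sqrt 2) * (1/2 :: real)"
        by (simp_all add: power_divide power3_eq_cube)
      then have "fst j = (0, 1/4)" using that unfolding mem_kink by simp
      then have "j = ((0, 1/4), 1 / sqrt 2)" using that(2) by (intro prod_eqI) simp_all
      then show ?thesis by (simp add: classical_kink_def)
    qed
    have "snd k = 1 / sqrt 2 \<or> snd l = 1 / sqrt 2" using half_square_cases[OF k(2)] d(1) by auto
    then show ?thesis using over k(1) l(1,4) False by blast
  qed
qed simp

text \<open>Either choice at the precrossing gives a classical kink; the sign \<delta> is taken such
  that the heights rise towards the chosen over branch.\<close>

lemma PR1_isotopic: "model_isotopic (resolve \<epsilon> (pre_kink c b)) (resolve \<epsilon> straight)"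
proof (rule kink_isotopic[of _ "if b = \<epsilon> c then 1 else - 1"])
  show "strands (pre_kink c b) = kink" by (simp add: pre_kink_def)
  fix k assume k: "k \<in> kink" "(snd k)\<^sup>2 = 1/2" "k \<in> overs (resolve \<epsilon> (pre_kink c b))"
  have "((snd k = 1 / sqrt 2) = b) = \<epsilon> c" using k(3) by (simp add: pre_kink_def mark_strand_def)
  moreover have "0 < 1 / sqrt 2" by simp
  ultimately show "0 < (if b = \<epsilon> c then 1 else - 1) * snd k"
    using half_square_cases[OF k(2)] by (cases b; cases "\<epsilon> c") auto
qed simp

section \<open>Invariance of the weighted resolution set\<close>

lemma transfers_reidemeister:
  assumes D: "motif \<Lambda> D" "motif \<Lambda> D'" and M: "reidemeister_model M M'" and move: "local_move \<Lambda> M M' D D'"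
  shows "transfers D D' \<and> transfers D' D"
proof -
  have s: "1 \<in> {1, - 1 :: real}" "- 1 \<in> {1, - 1 :: real}" by auto
  have k: "box_model classical_kink" "box_model (pre_kink c b)" for c b
    by (rule box_model_kink; simp add: classical_kink_def pre_kink_def)+
  have "box_model M \<and> box_model M' \<and> (\<forall>\<epsilon>. model_isotopic (resolve \<epsilon> M) (resolve \<epsilon> M'))"
    using M
  proof cases
    case R1
    then show ?thesis using k(1) box_model_straight R1_isotopic by blast
  next
    case R2
    then show ?thesis using box_model_twists R2_isotopic by blast
  next
    case R3
    then show ?thesis using box_model_triangles(1) s R3_isotopic by blast
  next
    case PR1
    then show ?thesis using k(2) box_model_straight PR1_isotopic by blast
  next
    case PR2
    then show ?thesis using box_model_twists PR2_isotopic by blast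
  next
    case PR3
    then show ?thesis using box_model_triangles(2) s PR3_isotopic by blast
  next
    case PR3'
    then show ?thesis using box_model_triangles(2) s PR3_isotopic by blast
  qed
  then show ?thesis using transfers_local_move[OF D move] by blast
qed

section \<open>Resolution events and their probabilities\<close>

definition resolving :: "pseudo_diagram \<Rightarrow> space set \<Rightarrow> (nat \<Rightarrow> bool) set" where
  "resolving D T = {\<epsilon>. \<exists>T'. resolution D \<epsilon> T' \<and> DP_isotopic T T'}"

lemma resolving_eq_transfers:
  assumes "transfers D D'" "transfers D' D"
  shows "resolving D T = resolving D' T"
  using assms DP_isotopic_trans unfolding resolving_def transfers_def by blast

lemma resolve_cong:
  assumes "\<And>c. c \<in> precrossing_classes D \<Longrightarrow> \<epsilon> c = \<epsilon>' c"
  shows "resolve \<epsilon> D = resolve \<epsilon>' D"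
proof -
  have "{k \<in> prepoints D. snd (marking D k) = \<epsilon> (fst (marking D k))} =
      {k \<in> prepoints D. snd (marking D k) = \<epsilon>' (fst (marking D k))}"
    using assms unfolding precrossing_classes_def by auto
  then show ?thesis unfolding resolve_def by simp
qed

lemma prepoints_crossings:
  assumes "k \<in> prepoints D"
  shows "fst k \<in> crossings D"
proof -
  obtain l where l: "k \<in> strands D" "l \<in> strands D" "k \<noteq> l" "fst k = fst l"
    using assms unfolding prepoints_def by blast
  have "k \<noteq> l \<and> fst k = fst k \<and> fst l = fst k" using l(3,4) by simp
  with l(1,2) show ?thesis unfolding crossings_def by blast
qed

text \<open>The crossings form finitely many orbits. The class is constant along an orbit and common
  to both strand points of a precrossing, so each orbit contributes at most one class.\<close>

lemma finite_precrossing_classes: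
  assumes D: "motif \<Lambda> D"
  shows "finite (precrossing_classes D)"
proof -
  obtain F where F: "finite F" "crossings D \<subseteq> {x + w | x w. x \<in> F \<and> w \<in> \<Lambda>}"
    using motifD(6)[OF D] by blast
  \<comment> \<open>Either prepoint over \<open>x\<close> may be chosen, since both bear the same
    class.\<close>
  define cl where "cl x = fst (marking D (SOME k. k \<in> prepoints D \<and> fst k = x))" for x
  have "precrossing_classes D \<subseteq> cl ` F"
  proof
    fix c assume "c \<in> precrossing_classes D"
    then obtain k where k: "k \<in> prepoints D" "c = fst (marking D k)" unfolding precrossing_classes_def by blast
    have "fst k \<in> crossings D" by (rule prepoints_crossings[OF k(1)])
    then obtain x w where xw: "x \<in> F" "w \<in> \<Lambda>" "fst k = x + w" using F(2) by blast
    have nw: "- w \<in> \<Lambda>" using lattice_uminus[OF motifD(1)[OF D] xw(2)] .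
    define k0 where "k0 = shift (- w) k"
    have k0: "k0 \<in> prepoints D" "fst k0 = x" "marking D k0 = marking D k"
    proof -
      show "k0 \<in> prepoints D" using motif_shift(3)[OF D nw, of k] k(1) unfolding k0_def by blast
      show "fst k0 = x" unfolding k0_def using xw(3) by simp
      show "marking D k0 = marking D k" unfolding k0_def by (rule motifD(5)[OF D nw k(1)])
    qed
    define l where "l = (SOME k. k \<in> prepoints D \<and> fst k = x)"
    have l: "l \<in> prepoints D \<and> fst l = x" unfolding l_def
      by (rule someI[of _ k0]) (intro conjI k0(1,2))
    have "fst (marking D l) = fst (marking D k0)"
    proof (cases "l = k0")
      case False
      have "fst l = fst k0" using l k0(2) by simp
      with motifD(9)[OF D conjunct1[OF l] k0(1) False] show ?thesis by blast
    qed simp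
    then have "c = cl x" unfolding cl_def l_def[symmetric] using k0(3) k(2) by simp
    then show "c \<in> cl ` F" using xw(1) by blast
  qed
  then show ?thesis by (rule finite_subset) (intro finite_imageI F(1))
qed

text \<open>A move such as PR1 can create or remove a class, so equal events are measured over
  different index sets. An event determined by \<open>A\<close> and also by \<open>B\<close> is
  determined by their intersection, and both product measures have the same marginal there.\<close>

lemma Pi_pmf_prob_eq:
  fixes E :: "('a \<Rightarrow> 'b) set"
  assumes fin: "finite A" "finite B"
    and A: "\<And>f g. (\<And>x. x \<in> A \<Longrightarrow> f x = g x) \<Longrightarrow> f \<in> E \<longleftrightarrow> g \<in> E"
    and B: "\<And>f g. (\<And>x. x \<in> B \<Longrightarrow> f x = g x) \<Longrightarrow> f \<in> E \<longleftrightarrow> g \<in> E"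
  shows "measure_pmf.prob (Pi_pmf A d p) E = measure_pmf.prob (Pi_pmf B d p) E"
proof -
  have AB: "f \<in> E \<longleftrightarrow> g \<in> E" if "\<And>x. x \<in> A \<inter> B \<Longrightarrow> f x = g x" for f g
  proof -
    \<comment> \<open>A hybrid that agrees with \<open>f\<close> on \<open>A\<close>, and with
      \<open>g\<close> on \<open>B\<close> because \<open>f\<close> and \<open>g\<close> agree on
      the intersection.\<close>
    define h where "h x = (if x \<in> A then f x else g x)" for x
    have "f \<in> E \<longleftrightarrow> h \<in> E" by (rule A) (simp add: h_def)
    also have "\<dots> \<longleftrightarrow> g \<in> E" by (rule B) (use that in \<open>auto simp: h_def\<close>)
    finally show ?thesis .
  qed
  have "measure_pmf.prob (Pi_pmf C d p) E = measure_pmf.prob (Pi_pmf (A \<inter> B) d p) E"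
    if "finite C" "A \<inter> B \<subseteq> C" for C
  proof -
    \<comment> \<open>Resetting all values outside the intersection to the default does not affect
      membership, so passing to the marginal preserves the probability.\<close>
    have "(\<lambda>f x. if x \<in> A \<inter> B then f x else d) -` E = E"
    proof (rule set_eqI)
      fix f
      have "(\<lambda>x. if x \<in> A \<inter> B then f x else d) \<in> E \<longleftrightarrow> f \<in> E" by (rule AB) simp
      then show "f \<in> (\<lambda>f x. if x \<in> A \<inter> B then f x else d) -` E \<longleftrightarrow> f \<in> E" by (simp only: vimage_eq)
    qed
    then show ?thesis unfolding Pi_pmf_subset[OF that] by simp
  qed
  note C = this
  show ?thesis using C[OF fin(1) Int_lower1] C[OF fin(2) Int_lower2] by (rule trans[OF _ sym])
qed

lemma prob_transfers:
  assumes D: "motif \<Lambda> D" and D': "motif \<Lambda>' D'" and eq: "resolving D T = resolving D' T"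
  shows "measure_pmf.prob (random_assignment D) (resolving D T) = measure_pmf.prob (random_assignment D') (resolving D' T)"
proof -
  have dep: "\<epsilon> \<in> resolving D T \<longleftrightarrow> \<epsilon>' \<in> resolving D T" if "\<And>c. c \<in> precrossing_classes D \<Longrightarrow> \<epsilon> c = \<epsilon>' c" for D \<epsilon> \<epsilon>'
  proof -
    have "resolve \<epsilon> D = resolve \<epsilon>' D" by (rule resolve_cong) (rule that)
    then show ?thesis unfolding resolving_def resolution_def by simp
  qed
  show ?thesis unfolding random_assignment_def eq
  proof (rule Pi_pmf_prob_eq[OF finite_precrossing_classes[OF D] finite_precrossing_classes[OF D']])
    fix f g :: "nat \<Rightarrow> bool" assume "\<And>x. x \<in> precrossing_classes D \<Longrightarrow> f x = g x"
    then show "f \<in> resolving D' T \<longleftrightarrow> g \<in> resolving D' T" unfolding eq[symmetric] by (rule dep)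
  next
    fix f g :: "nat \<Rightarrow> bool" assume "\<And>x. x \<in> precrossing_classes D' \<Longrightarrow> f x = g x"
    then show "f \<in> resolving D' T \<longleftrightarrow> g \<in> resolving D' T" by (rule dep)
  qed
qed

lemma WeRe_altdef:
  "up_to_DP_isotopy (WeRe D) =
    {(DP_isotopy_class T, measure_pmf.prob (random_assignment D) (resolving D T)) | T. \<exists>\<epsilon>. resolution D \<epsilon> T}"
  unfolding up_to_DP_isotopy_def WeRe_def resolving_def by auto

lemma resolving_cong: "DP_isotopic T T' \<Longrightarrow> resolving D T = resolving D T'"
  unfolding resolving_def using DP_isotopic_trans DP_isotopic_sym by blast

lemma DP_isotopy_class_cong: "DP_isotopic T T' \<Longrightarrow> DP_isotopy_class T = DP_isotopy_class T'"
  unfolding DP_isotopy_class_def using DP_isotopic_trans DP_isotopic_sym by blast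

text \<open>The assignment may differ between the two diagrams; this form serves the moves that keep
  assignments as well as renamings. Both entries of a pair depend only on the isotopy class of the
  tangle.\<close>

lemma WeRe_subset:
  assumes res: "\<And>\<epsilon> T. resolution D \<epsilon> T \<Longrightarrow> \<exists>\<epsilon>' T'. resolution D' \<epsilon>' T' \<and> DP_isotopic T T'"
    and prob: "\<And>T. measure_pmf.prob (random_assignment D) (resolving D T) = measure_pmf.prob (random_assignment D') (resolving D' T)"
  shows "up_to_DP_isotopy (WeRe D) \<subseteq> up_to_DP_isotopy (WeRe D')"
proof
  fix z assume "z \<in> up_to_DP_isotopy (WeRe D)"
  then obtain \<epsilon> T where T: "resolution D \<epsilon> T"
    and z: "z = (DP_isotopy_class T, measure_pmf.prob (random_assignment D) (resolving D T))"
    unfolding WeRe_altdef by blast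
  obtain \<epsilon>' T' where T': "resolution D' \<epsilon>' T'" "DP_isotopic T T'" using res[OF T] by blast
  have "z = (DP_isotopy_class T', measure_pmf.prob (random_assignment D') (resolving D' T'))"
    unfolding z prob DP_isotopy_class_cong[OF T'(2)] resolving_cong[OF T'(2)] ..
  then show "z \<in> up_to_DP_isotopy (WeRe D')" unfolding WeRe_altdef using T'(1) by blast
qed

lemma WeRe_transfers:
  assumes D: "motif \<Lambda> D" and D': "motif \<Lambda>' D'" and t: "transfers D D'" "transfers D' D"
  shows "up_to_DP_isotopy (WeRe D) = up_to_DP_isotopy (WeRe D')"
proof
  note p = prob_transfers[OF D D' resolving_eq_transfers[OF t]]
  show "up_to_DP_isotopy (WeRe D) \<subseteq> up_to_DP_isotopy (WeRe D')"
    by (rule WeRe_subset[OF _ p]) (use t(1) in \<open>unfold transfers_def, blast\<close>)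
  show "up_to_DP_isotopy (WeRe D') \<subseteq> up_to_DP_isotopy (WeRe D)"
    by (rule WeRe_subset[OF _ p[symmetric]]) (use t(2) in \<open>unfold transfers_def, blast\<close>)
qed

lemma fair_coin_flip: "map_pmf (\<lambda>b. b \<noteq> c) (bernoulli_pmf (1/2)) = bernoulli_pmf (1/2)"
proof (rule pmf_eqI)
  fix b
  have "pmf (map_pmf (\<lambda>b. b \<noteq> c) (bernoulli_pmf (1/2))) ((b \<noteq> c) \<noteq> c) = pmf (bernoulli_pmf (1/2)) (b \<noteq> c)"
    by (rule pmf_map_inj') (auto simp: inj_def)
  moreover have "((b \<noteq> c) \<noteq> c) = b" by auto
  ultimately have "pmf (map_pmf (\<lambda>b. b \<noteq> c) (bernoulli_pmf (1/2))) b = pmf (bernoulli_pmf (1/2)) (b \<noteq> c)" by simp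
  then show "pmf (map_pmf (\<lambda>b. b \<noteq> c) (bernoulli_pmf (1/2))) b = pmf (bernoulli_pmf (1/2)) b"
    by (cases b; cases c) simp_all
qed

lemma Pi_pmf_map_dependent:
  assumes "finite A"
  shows "Pi_pmf A d (\<lambda>x. map_pmf (f x) (p x)) = map_pmf (\<lambda>h x. if x \<in> A then f x (h x) else d) (Pi_pmf A d' p)"
  unfolding map_pmf_def Pi_pmf_bind[OF assms, where d' = d'] Pi_pmf_return_pmf[OF assms] ..

lemma WeRe_renaming:
  assumes D: "motif \<Lambda> D" and D': "motif \<Lambda> D'" and r: "renaming D D'"
  shows "up_to_DP_isotopy (WeRe D) = up_to_DP_isotopy (WeRe D')"
proof -
  obtain \<rho> flip where st: "strands D' = strands D" "overs D' = overs D" and \<rho>: "inj \<rho>"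
    and m: "\<And>k. k \<in> prepoints D \<Longrightarrow> marking D' k = (\<rho> (fst (marking D k)), snd (marking D k) \<noteq> flip (fst (marking D k)))"
    using r unfolding renaming_def by blast
  have pre: "prepoints D' = prepoints D" unfolding prepoints_def st ..
  \<comment> \<open>Under \<open>\<tau> \<epsilon>\<close> the diagram \<open>D\<close> chooses the
    same over strands as \<open>D'\<close> does under \<open>\<epsilon>\<close>, so the resolutions
    are literally equal.\<close>
  define \<tau> where "\<tau> \<epsilon> c = (\<epsilon> (\<rho> c) \<noteq> flip c)" for \<epsilon> :: "nat \<Rightarrow> bool" and c
  have res: "resolution D' \<epsilon> T \<longleftrightarrow> resolution D (\<tau> \<epsilon>) T" for \<epsilon> T
  proof -
    have "{k \<in> prepoints D'. snd (marking D' k) = \<epsilon> (fst (marking D' k))} =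
        {k \<in> prepoints D. snd (marking D k) = \<tau> \<epsilon> (fst (marking D k))}"
      unfolding pre using m by (auto simp: \<tau>_def)
    then show ?thesis unfolding resolution_def spatial_lift_def resolve_simps st by simp
  qed
  have "\<exists>\<epsilon>'. \<tau> \<epsilon>' = \<epsilon>" for \<epsilon>
  proof
    \<comment> \<open>Flipping twice with the same sign cancels, and injectivity of \<rho> lets the
      classes be read back.\<close>
    show "\<tau> (\<lambda>c. \<epsilon> (inv \<rho> c) \<noteq> flip (inv \<rho> c)) = \<epsilon>" unfolding \<tau>_def using inv_f_f[OF \<rho>] by auto
  qed
  then have surj: "\<exists>\<epsilon>'. resolution D' \<epsilon>' T" if "resolution D \<epsilon> T" for \<epsilon> T using res that by metis
  define A where "A = precrossing_classes D"
  have finA: "finite A" unfolding A_def by (rule finite_precrossing_classes[OF D])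
  have A': "precrossing_classes D' = \<rho> ` A"
    unfolding A_def precrossing_classes_def pre image_image using m by (intro image_cong refl) simp
  let ?p = "bernoulli_pmf (1/2)"
  have bij: "bij_betw \<rho> A (\<rho> ` A)" using \<rho> by (meson inj_on_imp_bij_betw inj_on_subset subset_UNIV)
  have "Pi_pmf A False (\<lambda>_. ?p) = map_pmf (\<lambda>g. g \<circ> \<rho>) (Pi_pmf (\<rho> ` A) False (\<lambda>_. ?p))"
    by (rule Pi_pmf_bij_betw[OF finA bij]) (use \<rho> in \<open>auto dest: injD\<close>)
  moreover have "Pi_pmf A False (\<lambda>c. map_pmf (\<lambda>b. b \<noteq> flip c) ?p) =
      map_pmf (\<lambda>h c. if c \<in> A then h c \<noteq> flip c else False) (Pi_pmf A False (\<lambda>_. ?p))"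
    by (rule Pi_pmf_map_dependent[OF finA])
  \<comment> \<open>Independent fair coins stay independent and fair when they are reindexed by
    \<rho> and flipped by signs that depend only on the class; values outside \<open>A\<close> are
    set to the default of the product measure.\<close>
  ultimately have ra: "random_assignment D =
      map_pmf (\<lambda>g c. if c \<in> A then \<tau> g c else False) (random_assignment D')"
    unfolding random_assignment_def A' A_def[symmetric] fair_coin_flip
    by (simp add: map_pmf_comp \<tau>_def o_def)
  have prob: "measure_pmf.prob (random_assignment D) (resolving D T) = measure_pmf.prob (random_assignment D') (resolving D' T)" for T
  proof -
    \<comment> \<open>The default outside \<open>A\<close> is invisible, since only classes that
      occur influence a resolution.\<close>
    have "resolve (\<lambda>c. if c \<in> A then \<tau> g c else False) D = resolve (\<tau> g) D" for g
      by (rule resolve_cong) (simp add: A_def)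
    then have "(\<lambda>g c. if c \<in> A then \<tau> g c else False) -` resolving D T = resolving D' T"
      unfolding resolving_def res by (simp add: resolution_def)
    then show ?thesis unfolding ra by simp
  qed
  show ?thesis
  proof
    show "up_to_DP_isotopy (WeRe D) \<subseteq> up_to_DP_isotopy (WeRe D')"
      by (rule WeRe_subset[OF _ prob]) (use surj DP_isotopic_refl in blast)
    show "up_to_DP_isotopy (WeRe D') \<subseteq> up_to_DP_isotopy (WeRe D)"
      by (rule WeRe_subset[OF _ prob[symmetric]]) (use res DP_isotopic_refl in blast)
  qed
qed

lemma WeRe_motif_move:
  assumes "motif_move P P'"
  shows "up_to_DP_isotopy (WeRe (fst P)) = up_to_DP_isotopy (WeRe (fst P'))"
  using assms
proof cases
  case (surface_isotopy \<Lambda> D D' H)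
  show ?thesis unfolding surface_isotopy(1,2) fst_conv
    by (rule WeRe_transfers[OF surface_isotopy(3,4) transfers_surface_isotopy[OF surface_isotopy(3-6)]])
next
  case (renaming \<Lambda> D D')
  show ?thesis unfolding renaming(1,2) fst_conv by (rule WeRe_renaming[OF renaming(3-5)])
next
  case (reidemeister \<Lambda> D D' M M')
  note t = transfers_reidemeister[OF reidemeister(3-6)]
  show ?thesis unfolding reidemeister(1,2) fst_conv
    by (rule WeRe_transfers[OF reidemeister(3,4) conjunct1[OF t] conjunct2[OF t]])
next
  case (affine \<Lambda> D L D' w)
  show ?thesis unfolding affine(1,2) fst_conv
    by (rule WeRe_transfers[OF affine(3,4) transfers_affine[OF affine(5,6)]])
next
  \<comment> \<open>The weighted resolution set is defined from the marked diagram alone, so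
    changing the lattice of the motif leaves it untouched.\<close>
  case cover
  then show ?thesis by (simp only: fst_conv)
qed

theorem theorem4p4:
  fixes D D' :: pseudo_diagram
  assumes "pseudo_DP_diagram D" and "pseudo_DP_diagram D'"
    and "pseudo_DP_equivalent D D'"
  shows "up_to_DP_isotopy (WeRe D) = up_to_DP_isotopy (WeRe D')"
proof -
  obtain \<Lambda> \<Lambda>' where "equivclp motif_move (D, \<Lambda>) (D', \<Lambda>')"
    using assms(3) unfolding pseudo_DP_equivalent_def by blast
  then have "up_to_DP_isotopy (WeRe (fst (D, \<Lambda>))) = up_to_DP_isotopy (WeRe (fst (D', \<Lambda>')))"
  proof (induction rule: equivclp_induct)
    case (step P P')
    then show ?case using WeRe_motif_move by metis
  qed simp
  then show ?thesis by simp
qed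

end
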